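(* Suppose that $\mathcal T$ is a rigidly-compactly generated tensor-triangulated category. Then there is a duality (contravariant equivalence) on $\mathrm{mod}\text{-}\mathcal T^{\rm c}$ which is given on objects by $$G_f\mapsto\ker\big((-,f^\vee):(-,B^\vee)\to(-,A^\vee)\big)$$ for $f:A\to B$ in $\mathcal T^{\rm c}$, where $(-)^\vee$ is the duality on $\mathcal T^{\rm c}$.
   Context: $\mathcal T$ is a compactly generated triangulated category: a triangulated category with arbitrary coproducts, with only a set of isomorphism classes of compact objects ($A$ is compact if $(A,-)=\mathrm{Hom}_{\mathcal T}(A,-)$ commutes with coproducts), and such that $(A,X)=0$ for all compact $A$ implies $X=0$. $\mathcal T^{\rm c}$ is the full subcategory of compact objects. Rigidly-compactly generated tensor-triangulated: $\mathcal T$ has a commutative, associative tensor product $\otimes$, exact in each variable, with unit $\mathbbm{1}$; the structure is closed, i.e. there is an internal hom $[-,-]$ right adjoint to $\otimes$, $(X\otimes Y,Z)\simeq(X,[Y,Z])$; and, writing $X^\vee=[X,\mathbbm{1}]$, every compact $A$ is rigid: the natural map $A^\vee\otimes B\to[A,B]$ is an isomorphism for every $B\in\mathcal T^{\rm c}$. It follows that $\mathcal T^{\rm c}$ is closed under $\otimes$ and that $(-)^\vee$ restricts to an anti-equivalence $(\mathcal T^{\rm c})^{\rm op}\simeq\mathcal T^{\rm c}$ with $(-)^{\vee\vee}$ naturally equivalent to the identity. $\mathrm{mod}\text{-}\mathcal T^{\rm c}$ is the category of finitely presented additive functors $(\mathcal T^{\rm c})^{\rm op}\to\mathbf{Ab}$.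 For $f:A\to B$ in $\mathcal T^{\rm c}$, $G_f=\mathrm{coker}\big((-,f):(-,A)\to(-,B)\big)$, where $(-,A)$ denotes the representable functor on $\mathcal T^{\rm c}$; every object of $\mathrm{mod}\text{-}\mathcal T^{\rm c}$ is isomorphic to some $G_f$. The dual of $f$ is $f^\vee:B^\vee\to A^\vee$. *)

theory Defs
  imports "HOL-Algebra.FiniteProduct" "HOL-Algebra.Product_Groups" "HOL-Library.Equipollence"
begin

section \<open>Categories, functors, equivalences\<close>

record ('o, 'm) cat =
  Obj :: "'o set"
  Arr :: "'m set"
  Dom :: "'m \<Rightarrow> 'o"
  Cod :: "'m \<Rightarrow> 'o"
  Ident :: "'o \<Rightarrow> 'm"
  Comp :: "'m \<Rightarrow> 'm \<Rightarrow> 'm"  (infixr "\<cdot>\<index>" 75)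

text \<open>Composition is written in the usual order: \<open>g \<cdot> f\<close> means first \<open>f\<close>, then \<open>g\<close>.\<close>

definition Hom :: "('o, 'm, 'x) cat_scheme \<Rightarrow> 'o \<Rightarrow> 'o \<Rightarrow> 'm set" where
  "Hom C A B = {f \<in> Arr C. Dom C f = A \<and> Cod C f = B}"

locale category =
  fixes C :: "('o, 'm, 'x) cat_scheme" (structure)
  assumes dom_closed: "f \<in> Arr C \<Longrightarrow> Dom C f \<in> Obj C"
    and cod_closed: "f \<in> Arr C \<Longrightarrow> Cod C f \<in> Obj C"
    and ident_closed: "A \<in> Obj C \<Longrightarrow> Ident C A \<in> Hom C A A"
    and comp_closed: "f \<in> Hom C A B \<Longrightarrow> g \<in> Hom C B D \<Longrightarrow> g \<cdot> f \<in> Hom C A D"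
    and comp_assoc: "f \<in> Hom C A B \<Longrightarrow> g \<in> Hom C B D \<Longrightarrow> h \<in> Hom C D E \<Longrightarrow>
                       (h \<cdot> g) \<cdot> f = h \<cdot> (g \<cdot> f)"
    and comp_ident: "f \<in> Hom C A B \<Longrightarrow> f \<cdot> Ident C A = f"
    and ident_comp: "f \<in> Hom C A B \<Longrightarrow> Ident C B \<cdot> f = f"

definition op_cat :: "('o, 'm, 'x) cat_scheme \<Rightarrow> ('o, 'm, 'x) cat_scheme" where
  "op_cat C = C\<lparr>Dom := Cod C, Cod := Dom C, Comp := (\<lambda>g f. Comp C f g)\<rparr>"

definition full_subcat :: "('o, 'm, 'x) cat_scheme \<Rightarrow> 'o set \<Rightarrow> ('o, 'm, 'x) cat_scheme" where
  "full_subcat C S = C\<lparr>Obj := S, Arr := {f \<in> Arr C. Dom C f \<in> S \<and> Cod C f \<in> S}\<rparr>"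

definition inverse_arrs :: "('o, 'm, 'x) cat_scheme \<Rightarrow> 'm \<Rightarrow> 'm \<Rightarrow> bool" where
  "inverse_arrs C f g \<longleftrightarrow>
     f \<in> Arr C \<and> g \<in> Hom C (Cod C f) (Dom C f) \<and>
     g \<cdot>\<^bsub>C\<^esub> f = Ident C (Dom C f) \<and> f \<cdot>\<^bsub>C\<^esub> g = Ident C (Cod C f)"

definition iso_arr :: "('o, 'm, 'x) cat_scheme \<Rightarrow> 'm \<Rightarrow> bool" where
  "iso_arr C f \<longleftrightarrow> (\<exists>g. inverse_arrs C f g)"

definition inv_arr :: "('o, 'm, 'x) cat_scheme \<Rightarrow> 'm \<Rightarrow> 'm" where
  "inv_arr C f = (THE g. inverse_arrs C f g)"

definition iso_objs :: "('o, 'm, 'x) cat_scheme \<Rightarrow> 'o \<Rightarrow> 'o \<Rightarrow> bool" where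
  "iso_objs C A B \<longleftrightarrow> (\<exists>f \<in> Hom C A B. iso_arr C f)"

record ('o, 'm, 'p, 'n) ftr =
  OnObj :: "'o \<Rightarrow> 'p"
  OnArr :: "'m \<Rightarrow> 'n"

definition id_ftr :: "('o, 'm, 'o, 'm) ftr" where
  "id_ftr = \<lparr>OnObj = (\<lambda>A. A), OnArr = (\<lambda>f. f)\<rparr>"

definition comp_ftr ::
  "('p, 'n, 'q, 'k) ftr \<Rightarrow> ('o, 'm, 'p, 'n) ftr \<Rightarrow> ('o, 'm, 'q, 'k) ftr" where
  "comp_ftr G F = \<lparr>OnObj = OnObj G \<circ> OnObj F, OnArr = OnArr G \<circ> OnArr F\<rparr>"

definition is_functor ::
  "('o, 'm, 'x) cat_scheme \<Rightarrow> ('p, 'n, 'y) cat_scheme \<Rightarrow> ('o, 'm, 'p, 'n) ftr \<Rightarrow> bool" where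
  "is_functor C D F \<longleftrightarrow>
     (\<forall>A \<in> Obj C. OnObj F A \<in> Obj D) \<and>
     (\<forall>A \<in> Obj C. \<forall>B \<in> Obj C. \<forall>f \<in> Hom C A B. OnArr F f \<in> Hom D (OnObj F A) (OnObj F B)) \<and>
     (\<forall>A \<in> Obj C. OnArr F (Ident C A) = Ident D (OnObj F A)) \<and>
     (\<forall>f \<in> Arr C. \<forall>g \<in> Arr C. Cod C f = Dom C g \<longrightarrow>
        OnArr F (g \<cdot>\<^bsub>C\<^esub> f) = OnArr F g \<cdot>\<^bsub>D\<^esub> OnArr F f)"

definition natural_iso ::
  "('o, 'm, 'x) cat_scheme \<Rightarrow> ('p, 'n, 'y) cat_scheme \<Rightarrow>
   ('o, 'm, 'p, 'n) ftr \<Rightarrow> ('o, 'm, 'p, 'n) ftr \<Rightarrow> ('o \<Rightarrow> 'n) \<Rightarrow> bool" where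
  "natural_iso C D F G \<eta> \<longleftrightarrow>
     (\<forall>A \<in> Obj C. \<eta> A \<in> Hom D (OnObj F A) (OnObj G A) \<and> iso_arr D (\<eta> A)) \<and>
     (\<forall>f \<in> Arr C. \<eta> (Cod C f) \<cdot>\<^bsub>D\<^esub> OnArr F f = OnArr G f \<cdot>\<^bsub>D\<^esub> \<eta> (Dom C f))"

definition equivalence ::
  "('o, 'm, 'x) cat_scheme \<Rightarrow> ('p, 'n, 'y) cat_scheme \<Rightarrow> ('o, 'm, 'p, 'n) ftr \<Rightarrow> bool" where
  "equivalence C D F \<longleftrightarrow>
     is_functor C D F \<and>
     (\<exists>G. is_functor D C G \<and>
          (\<exists>\<eta>. natural_iso C C id_ftr (comp_ftr G F) \<eta>) \<and>
          (\<exists>\<epsilon>. natural_iso D D (comp_ftr F G) id_ftr \<epsilon>))"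

definition contravariant_equivalence ::
  "('o, 'm, 'x) cat_scheme \<Rightarrow> ('p, 'n, 'y) cat_scheme \<Rightarrow> ('o, 'm, 'p, 'n) ftr \<Rightarrow> bool" where
  "contravariant_equivalence C D F \<longleftrightarrow> equivalence (op_cat C) D F"

definition zero_object :: "('o, 'm, 'x) cat_scheme \<Rightarrow> 'o \<Rightarrow> bool" where
  "zero_object C Z \<longleftrightarrow>
     Z \<in> Obj C \<and> (\<forall>A \<in> Obj C. (\<exists>!f. f \<in> Hom C A Z) \<and> (\<exists>!f. f \<in> Hom C Z A))"

definition is_coproduct ::
  "('o, 'm, 'x) cat_scheme \<Rightarrow> 'i set \<Rightarrow> ('i \<Rightarrow> 'o) \<Rightarrow> 'o \<Rightarrow> ('i \<Rightarrow> 'm) \<Rightarrow> bool" where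
  "is_coproduct C I X S \<iota> \<longleftrightarrow>
     S \<in> Obj C \<and> (\<forall>i \<in> I. X i \<in> Obj C) \<and> (\<forall>i \<in> I. \<iota> i \<in> Hom C (X i) S) \<and>
     (\<forall>Y \<in> Obj C. \<forall>f. (\<forall>i \<in> I. f i \<in> Hom C (X i) Y) \<longrightarrow>
        (\<exists>!h. h \<in> Hom C S Y \<and> (\<forall>i \<in> I. h \<cdot>\<^bsub>C\<^esub> \<iota> i = f i)))"


section \<open>Additive categories\<close>

record ('o, 'm) abcat = "('o, 'm) cat" +
  Add :: "'m \<Rightarrow> 'm \<Rightarrow> 'm"  (infixl "\<boxplus>\<index>" 65)
  Zero :: "'o \<Rightarrow> 'o \<Rightarrow> 'm"

text \<open>The hom groups are multiplicatively written HOL-Algebra groups.\<close>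

definition HomGrp :: "('o, 'm, 'x) abcat_scheme \<Rightarrow> 'o \<Rightarrow> 'o \<Rightarrow> 'm monoid" where
  "HomGrp C A B = \<lparr>carrier = Hom C A B, monoid.mult = Add C, one = Zero C A B\<rparr>"

definition Neg :: "('o, 'm, 'x) abcat_scheme \<Rightarrow> 'm \<Rightarrow> 'm" where
  "Neg C f = inv\<^bsub>HomGrp C (Dom C f) (Cod C f)\<^esub> f"

locale additive_category = category C
  for C :: "('o, 'm, 'x) abcat_scheme" (structure) +
  assumes hom_comm_group: "A \<in> Obj C \<Longrightarrow> B \<in> Obj C \<Longrightarrow> comm_group (HomGrp C A B)"
    and comp_add: "f \<in> Hom C A B \<Longrightarrow> g \<in> Hom C B D \<Longrightarrow> g' \<in> Hom C B D \<Longrightarrow>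
                     (g \<boxplus> g') \<cdot> f = g \<cdot> f \<boxplus> g' \<cdot> f"
    and add_comp: "f \<in> Hom C A B \<Longrightarrow> f' \<in> Hom C A B \<Longrightarrow> g \<in> Hom C B D \<Longrightarrow>
                     g \<cdot> (f \<boxplus> f') = g \<cdot> f \<boxplus> g \<cdot> f'"
    and has_zero_object: "\<exists>Z. zero_object C Z"
    and has_biproducts: "A \<in> Obj C \<Longrightarrow> B \<in> Obj C \<Longrightarrow>
          \<exists>S \<in> Obj C. \<exists>i \<in> Hom C A S. \<exists>j \<in> Hom C B S. \<exists>p \<in> Hom C S A. \<exists>q \<in> Hom C S B.
            p \<cdot> i = Ident C A \<and> q \<cdot> j = Ident C B \<and>
            p \<cdot> j = Zero C B A \<and> q \<cdot> i = Zero C A B \<and>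
            i \<cdot> p \<boxplus> j \<cdot> q = Ident C S"

definition additive_functor ::
  "('o, 'm, 'x) abcat_scheme \<Rightarrow> ('p, 'n, 'y) abcat_scheme \<Rightarrow> ('o, 'm, 'p, 'n) ftr \<Rightarrow> bool" where
  "additive_functor C D F \<longleftrightarrow>
     is_functor C D F \<and>
     (\<forall>A \<in> Obj C. \<forall>B \<in> Obj C. \<forall>f \<in> Hom C A B. \<forall>g \<in> Hom C A B.
        OnArr F (f \<boxplus>\<^bsub>C\<^esub> g) = OnArr F f \<boxplus>\<^bsub>D\<^esub> OnArr F g)"


section \<open>Triangulated categories\<close>

text \<open>\<open>Tri\<close> is the set of distinguished triangles. A triangle \<open>A \<rightarrow> B \<rightarrow> C \<rightarrow> \<Sigma> A\<close> is the triple of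
  its arrows, which determine the objects.\<close>

record ('o, 'm) tricat = "('o, 'm) abcat" +
  Sus :: "('o, 'm, 'o, 'm) ftr"
  Tri :: "('m \<times> 'm \<times> 'm) set"

definition candidate_triangle :: "('o, 'm, 'x) tricat_scheme \<Rightarrow> 'm \<Rightarrow> 'm \<Rightarrow> 'm \<Rightarrow> bool" where
  "candidate_triangle T f g h \<longleftrightarrow>
     f \<in> Arr T \<and> g \<in> Arr T \<and> h \<in> Arr T \<and>
     Dom T g = Cod T f \<and> Dom T h = Cod T g \<and> Cod T h = OnObj (Sus T) (Dom T f)"

locale triangulated_category = additive_category T
  for T :: "('o, 'm, 'x) tricat_scheme" (structure) +
  assumes sus_additive: "additive_functor T T (Sus T)"
    and sus_equivalence: "equivalence T T (Sus T)"
    and tri_candidate: "(f, g, h) \<in> Tri T \<Longrightarrow> candidate_triangle T f g h"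
    and tri_iso: "(f, g, h) \<in> Tri T \<Longrightarrow> candidate_triangle T f' g' h' \<Longrightarrow>
          a \<in> Hom T (Dom T f) (Dom T f') \<Longrightarrow> b \<in> Hom T (Dom T g) (Dom T g') \<Longrightarrow>
          c \<in> Hom T (Dom T h) (Dom T h') \<Longrightarrow> iso_arr T a \<Longrightarrow> iso_arr T b \<Longrightarrow> iso_arr T c \<Longrightarrow>
          b \<cdot> f = f' \<cdot> a \<Longrightarrow> c \<cdot> g = g' \<cdot> b \<Longrightarrow> OnArr (Sus T) a \<cdot> h = h' \<cdot> c \<Longrightarrow>
          (f', g', h') \<in> Tri T"
    and tri_ident: "A \<in> Obj T \<Longrightarrow> zero_object T Z \<Longrightarrow>
          (Ident T A, Zero T A Z, Zero T Z (OnObj (Sus T) A)) \<in> Tri T"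
    and tri_complete: "f \<in> Arr T \<Longrightarrow> \<exists>g h. (f, g, h) \<in> Tri T"
    and tri_rotate: "candidate_triangle T f g h \<Longrightarrow>
          (f, g, h) \<in> Tri T \<longleftrightarrow> (g, h, Neg T (OnArr (Sus T) f)) \<in> Tri T"
    and tri_morphism: "(f, g, h) \<in> Tri T \<Longrightarrow> (f', g', h') \<in> Tri T \<Longrightarrow>
          a \<in> Hom T (Dom T f) (Dom T f') \<Longrightarrow> b \<in> Hom T (Dom T g) (Dom T g') \<Longrightarrow>
          b \<cdot> f = f' \<cdot> a \<Longrightarrow>
          \<exists>c \<in> Hom T (Dom T h) (Dom T h'). c \<cdot> g = g' \<cdot> b \<and> OnArr (Sus T) a \<cdot> h = h' \<cdot> c"
    and tri_octahedron: "f \<in> Hom T A B \<Longrightarrow> g \<in> Hom T B C \<Longrightarrow>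
          (f, u, v) \<in> Tri T \<Longrightarrow> (g \<cdot> f, r, s) \<in> Tri T \<Longrightarrow> (g, p, q) \<in> Tri T \<Longrightarrow>
          \<exists>d e. d \<in> Hom T (Cod T u) (Cod T r) \<and> e \<in> Hom T (Cod T r) (Cod T p) \<and>
            (d, e, OnArr (Sus T) u \<cdot> q) \<in> Tri T \<and>
            d \<cdot> u = r \<cdot> g \<and> s \<cdot> d = v \<and> e \<cdot> r = p \<and> q \<cdot> e = OnArr (Sus T) f \<cdot> s"

definition exact_functor :: "('o, 'm, 'x) tricat_scheme \<Rightarrow> ('o, 'm, 'o, 'm) ftr \<Rightarrow> bool" where
  "exact_functor T F \<longleftrightarrow>
     additive_functor T T F \<and>
     (\<exists>\<eta>. natural_iso T T (comp_ftr F (Sus T)) (comp_ftr (Sus T) F) \<eta> \<and>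
          (\<forall>(f, g, h) \<in> Tri T.
             (OnArr F f, OnArr F g, \<eta> (Dom T f) \<cdot>\<^bsub>T\<^esub> OnArr F h) \<in> Tri T))"


section \<open>Compact objects and compact generation\<close>

text \<open>Smallness is relative to a parameter \<open>U\<close> standing for the universe of all sets: a collection
  is small (``a set'') iff it has strictly smaller cardinality than \<open>U\<close>. If the cardinality of
  \<open>U\<close> is inaccessible, this is smallness with respect to a Grothendieck universe. Small families
  are indexed, without loss of generality, by small sets in the type of elements of \<open>U\<close>.\<close>

abbreviation small :: "'u set \<Rightarrow> 'a set \<Rightarrow> bool" where
  "small U S \<equiv> S \<prec> U"

text \<open>\<open>A\<close> is compact iff for each small coproduct \<open>(\<iota> i : X i \<rightarrow> S)\<^sub>i\<close> the canonical map from the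
  direct sum of the groups \<open>(A, X i)\<close> to \<open>(A, S)\<close>, sending \<open>x\<close> to the finite sum of the arrows
  \<open>\<iota> i \<cdot> x i\<close>, is an isomorphism.\<close>

definition compact_object :: "'u set \<Rightarrow> ('o, 'm, 'x) abcat_scheme \<Rightarrow> 'o \<Rightarrow> bool" where
  "compact_object U C A \<longleftrightarrow>
     A \<in> Obj C \<and>
     (\<forall>(I :: 'u set) X S \<iota>. small U I \<longrightarrow> is_coproduct C I X S \<iota> \<longrightarrow>
        (\<lambda>x. finprod (HomGrp C A S) (\<lambda>i. \<iota> i \<cdot>\<^bsub>C\<^esub> x i) {i \<in> I. x i \<noteq> Zero C A (X i)})
          \<in> iso (sum_group I (\<lambda>i. HomGrp C A (X i))) (HomGrp C A S))"

definition compacts :: "'u set \<Rightarrow> ('o, 'm, 'x) abcat_scheme \<Rightarrow> ('o, 'm, 'x) abcat_scheme" where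
  "compacts U C = full_subcat C {A. compact_object U C A}"

locale compactly_generated = triangulated_category T
  for T :: "('o, 'm, 'x) tricat_scheme" (structure) and U :: "'u set" +
  assumes locally_small: "A \<in> Obj T \<Longrightarrow> B \<in> Obj T \<Longrightarrow> small U (Hom T A B)"
    and has_coproducts: "small U (I :: 'u set) \<Longrightarrow> (\<And>i. i \<in> I \<Longrightarrow> Xs i \<in> Obj T) \<Longrightarrow>
          \<exists>S \<iota>. is_coproduct T I Xs S \<iota>"
    and compacts_skeletally_small:
          "\<exists>S. small U S \<and> S \<subseteq> Obj (compacts U T) \<and>
               (\<forall>A \<in> Obj (compacts U T). \<exists>B \<in> S. iso_objs T A B)"
    and compacts_generate: "X \<in> Obj T \<Longrightarrow>
          (\<And>A. A \<in> Obj (compacts U T) \<Longrightarrow> Hom T A X = {Zero T A X}) \<Longrightarrow> zero_object T X"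


section \<open>Closed tensor-triangulated categories and rigidity\<close>

text \<open>\<open>IHom T Y Z\<close> is the internal hom \<open>[Y, Z]\<close>, and \<open>Adj T X Y Z\<close> is the adjunction bijection from
  \<open>(X \<otimes> Y, Z)\<close> to \<open>(X, [Y, Z])\<close>.\<close>

record ('o, 'm) ttcat = "('o, 'm) tricat" +
  Tens :: "'o \<Rightarrow> 'o \<Rightarrow> 'o"  (infixl "\<boxtimes>\<index>" 80)
  TensA :: "'m \<Rightarrow> 'm \<Rightarrow> 'm"  (infixl "\<boxdot>\<index>" 80)
  TUnit :: "'o"
  Assoc :: "'o \<Rightarrow> 'o \<Rightarrow> 'o \<Rightarrow> 'm"
  LUnit :: "'o \<Rightarrow> 'm"
  RUnit :: "'o \<Rightarrow> 'm"
  Braid :: "'o \<Rightarrow> 'o \<Rightarrow> 'm"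
  IHom :: "'o \<Rightarrow> 'o \<Rightarrow> 'o"
  IHomA :: "'m \<Rightarrow> 'm \<Rightarrow> 'm"
  Adj :: "'o \<Rightarrow> 'o \<Rightarrow> 'o \<Rightarrow> 'm \<Rightarrow> 'm"

locale tensor_triangulated_category = triangulated_category T
  for T :: "('o, 'm, 'x) ttcat_scheme" (structure) +
  assumes tens_obj: "X \<in> Obj T \<Longrightarrow> Y \<in> Obj T \<Longrightarrow> X \<boxtimes> Y \<in> Obj T"
    and tens_arr: "f \<in> Hom T X X' \<Longrightarrow> g \<in> Hom T Y Y' \<Longrightarrow> f \<boxdot> g \<in> Hom T (X \<boxtimes> Y) (X' \<boxtimes> Y')"
    and tens_ident: "X \<in> Obj T \<Longrightarrow> Y \<in> Obj T \<Longrightarrow>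
          Ident T X \<boxdot> Ident T Y = Ident T (X \<boxtimes> Y)"
    and tens_comp: "f \<in> Hom T X X' \<Longrightarrow> f' \<in> Hom T X' X'' \<Longrightarrow>
          g \<in> Hom T Y Y' \<Longrightarrow> g' \<in> Hom T Y' Y'' \<Longrightarrow>
          (f' \<cdot> f) \<boxdot> (g' \<cdot> g) = (f' \<boxdot> g') \<cdot> (f \<boxdot> g)"
    and tunit_obj: "TUnit T \<in> Obj T"
    and assoc_iso: "X \<in> Obj T \<Longrightarrow> Y \<in> Obj T \<Longrightarrow> Z \<in> Obj T \<Longrightarrow>
          Assoc T X Y Z \<in> Hom T ((X \<boxtimes> Y) \<boxtimes> Z) (X \<boxtimes> (Y \<boxtimes> Z)) \<and> iso_arr T (Assoc T X Y Z)"
    and assoc_natural: "f \<in> Hom T X X' \<Longrightarrow> g \<in> Hom T Y Y' \<Longrightarrow> h \<in> Hom T Z Z' \<Longrightarrow>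
          Assoc T X' Y' Z' \<cdot> ((f \<boxdot> g) \<boxdot> h) = (f \<boxdot> (g \<boxdot> h)) \<cdot> Assoc T X Y Z"
    and lunit_iso: "X \<in> Obj T \<Longrightarrow> LUnit T X \<in> Hom T (TUnit T \<boxtimes> X) X \<and> iso_arr T (LUnit T X)"
    and lunit_natural: "f \<in> Hom T X X' \<Longrightarrow>
          LUnit T X' \<cdot> (Ident T (TUnit T) \<boxdot> f) = f \<cdot> LUnit T X"
    and runit_iso: "X \<in> Obj T \<Longrightarrow> RUnit T X \<in> Hom T (X \<boxtimes> TUnit T) X \<and> iso_arr T (RUnit T X)"
    and runit_natural: "f \<in> Hom T X X' \<Longrightarrow>
          RUnit T X' \<cdot> (f \<boxdot> Ident T (TUnit T)) = f \<cdot> RUnit T X"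
    and pentagon: "W \<in> Obj T \<Longrightarrow> X \<in> Obj T \<Longrightarrow> Y \<in> Obj T \<Longrightarrow> Z \<in> Obj T \<Longrightarrow>
          Assoc T W X (Y \<boxtimes> Z) \<cdot> Assoc T (W \<boxtimes> X) Y Z =
          (Ident T W \<boxdot> Assoc T X Y Z) \<cdot> Assoc T W (X \<boxtimes> Y) Z \<cdot> (Assoc T W X Y \<boxdot> Ident T Z)"
    and unit_triangle: "X \<in> Obj T \<Longrightarrow> Y \<in> Obj T \<Longrightarrow>
          (Ident T X \<boxdot> LUnit T Y) \<cdot> Assoc T X (TUnit T) Y = RUnit T X \<boxdot> Ident T Y"
    and braid_arr: "X \<in> Obj T \<Longrightarrow> Y \<in> Obj T \<Longrightarrow> Braid T X Y \<in> Hom T (X \<boxtimes> Y) (Y \<boxtimes> X)"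
    and braid_natural: "f \<in> Hom T X X' \<Longrightarrow> g \<in> Hom T Y Y' \<Longrightarrow>
          Braid T X' Y' \<cdot> (f \<boxdot> g) = (g \<boxdot> f) \<cdot> Braid T X Y"
    and braid_symmetric: "X \<in> Obj T \<Longrightarrow> Y \<in> Obj T \<Longrightarrow>
          Braid T Y X \<cdot> Braid T X Y = Ident T (X \<boxtimes> Y)"
    and hexagon: "X \<in> Obj T \<Longrightarrow> Y \<in> Obj T \<Longrightarrow> Z \<in> Obj T \<Longrightarrow>
          Assoc T Y Z X \<cdot> Braid T X (Y \<boxtimes> Z) \<cdot> Assoc T X Y Z =
          (Ident T Y \<boxdot> Braid T X Z) \<cdot> Assoc T Y X Z \<cdot> (Braid T X Y \<boxdot> Ident T Z)"
    and tens_exact_left: "Y \<in> Obj T \<Longrightarrow>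
          exact_functor T \<lparr>OnObj = (\<lambda>X. X \<boxtimes> Y), OnArr = (\<lambda>f. f \<boxdot> Ident T Y)\<rparr>"
    and tens_exact_right: "X \<in> Obj T \<Longrightarrow>
          exact_functor T \<lparr>OnObj = (\<lambda>Y. X \<boxtimes> Y), OnArr = (\<lambda>f. Ident T X \<boxdot> f)\<rparr>"

locale closed_tensor_triangulated_category = tensor_triangulated_category T
  for T :: "('o, 'm, 'x) ttcat_scheme" (structure) +
  assumes ihom_obj: "Y \<in> Obj T \<Longrightarrow> Z \<in> Obj T \<Longrightarrow> IHom T Y Z \<in> Obj T"
    and ihom_arr: "g \<in> Hom T Y' Y \<Longrightarrow> h \<in> Hom T Z Z' \<Longrightarrow>
          IHomA T g h \<in> Hom T (IHom T Y Z) (IHom T Y' Z')"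
    and ihom_ident: "Y \<in> Obj T \<Longrightarrow> Z \<in> Obj T \<Longrightarrow>
          IHomA T (Ident T Y) (Ident T Z) = Ident T (IHom T Y Z)"
    and ihom_comp: "g \<in> Hom T Y' Y \<Longrightarrow> g' \<in> Hom T Y'' Y' \<Longrightarrow>
          h \<in> Hom T Z Z' \<Longrightarrow> h' \<in> Hom T Z' Z'' \<Longrightarrow>
          IHomA T (g \<cdot> g') (h' \<cdot> h) = IHomA T g' h' \<cdot> IHomA T g h"
    and adj_bij: "X \<in> Obj T \<Longrightarrow> Y \<in> Obj T \<Longrightarrow> Z \<in> Obj T \<Longrightarrow>
          bij_betw (Adj T X Y Z) (Hom T (X \<boxtimes> Y) Z) (Hom T X (IHom T Y Z))"
    and adj_natural: "f \<in> Hom T X' X \<Longrightarrow> g \<in> Hom T Y' Y \<Longrightarrow> h \<in> Hom T Z Z' \<Longrightarrow>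
          t \<in> Hom T (X \<boxtimes> Y) Z \<Longrightarrow>
          Adj T X' Y' Z' (h \<cdot> t \<cdot> (f \<boxdot> g)) = IHomA T g h \<cdot> Adj T X Y Z t \<cdot> f"

definition dual :: "('o, 'm, 'x) ttcat_scheme \<Rightarrow> 'o \<Rightarrow> 'o" where
  "dual T X = IHom T X (TUnit T)"

definition dual_arr :: "('o, 'm, 'x) ttcat_scheme \<Rightarrow> 'm \<Rightarrow> 'm" where
  "dual_arr T f = IHomA T f (Ident T (TUnit T))"

text \<open>The counit \<open>[A, B] \<otimes> A \<rightarrow> B\<close> of the adjunction.\<close>

definition eval_arr :: "('o, 'm, 'x) ttcat_scheme \<Rightarrow> 'o \<Rightarrow> 'o \<Rightarrow> 'm" where
  "eval_arr T A B =
     the_inv_into (Hom T (IHom T A B \<boxtimes>\<^bsub>T\<^esub> A) B) (Adj T (IHom T A B) A B) (Ident T (IHom T A B))"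

text \<open>The natural map \<open>A\<^sup>\<or> \<otimes> B \<rightarrow> [A, B]\<close>: the adjunct of
  \<open>(A\<^sup>\<or> \<otimes> B) \<otimes> A \<rightarrow> A\<^sup>\<or> \<otimes> (B \<otimes> A) \<rightarrow> A\<^sup>\<or> \<otimes> (A \<otimes> B) \<rightarrow> (A\<^sup>\<or> \<otimes> A) \<otimes> B \<rightarrow> \<one> \<otimes> B \<rightarrow> B\<close>.\<close>

definition rigid_map :: "('o, 'm, 'x) ttcat_scheme \<Rightarrow> 'o \<Rightarrow> 'o \<Rightarrow> 'm" where
  "rigid_map T A B =
     Adj T (dual T A \<boxtimes>\<^bsub>T\<^esub> B) A B
       (LUnit T B
        \<cdot>\<^bsub>T\<^esub> (eval_arr T A (TUnit T) \<boxdot>\<^bsub>T\<^esub> Ident T B)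
        \<cdot>\<^bsub>T\<^esub> inv_arr T (Assoc T (dual T A) A B)
        \<cdot>\<^bsub>T\<^esub> (Ident T (dual T A) \<boxdot>\<^bsub>T\<^esub> Braid T B A)
        \<cdot>\<^bsub>T\<^esub> Assoc T (dual T A) B A)"

locale rigidly_compactly_generated_ttcat =
  closed_tensor_triangulated_category T + compactly_generated T U
  for T :: "('o, 'm, 'x) ttcat_scheme" (structure) and U :: "'u set" +
  assumes compacts_rigid: "A \<in> Obj (compacts U T) \<Longrightarrow> B \<in> Obj (compacts U T) \<Longrightarrow>
    iso_arr T (rigid_map T A B)"


section \<open>Finitely presented functors\<close>

text \<open>Functors from the opposite of a category to abelian groups with elements in a type \<open>'g\<close>. The
  action of a functor outside the category and outside the carriers of its values is irrelevant.\<close>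

type_synonym ('o, 'm, 'g) presheaf = "('o, 'm, 'g monoid, 'g \<Rightarrow> 'g) ftr"

definition additive_presheaf ::
  "('o, 'm, 'x) abcat_scheme \<Rightarrow> ('o, 'm, 'g) presheaf \<Rightarrow> bool" where
  "additive_presheaf C F \<longleftrightarrow>
     (\<forall>X \<in> Obj C. comm_group (OnObj F X)) \<and>
     (\<forall>u \<in> Arr C. OnArr F u \<in> hom (OnObj F (Cod C u)) (OnObj F (Dom C u))) \<and>
     (\<forall>X \<in> Obj C. \<forall>x \<in> carrier (OnObj F X). OnArr F (Ident C X) x = x) \<and>
     (\<forall>u \<in> Arr C. \<forall>v \<in> Arr C. Cod C u = Dom C v \<longrightarrow>
        (\<forall>x \<in> carrier (OnObj F (Cod C v)). OnArr F (v \<cdot>\<^bsub>C\<^esub> u) x = OnArr F u (OnArr F v x))) \<and>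
     (\<forall>X \<in> Obj C. \<forall>Y \<in> Obj C. \<forall>u \<in> Hom C X Y. \<forall>v \<in> Hom C X Y. \<forall>y \<in> carrier (OnObj F Y).
        OnArr F (u \<boxplus>\<^bsub>C\<^esub> v) y = OnArr F u y \<otimes>\<^bsub>OnObj F X\<^esub> OnArr F v y)"

definition presheaf_map ::
  "('o, 'm, 'x) abcat_scheme \<Rightarrow> ('o, 'm, 'g) presheaf \<Rightarrow> ('o, 'm, 'h) presheaf \<Rightarrow>
   ('o \<Rightarrow> 'g \<Rightarrow> 'h) \<Rightarrow> bool" where
  "presheaf_map C F G \<alpha> \<longleftrightarrow>
     (\<forall>X \<in> Obj C. \<alpha> X \<in> hom (OnObj F X) (OnObj G X)) \<and>
     (\<forall>u \<in> Arr C. \<forall>x \<in> carrier (OnObj F (Cod C u)).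
        \<alpha> (Dom C u) (OnArr F u x) = OnArr G u (\<alpha> (Cod C u) x))"

definition presheaf_iso ::
  "('o, 'm, 'x) abcat_scheme \<Rightarrow> ('o, 'm, 'g) presheaf \<Rightarrow> ('o, 'm, 'h) presheaf \<Rightarrow> bool" where
  "presheaf_iso C F G \<longleftrightarrow>
     (\<exists>\<alpha>. presheaf_map C F G \<alpha> \<and> (\<forall>X \<in> Obj C. \<alpha> X \<in> iso (OnObj F X) (OnObj G X)))"

definition presheaf_ker ::
  "('o, 'm, 'g) presheaf \<Rightarrow> ('o, 'm, 'h) presheaf \<Rightarrow> ('o \<Rightarrow> 'g \<Rightarrow> 'h) \<Rightarrow> ('o, 'm, 'g) presheaf"
  where
  "presheaf_ker F G \<alpha> =
     \<lparr>OnObj = (\<lambda>X. (OnObj F X)\<lparr>carrier := kernel (OnObj F X) (OnObj G X) (\<alpha> X)\<rparr>),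
      OnArr = OnArr F\<rparr>"

definition presheaf_im :: "('o, 'm, 'g) presheaf \<Rightarrow> ('o \<Rightarrow> 'g \<Rightarrow> 'h) \<Rightarrow> 'o \<Rightarrow> 'h set" where
  "presheaf_im F \<alpha> X = \<alpha> X ` carrier (OnObj F X)"

text \<open>On an arrow \<open>u : X' \<rightarrow> X\<close>, the cokernel of \<open>\<alpha> : F \<rightarrow> G\<close> sends the coset of \<open>y\<close> to the coset of
  \<open>G u y\<close>. The union below is over representatives \<open>y\<close>, all of which give the same coset.\<close>

definition presheaf_coker ::
  "('o, 'm, 'x) abcat_scheme \<Rightarrow> ('o, 'm, 'g) presheaf \<Rightarrow> ('o, 'm, 'h) presheaf \<Rightarrow>
   ('o \<Rightarrow> 'g \<Rightarrow> 'h) \<Rightarrow> ('o, 'm, 'h set) presheaf" where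
  "presheaf_coker C F G \<alpha> =
     \<lparr>OnObj = (\<lambda>X. OnObj G X Mod presheaf_im F \<alpha> X),
      OnArr = (\<lambda>u S. \<Union>y\<in>S. presheaf_im F \<alpha> (Dom C u) #>\<^bsub>OnObj G (Dom C u)\<^esub> OnArr G u y)\<rparr>"

definition representable :: "('o, 'm, 'x) abcat_scheme \<Rightarrow> 'o \<Rightarrow> ('o, 'm, 'm) presheaf" where
  "representable C B = \<lparr>OnObj = (\<lambda>X. HomGrp C X B), OnArr = (\<lambda>u x. x \<cdot>\<^bsub>C\<^esub> u)\<rparr>"

definition representable_map :: "('o, 'm, 'x) abcat_scheme \<Rightarrow> 'm \<Rightarrow> 'o \<Rightarrow> 'm \<Rightarrow> 'm" where
  "representable_map C f = (\<lambda>X x. f \<cdot>\<^bsub>C\<^esub> x)"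

text \<open>\<open>F\<close> is finitely presented iff there is an exact sequence \<open>(-, A) \<rightarrow> (-, B) \<rightarrow> F \<rightarrow> 0\<close>; by the
  Yoneda lemma the first map is \<open>(-, f)\<close> for some \<open>f : A \<rightarrow> B\<close>.\<close>

definition finitely_presented ::
  "('o, 'm, 'x) abcat_scheme \<Rightarrow> ('o, 'm, 'g) presheaf \<Rightarrow> bool" where
  "finitely_presented C F \<longleftrightarrow>
     (\<exists>f \<in> Arr C. \<exists>\<pi>. presheaf_map C (representable C (Cod C f)) F \<pi> \<and>
        (\<forall>X \<in> Obj C.
           presheaf_im (representable C (Cod C f)) \<pi> X = carrier (OnObj F X) \<and>
           kernel (OnObj (representable C (Cod C f)) X) (OnObj F X) (\<pi> X) =
             presheaf_im (representable C (Dom C f)) (representable_map C f) X))"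

definition coker_functor :: "('o, 'm, 'x) abcat_scheme \<Rightarrow> 'm \<Rightarrow> ('o, 'm, 'm set) presheaf" where
  "coker_functor C f =
     presheaf_coker C (representable C (Dom C f)) (representable C (Cod C f)) (representable_map C f)"

definition ker_functor :: "('o, 'm, 'x) abcat_scheme \<Rightarrow> 'm \<Rightarrow> ('o, 'm, 'm) presheaf" where
  "ker_functor C f =
     presheaf_ker (representable C (Dom C f)) (representable C (Cod C f)) (representable_map C f)"

text \<open>The category of finitely presented functors with values in groups on a type \<open>'g\<close>. Arrows carry
  their domain and codomain, and are made undefined outside the category and outside carriers so
  that equal natural transformations are equal as HOL functions. With \<open>'g\<close> the type of sets of
  arrows, every finitely presented functor is isomorphic to an object, as a cokernel of cosets.\<close>

definition mod_cat ::
  "('o, 'm, 'x) abcat_scheme \<Rightarrow>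
   (('o, 'm, 'g) presheaf,
    ('o, 'm, 'g) presheaf \<times> ('o \<Rightarrow> 'g \<Rightarrow> 'g) \<times> ('o, 'm, 'g) presheaf) cat" where
  "mod_cat C =
     (let M = {F. additive_presheaf C F \<and> finitely_presented C F} in
      \<lparr>Obj = M,
       Arr = {(F, \<alpha>, G). F \<in> M \<and> G \<in> M \<and> presheaf_map C F G \<alpha> \<and> \<alpha> \<in> extensional (Obj C) \<and>
                (\<forall>X \<in> Obj C. \<alpha> X \<in> extensional (carrier (OnObj F X)))},
       Dom = (\<lambda>(F, \<alpha>, G). F),
       Cod = (\<lambda>(F, \<alpha>, G). G),
       Ident = (\<lambda>F. (F, (\<lambda>X\<in>Obj C. \<lambda>x\<in>carrier (OnObj F X). x), F)),
       Comp = (\<lambda>(G, \<beta>, H) (F, \<alpha>, G'). (F, (\<lambda>X\<in>Obj C. \<lambda>x\<in>carrier (OnObj F X). \<beta> X (\<alpha> X x)), H))\<rparr>)"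

end

theory Submission
  imports Defs
begin

text \<open>Each compact \<open>f : A \<rightarrow> B\<close> sits in a triangle \<open>A \<rightarrow> B \<rightarrow> C \<rightarrow> \<Sigma>A\<close> of compact objects, so \<open>f\<close>, \<open>g : B \<rightarrow> C\<close> and
  \<open>h : C \<rightarrow> \<Sigma>A\<close> are successive weak kernels and weak cokernels. The functor \<open>G\<^sub>f\<close> is the image of \<open>(-, g)\<close>,
  hence also the kernel of \<open>(-, h)\<close>. Since \<open>(-)\<^sup>\<or>\<close> is fully faithful on compact objects, a map of finitely
  presented functors lifts to presentations \<open>B \<rightarrow> B'\<close>, its dual restricts to
  \<open>ker (-, f'\<^sup>\<or>) \<rightarrow> ker (-, f\<^sup>\<or>)\<close>, and weak (co)kernels show that every map between such kernels arises in
  this way and that every finitely presented functor is such a kernel.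

  That \<open>(-)\<^sup>\<or>\<close> is a duality on the compact objects needs care because the unit is not assumed to be
  compact. The inverse image of the identity under \<open>A\<^sup>\<or> \<otimes> A \<simeq> [A, A]\<close> is a coevaluation
  \<open>\<eta> : \<one> \<rightarrow> A\<^sup>\<or> \<otimes> A\<close>, and it satisfies both triangle identities. Thus \<open>- \<otimes> A\<^sup>\<or>\<close> is left adjoint to \<open>- \<otimes> A\<close>,
  which preserves coproducts, so tensoring with \<open>A\<^sup>\<or>\<close> preserves compactness; and \<open>A\<^sup>\<or>\<close> is a retract of
  \<open>A\<^sup>\<or> \<otimes> A \<otimes> A\<^sup>\<or>\<close>.\<close>

section \<open>Categories\<close>

text \<open>The formula for the dual of G_f has an intrinsic meaning: it sends X to Hom (G_f, (-,
  dual X)), because Hom into a representable turns a cokernel into a kernel, and (B, dual X) is the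
  same as (X, dual B). This explains why f does not matter up to isomorphism. The intrinsic form has
  natural transformations as elements, whereas values here must be groups of sets of arrows, so the
  formula with f is kept. A presentation is then chosen for every functor and a lift for every map.
  Two lifts of the same map into G_g differ by an arrow g \<cdot> s, whose dual vanishes on the
  kernel of the dual of g, so the choice of lift leaves no trace. The equivalence is obtained from
  full faithfulness and essential surjectivity, which avoids comparing the presentation chosen for a
  functor with the one chosen for its double dual. On the tensor side the adjunction is given as a
  natural bijection of sets, so additivity of the duality has to be derived. The equations with
  evaluation and coevaluation need explicit associators and unitors, hence the coherence
  lemmas.\<close>

lemma in_HomI: "f \<in> Arr C \<Longrightarrow> Dom C f = A \<Longrightarrow> Cod C f = B \<Longrightarrow> f \<in> Hom C A B"
  by (simp add: Hom_def)

lemma in_HomD: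
  assumes "f \<in> Hom C A B"
  shows "f \<in> Arr C" "Dom C f = A" "Cod C f = B"
  using assms by (auto simp: Hom_def)

context category
begin

lemma comp_simps [simp]:
  assumes "f \<in> Arr C" "g \<in> Arr C" "Dom C g = Cod C f"
  shows "g \<cdot> f \<in> Arr C" "Dom C (g \<cdot> f) = Dom C f" "Cod C (g \<cdot> f) = Cod C g"
  using comp_closed[of f "Dom C f" "Cod C f" g "Cod C g"] assms by (auto simp: Hom_def)

lemma ident_simps [simp]:
  assumes "A \<in> Obj C"
  shows "Ident C A \<in> Arr C" "Dom C (Ident C A) = A" "Cod C (Ident C A) = A"
  using ident_closed[OF assms] by (auto simp: Hom_def)

lemma comp_assoc_arr [simp]:
  "f \<in> Arr C \<Longrightarrow> g \<in> Arr C \<Longrightarrow> h \<in> Arr C \<Longrightarrow> Dom C g = Cod C f \<Longrightarrow> Dom C h = Cod C g \<Longrightarrow>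
     (h \<cdot> g) \<cdot> f = h \<cdot> (g \<cdot> f)"
  using comp_assoc[of f "Dom C f" "Cod C f" g "Cod C g" h "Cod C h"] by (auto simp: Hom_def)

lemma comp_ident_arr [simp]: "f \<in> Arr C \<Longrightarrow> Dom C f = A \<Longrightarrow> f \<cdot> Ident C A = f"
  using comp_ident[of f A "Cod C f"] by (auto simp: Hom_def)

lemma ident_comp_arr [simp]: "f \<in> Arr C \<Longrightarrow> Cod C f = A \<Longrightarrow> Ident C A \<cdot> f = f"
  using ident_comp[of f "Dom C f" A] by (auto simp: Hom_def)

lemma dom_obj [simp]: "f \<in> Arr C \<Longrightarrow> Dom C f \<in> Obj C"
  and cod_obj [simp]: "f \<in> Arr C \<Longrightarrow> Cod C f \<in> Obj C"
  by (simp_all add: dom_closed cod_closed)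

lemma hom_obj: "f \<in> Hom C A B \<Longrightarrow> A \<in> Obj C" "f \<in> Hom C A B \<Longrightarrow> B \<in> Obj C"
  by (auto simp: Hom_def)

text \<open>Composites are normalised to the right by \<open>comp_assoc_arr\<close>, so an equation
  for \<open>g \<cdot> f\<close> no longer matches inside a longer composite. This form applies it
  in front of a tail \<open>x\<close>.\<close>

lemma comp_reduce:
  assumes "g \<cdot> f = k" "f \<in> Arr C" "g \<in> Arr C" "Dom C g = Cod C f" "x \<in> Arr C" "Cod C x = Dom C f"
  shows "g \<cdot> (f \<cdot> x) = k \<cdot> x"
  using assms by (simp add: comp_assoc_arr [symmetric] del: comp_assoc_arr)

lemma inverse_arrs_sym: "inverse_arrs C f g \<Longrightarrow> inverse_arrs C g f"
  by (auto simp: inverse_arrs_def Hom_def)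

lemma inverse_arrs_unique:
  assumes "inverse_arrs C f g" "inverse_arrs C f h"
  shows "g = h"
proof -
  have "g = g \<cdot> (f \<cdot> h)" using assms by (auto simp: inverse_arrs_def Hom_def)
  also have "\<dots> = (g \<cdot> f) \<cdot> h" using assms by (subst comp_assoc_arr) (auto simp: inverse_arrs_def Hom_def)
  also have "\<dots> = h" using assms by (auto simp: inverse_arrs_def Hom_def)
  finally show ?thesis .
qed

lemma inv_arr:
  assumes "iso_arr C f"
  shows "inverse_arrs C f (inv_arr C f)"
  unfolding inv_arr_def using assms inverse_arrs_unique
  by (auto simp: iso_arr_def intro: theI)

lemma iso_arrI:
  assumes "f \<in> Hom C A B" "g \<in> Hom C B A" "g \<cdot> f = Ident C A" "f \<cdot> g = Ident C B"
  shows "iso_arr C f"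
  using assms unfolding iso_arr_def inverse_arrs_def Hom_def by auto

lemma iso_arrE:
  assumes "iso_arr C f" "f \<in> Hom C A B"
  obtains g where "g \<in> Hom C B A" "g \<cdot> f = Ident C A" "f \<cdot> g = Ident C B"
  using assms unfolding iso_arr_def inverse_arrs_def Hom_def by auto

end

lemma Hom_op_cat [simp]: "Hom (op_cat C) A B = Hom C B A"
  by (auto simp: Hom_def op_cat_def)

lemma op_cat_simps [simp]:
  "Obj (op_cat C) = Obj C" "Arr (op_cat C) = Arr C" "Dom (op_cat C) = Cod C"
  "Cod (op_cat C) = Dom C" "Ident (op_cat C) = Ident C" "Comp (op_cat C) g f = Comp C f g"
  by (simp_all add: op_cat_def)

lemma category_op_cat:
  assumes "category C"
  shows "category (op_cat C)"
proof -
  interpret category C by fact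
  show ?thesis by unfold_locales (auto simp: Hom_def)
qed

lemma functor_hom:
  "is_functor C D F \<Longrightarrow> A \<in> Obj C \<Longrightarrow> B \<in> Obj C \<Longrightarrow> f \<in> Hom C A B \<Longrightarrow>
     OnArr F f \<in> Hom D (OnObj F A) (OnObj F B)"
  by (simp add: is_functor_def)

lemma functor_comp:
  "is_functor C D F \<Longrightarrow> f \<in> Hom C A B \<Longrightarrow> g \<in> Hom C B E \<Longrightarrow>
     OnArr F (g \<cdot>\<^bsub>C\<^esub> f) = OnArr F g \<cdot>\<^bsub>D\<^esub> OnArr F f"
  by (auto simp: is_functor_def Hom_def)

lemma functor_arr_simps:
  assumes "category C" "is_functor C D F" "f \<in> Arr C"
  shows "OnArr F f \<in> Arr D" "Dom D (OnArr F f) = OnObj F (Dom C f)"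
    "Cod D (OnArr F f) = OnObj F (Cod C f)"
proof -
  interpret category C by fact
  have "OnArr F f \<in> Hom D (OnObj F (Dom C f)) (OnObj F (Cod C f))"
    using functor_hom[OF assms(2)] assms(3) by (simp add: Hom_def)
  then show "OnArr F f \<in> Arr D" "Dom D (OnArr F f) = OnObj F (Dom C f)"
    "Cod D (OnArr F f) = OnObj F (Cod C f)" by (auto simp: Hom_def)
qed

section \<open>Equivalences as fully faithful, essentially surjective functors\<close>

definition faithful_functor where
  "faithful_functor C F \<longleftrightarrow> (\<forall>A \<in> Obj C. \<forall>B \<in> Obj C. inj_on (OnArr F) (Hom C A B))"

definition full_functor where
  "full_functor C D F \<longleftrightarrow>
     (\<forall>A \<in> Obj C. \<forall>B \<in> Obj C. Hom D (OnObj F A) (OnObj F B) \<subseteq> OnArr F ` Hom C A B)"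

definition ess_surj_functor where
  "ess_surj_functor C D F \<longleftrightarrow> (\<forall>Y \<in> Obj D. \<exists>X \<in> Obj C. iso_objs D (OnObj F X) Y)"

text \<open>A quasi-inverse is assembled by choice: \<open>H Y\<close> is an object whose image is
  isomorphic to \<open>Y\<close>, and arrows are pulled back along the bijections on hom sets. Every
  equation in \<open>C\<close> is checked after applying \<open>F\<close>, where the chosen
  isomorphisms cancel.\<close>

lemma fully_faithful_ess_surj_imp_equivalence:
  fixes C :: "('o, 'm, 'x) cat_scheme" and D :: "('p, 'n, 'y) cat_scheme"
  assumes C: "category C" and D: "category D" and F: "is_functor C D F"
    and faithful: "faithful_functor C F" and full: "full_functor C D F"
    and surj: "ess_surj_functor C D F"
  shows "equivalence C D F"
proof -
  interpret C: category C by fact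
  interpret D: category D by fact
  note F_simps [simp] = functor_arr_simps[OF C F]
  have F_obj [simp]: "OnObj F A \<in> Obj D" if "A \<in> Obj C" for A
    using F that by (auto simp: is_functor_def)
  have F_comp [simp]: "OnArr F (g \<cdot>\<^bsub>C\<^esub> f) = OnArr F g \<cdot>\<^bsub>D\<^esub> OnArr F f"
    if "f \<in> Arr C" "g \<in> Arr C" "Dom C g = Cod C f" for f g
    using F that by (auto simp: is_functor_def)
  have F_id [simp]: "OnArr F (Ident C A) = Ident D (OnObj F A)" if "A \<in> Obj C" for A
    using F that by (auto simp: is_functor_def)
  have F_inj: "f = g" if "OnArr F f = OnArr F g" "f \<in> Arr C" "g \<in> Arr C"
    "Dom C f = Dom C g" "Cod C f = Cod C g" for f g
    using faithful that unfolding faithful_functor_def inj_on_def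
    by (metis C.cod_obj C.dom_obj in_HomI)
  have "\<exists>X e. Y \<in> Obj D \<longrightarrow> X \<in> Obj C \<and> e \<in> Hom D (OnObj F X) Y \<and> iso_arr D e" for Y
    using surj unfolding ess_surj_functor_def iso_objs_def by blast
  then obtain H e where H: "\<And>Y. Y \<in> Obj D \<Longrightarrow> H Y \<in> Obj C"
    and e: "\<And>Y. Y \<in> Obj D \<Longrightarrow> e Y \<in> Hom D (OnObj F (H Y)) Y"
    and e_iso: "\<And>Y. Y \<in> Obj D \<Longrightarrow> iso_arr D (e Y)"
    by metis
  have "\<exists>e'. Y \<in> Obj D \<longrightarrow> e' \<in> Hom D Y (OnObj F (H Y)) \<and> e' \<cdot>\<^bsub>D\<^esub> e Y = Ident D (OnObj F (H Y)) \<and>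
          e Y \<cdot>\<^bsub>D\<^esub> e' = Ident D Y" for Y
    using D.iso_arrE[OF e_iso e] by metis
  then obtain e' where e': "\<And>Y. Y \<in> Obj D \<Longrightarrow> e' Y \<in> Hom D Y (OnObj F (H Y))"
    and e'e: "\<And>Y. Y \<in> Obj D \<Longrightarrow> e' Y \<cdot>\<^bsub>D\<^esub> e Y = Ident D (OnObj F (H Y))"
    and ee': "\<And>Y. Y \<in> Obj D \<Longrightarrow> e Y \<cdot>\<^bsub>D\<^esub> e' Y = Ident D Y"
    by metis
  have lift: "\<exists>c. A \<in> Obj C \<and> B \<in> Obj C \<and> k \<in> Hom D (OnObj F A) (OnObj F B) \<longrightarrow>
      c \<in> Hom C A B \<and> OnArr F c = k" for A B k
  proof -
    have "k \<in> OnArr F ` Hom C A B"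
      if "A \<in> Obj C" "B \<in> Obj C" "k \<in> Hom D (OnObj F A) (OnObj F B)"
      using full that by (auto simp: full_functor_def)
    then show ?thesis by blast
  qed
  define L where "L A B k = (SOME c. c \<in> Hom C A B \<and> OnArr F c = k)" for A B k
  have L: "L A B k \<in> Hom C A B \<and> OnArr F (L A B k) = k"
    if "A \<in> Obj C" "B \<in> Obj C" "k \<in> Hom D (OnObj F A) (OnObj F B)" for A B k
    unfolding L_def by (rule someI_ex) (use that lift in blast)
  note e_simps [simp] = in_HomD[OF e] in_HomD[OF e'] e'e ee' H
  \<comment> \<open>The preimage under \<open>F\<close> of \<open>k\<close> conjugated by the chosen
    isomorphisms. Functoriality then comes down to cancelling \<open>e\<close> against
    \<open>e'\<close>.\<close>
  define GA where "GA k = L (H (Dom D k)) (H (Cod D k)) (e' (Cod D k) \<cdot>\<^bsub>D\<^esub> k \<cdot>\<^bsub>D\<^esub> e (Dom D k))" for k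
  have GA: "GA k \<in> Hom C (H (Dom D k)) (H (Cod D k)) \<and>
      OnArr F (GA k) = e' (Cod D k) \<cdot>\<^bsub>D\<^esub> k \<cdot>\<^bsub>D\<^esub> e (Dom D k)" if "k \<in> Arr D" for k
    unfolding GA_def by (rule L) (use that in \<open>simp_all add: Hom_def\<close>)
  note GA_simps [simp] = in_HomD[OF GA[THEN conjunct1]] GA[THEN conjunct2]
  define G where "G = \<lparr>OnObj = H, OnArr = GA\<rparr>"
  note red = D.comp_reduce[OF e'e] D.comp_reduce[OF ee']
  have G: "is_functor D C G"
    unfolding is_functor_def
  proof (intro conjI ballI impI)
    fix f g assume fg: "f \<in> Arr D" "g \<in> Arr D" "Cod D f = Dom D g"
    then show "OnArr G (g \<cdot>\<^bsub>D\<^esub> f) = OnArr G g \<cdot>\<^bsub>C\<^esub> OnArr G f"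
      by (intro F_inj) (simp_all add: G_def red)
  next
    fix A assume "A \<in> Obj D"
    then show "OnArr G (Ident D A) = Ident C (OnObj G A)"
      by (intro F_inj) (simp_all add: G_def red)
  next
    fix A B f assume "f \<in> Hom D A B"
    then show "OnArr G f \<in> Hom C (OnObj G A) (OnObj G B)"
      using GA[of f] by (auto simp: G_def Hom_def)
  qed (simp add: G_def)
  define \<eta> where "\<eta> A = L A (H (OnObj F A)) (e' (OnObj F A))" for A
  define \<theta> where "\<theta> A = L (H (OnObj F A)) A (e (OnObj F A))" for A
  have \<eta>: "\<eta> A \<in> Hom C A (H (OnObj F A)) \<and> OnArr F (\<eta> A) = e' (OnObj F A)" if "A \<in> Obj C" for A
    unfolding \<eta>_def by (rule L) (use that in \<open>simp_all add: Hom_def\<close>)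
  have \<theta>: "\<theta> A \<in> Hom C (H (OnObj F A)) A \<and> OnArr F (\<theta> A) = e (OnObj F A)" if "A \<in> Obj C" for A
    unfolding \<theta>_def by (rule L) (use that in \<open>simp_all add: Hom_def\<close>)
  note \<eta>_simps [simp] = in_HomD[OF \<eta>[THEN conjunct1]] \<eta>[THEN conjunct2]
    in_HomD[OF \<theta>[THEN conjunct1]] \<theta>[THEN conjunct2]
  have "natural_iso C C id_ftr (comp_ftr G F) \<eta>"
    unfolding natural_iso_def
  proof (intro conjI ballI)
    fix A assume A: "A \<in> Obj C"
    then show "\<eta> A \<in> Hom C (OnObj id_ftr A) (OnObj (comp_ftr G F) A)"
      by (simp add: G_def id_ftr_def comp_ftr_def \<eta>)
    show "iso_arr C (\<eta> A)"
    proof (rule C.iso_arrI)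
      show "\<eta> A \<in> Hom C A (H (OnObj F A))" "\<theta> A \<in> Hom C (H (OnObj F A)) A" using A \<eta> \<theta> by auto
      show "\<theta> A \<cdot>\<^bsub>C\<^esub> \<eta> A = Ident C A" using A by (intro F_inj) simp_all
      show "\<eta> A \<cdot>\<^bsub>C\<^esub> \<theta> A = Ident C (H (OnObj F A))" using A by (intro F_inj) simp_all
    qed
  next
    fix f assume "f \<in> Arr C"
    then show "\<eta> (Cod C f) \<cdot>\<^bsub>C\<^esub> OnArr id_ftr f = OnArr (comp_ftr G F) f \<cdot>\<^bsub>C\<^esub> \<eta> (Dom C f)"
      by (intro F_inj) (simp_all add: G_def id_ftr_def comp_ftr_def red)
  qed
  moreover have "natural_iso D D (comp_ftr F G) id_ftr e"
    unfolding natural_iso_def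
    by (auto simp: G_def id_ftr_def comp_ftr_def e e_iso red)
  ultimately show ?thesis
    unfolding equivalence_def using F G by blast
qed

text \<open>\<open>F\<close> is faithful because the unit identifies \<open>G F f\<close> with
  \<open>f\<close>, and \<open>G\<close> is faithful by the counit. Fullness of \<open>F\<close>
  uses faithfulness of \<open>G\<close>: it suffices to find \<open>f\<close> with
  \<open>G F f = G k\<close>.\<close>

lemma equivalence_fully_faithful:
  assumes C: "category C" and D: "category D" and "equivalence C D F"
  shows "faithful_functor C F" "full_functor C D F"
proof -
  interpret C: category C by fact
  interpret D: category D by fact
  obtain G \<eta> \<epsilon> where F: "is_functor C D F" and G: "is_functor D C G"
    and \<eta>: "natural_iso C C id_ftr (comp_ftr G F) \<eta>"
    and \<epsilon>: "natural_iso D D (comp_ftr F G) id_ftr \<epsilon>"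
    using assms(3) by (auto simp: equivalence_def)
  note simps [simp] = functor_arr_simps[OF C F] functor_arr_simps[OF D G]
  have obj [simp]: "\<And>A. A \<in> Obj C \<Longrightarrow> OnObj F A \<in> Obj D" "\<And>A. A \<in> Obj D \<Longrightarrow> OnObj G A \<in> Obj C"
    using F G by (auto simp: is_functor_def)
  have \<eta>_hom: "\<eta> A \<in> Hom C A (OnObj G (OnObj F A))" "iso_arr C (\<eta> A)" if "A \<in> Obj C" for A
    using \<eta> that by (auto simp: natural_iso_def id_ftr_def comp_ftr_def)
  have \<eta>_nat: "\<eta> (Cod C f) \<cdot>\<^bsub>C\<^esub> f = OnArr G (OnArr F f) \<cdot>\<^bsub>C\<^esub> \<eta> (Dom C f)" if "f \<in> Arr C" for f
    using \<eta> that by (auto simp: natural_iso_def id_ftr_def comp_ftr_def)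
  have \<epsilon>_hom: "\<epsilon> A \<in> Hom D (OnObj F (OnObj G A)) A" "iso_arr D (\<epsilon> A)" if "A \<in> Obj D" for A
    using \<epsilon> that by (auto simp: natural_iso_def id_ftr_def comp_ftr_def)
  have \<epsilon>_nat: "\<epsilon> (Cod D f) \<cdot>\<^bsub>D\<^esub> OnArr F (OnArr G f) = f \<cdot>\<^bsub>D\<^esub> \<epsilon> (Dom D f)" if "f \<in> Arr D" for f
    using \<epsilon> that by (auto simp: natural_iso_def id_ftr_def comp_ftr_def)
  note \<eta>_simps [simp] = in_HomD[OF \<eta>_hom(1)] in_HomD[OF \<epsilon>_hom(1)]
  have F_inj: "f = g" if eq: "OnArr F f = OnArr F g" and f: "f \<in> Hom C A B" and g: "g \<in> Hom C A B" for f g A B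
  proof -
    have B: "B \<in> Obj C" using f C.hom_obj by blast
    obtain i where i: "i \<in> Hom C (OnObj G (OnObj F B)) B" "i \<cdot>\<^bsub>C\<^esub> \<eta> B = Ident C B"
      using C.iso_arrE[OF \<eta>_hom(2,1)[OF B]] .
    have "\<eta> B \<cdot>\<^bsub>C\<^esub> f = \<eta> B \<cdot>\<^bsub>C\<^esub> g" using \<eta>_nat[of f] \<eta>_nat[of g] f g eq by (auto simp: Hom_def)
    then have "(i \<cdot>\<^bsub>C\<^esub> \<eta> B) \<cdot>\<^bsub>C\<^esub> f = (i \<cdot>\<^bsub>C\<^esub> \<eta> B) \<cdot>\<^bsub>C\<^esub> g"
      using i(1) f g B by (simp add: Hom_def)
    then show ?thesis using i(2) f g by (auto simp: Hom_def)
  qed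
  have G_inj: "f = g" if eq: "OnArr G f = OnArr G g" and f: "f \<in> Hom D A B" and g: "g \<in> Hom D A B" for f g A B
  proof -
    have A: "A \<in> Obj D" using f D.hom_obj by blast
    obtain i where i: "i \<in> Hom D A (OnObj F (OnObj G A))" "\<epsilon> A \<cdot>\<^bsub>D\<^esub> i = Ident D A"
      using D.iso_arrE[OF \<epsilon>_hom(2,1)[OF A]] .
    have "f \<cdot>\<^bsub>D\<^esub> \<epsilon> A = g \<cdot>\<^bsub>D\<^esub> \<epsilon> A" using \<epsilon>_nat[of f] \<epsilon>_nat[of g] f g eq by (auto simp: Hom_def)
    then have "(f \<cdot>\<^bsub>D\<^esub> \<epsilon> A) \<cdot>\<^bsub>D\<^esub> i = (g \<cdot>\<^bsub>D\<^esub> \<epsilon> A) \<cdot>\<^bsub>D\<^esub> i" by simp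
    then have "f \<cdot>\<^bsub>D\<^esub> (\<epsilon> A \<cdot>\<^bsub>D\<^esub> i) = g \<cdot>\<^bsub>D\<^esub> (\<epsilon> A \<cdot>\<^bsub>D\<^esub> i)"
      using i(1) f g A by (simp add: Hom_def)
    then show ?thesis using i(2) f g by (auto simp: Hom_def)
  qed
  show "faithful_functor C F"
    unfolding faithful_functor_def by (auto intro!: inj_onI F_inj)
  show "full_functor C D F"
    unfolding full_functor_def
  proof (intro ballI subsetI)
    fix A B k assume A: "A \<in> Obj C" and B: "B \<in> Obj C" and k: "k \<in> Hom D (OnObj F A) (OnObj F B)"
    obtain i where i: "i \<in> Hom C (OnObj G (OnObj F B)) B" "\<eta> B \<cdot>\<^bsub>C\<^esub> i = Ident C (OnObj G (OnObj F B))"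
      using C.iso_arrE[OF \<eta>_hom(2,1)[OF B]] by metis
    obtain j where j: "j \<in> Hom C (OnObj G (OnObj F A)) A" "\<eta> A \<cdot>\<^bsub>C\<^esub> j = Ident C (OnObj G (OnObj F A))"
      using C.iso_arrE[OF \<eta>_hom(2,1)[OF A]] by metis
    \<comment> \<open>\<open>G k\<close> conjugated by the unit; naturality of the unit forces
      \<open>G F f = G k\<close>.\<close>
    define f where "f = i \<cdot>\<^bsub>C\<^esub> OnArr G k \<cdot>\<^bsub>C\<^esub> \<eta> A"
    have f: "f \<in> Hom C A B" unfolding f_def using i(1) k A B by (simp add: Hom_def)
    have "OnArr G (OnArr F f) \<cdot>\<^bsub>C\<^esub> \<eta> A = \<eta> B \<cdot>\<^bsub>C\<^esub> f" using \<eta>_nat[of f] f by (auto simp: Hom_def)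
    also have "\<dots> = (\<eta> B \<cdot>\<^bsub>C\<^esub> i) \<cdot>\<^bsub>C\<^esub> OnArr G k \<cdot>\<^bsub>C\<^esub> \<eta> A"
      unfolding f_def using i(1) k A B by (simp add: Hom_def)
    also have "\<dots> = OnArr G k \<cdot>\<^bsub>C\<^esub> \<eta> A" unfolding i(2) using k A by (simp add: Hom_def)
    finally have "(OnArr G (OnArr F f) \<cdot>\<^bsub>C\<^esub> \<eta> A) \<cdot>\<^bsub>C\<^esub> j = (OnArr G k \<cdot>\<^bsub>C\<^esub> \<eta> A) \<cdot>\<^bsub>C\<^esub> j" by simp
    then have "OnArr G (OnArr F f) \<cdot>\<^bsub>C\<^esub> (\<eta> A \<cdot>\<^bsub>C\<^esub> j) = OnArr G k \<cdot>\<^bsub>C\<^esub> (\<eta> A \<cdot>\<^bsub>C\<^esub> j)"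
      using f j(1) k A by (simp add: Hom_def)
    then have "OnArr G (OnArr F f) = OnArr G k"
      unfolding j(2) using f k by (auto simp: Hom_def)
    then have "OnArr F f = k" by (rule G_inj) (use f k in \<open>auto simp: Hom_def\<close>)
    then show "k \<in> OnArr F ` Hom C A B" using f by auto
  qed
qed

section \<open>Preadditive categories\<close>

text \<open>The part of an additive category that passes to every full subcategory by mere
  restriction (\<open>preadditive_full_subcat\<close>). The theory of presheaves below can therefore
  be applied to the compact objects themselves.\<close>

locale preadditive_category = category C
  for C :: "('o, 'm, 'x) abcat_scheme" (structure) +
  assumes hom_comm_group: "A \<in> Obj C \<Longrightarrow> B \<in> Obj C \<Longrightarrow> comm_group (HomGrp C A B)"
    and comp_add: "f \<in> Hom C A B \<Longrightarrow> g \<in> Hom C B D \<Longrightarrow> g' \<in> Hom C B D \<Longrightarrow>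
                     (g \<boxplus> g') \<cdot> f = g \<cdot> f \<boxplus> g' \<cdot> f"
    and add_comp: "f \<in> Hom C A B \<Longrightarrow> f' \<in> Hom C A B \<Longrightarrow> g \<in> Hom C B D \<Longrightarrow>
                     g \<cdot> (f \<boxplus> f') = g \<cdot> f \<boxplus> g \<cdot> f'"

sublocale additive_category \<subseteq> preadditive_category
  by (intro preadditive_category.intro preadditive_category_axioms.intro category_axioms
      hom_comm_group comp_add add_comp)

lemma HomGrp_simps [simp]:
  "carrier (HomGrp C A B) = Hom C A B" "monoid.mult (HomGrp C A B) = Add C"
  "one (HomGrp C A B) = Zero C A B"
  by (simp_all add: HomGrp_def)

context preadditive_category
begin

lemma add_closed: "f \<in> Hom C A B \<Longrightarrow> g \<in> Hom C A B \<Longrightarrow> f \<boxplus> g \<in> Hom C A B"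
  using monoid.m_closed[of "HomGrp C A B" f g] hom_comm_group[of A B] hom_obj[of f A B]
  by (auto simp: comm_group_def group_def)

lemma zero_closed: "A \<in> Obj C \<Longrightarrow> B \<in> Obj C \<Longrightarrow> Zero C A B \<in> Hom C A B"
  using monoid.one_closed[of "HomGrp C A B"] hom_comm_group[of A B]
  by (auto simp: comm_group_def group_def)

lemma zero_simps [simp]:
  assumes "A \<in> Obj C" "B \<in> Obj C"
  shows "Zero C A B \<in> Arr C" "Dom C (Zero C A B) = A" "Cod C (Zero C A B) = B"
  using zero_closed[OF assms] by (auto simp: Hom_def)

lemma add_simps [simp]:
  assumes "f \<in> Arr C" "g \<in> Arr C" "Dom C f = Dom C g" "Cod C f = Cod C g"
  shows "f \<boxplus> g \<in> Arr C" "Dom C (f \<boxplus> g) = Dom C g" "Cod C (f \<boxplus> g) = Cod C g"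
  using add_closed[of f "Dom C g" "Cod C g" g] assms by (auto simp: Hom_def)

lemma neg_closed: "f \<in> Hom C A B \<Longrightarrow> Neg C f \<in> Hom C A B"
  using group.inv_closed[of "HomGrp C A B" f] hom_comm_group[of A B] hom_obj[of f A B]
  by (auto simp: comm_group_def Neg_def in_HomD)

lemma neg_simps [simp]:
  assumes "f \<in> Arr C"
  shows "Neg C f \<in> Arr C" "Dom C (Neg C f) = Dom C f" "Cod C (Neg C f) = Cod C f"
  using neg_closed[of f "Dom C f" "Cod C f"] assms by (auto simp: Hom_def)

lemma add_assoc:
  "f \<in> Hom C A B \<Longrightarrow> g \<in> Hom C A B \<Longrightarrow> h \<in> Hom C A B \<Longrightarrow> (f \<boxplus> g) \<boxplus> h = f \<boxplus> (g \<boxplus> h)"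
  using monoid.m_assoc[of "HomGrp C A B" f g h] hom_comm_group[of A B] hom_obj[of f A B]
  by (auto simp: comm_group_def group_def)

lemma add_commute: "f \<in> Hom C A B \<Longrightarrow> g \<in> Hom C A B \<Longrightarrow> f \<boxplus> g = g \<boxplus> f"
  using comm_monoid.m_comm[of "HomGrp C A B" f g] hom_comm_group[of A B] hom_obj[of f A B]
  by (auto simp: comm_group_def)

lemma add_zero: "f \<in> Hom C A B \<Longrightarrow> f \<boxplus> Zero C A B = f"
  using monoid.r_one[of "HomGrp C A B" f] hom_comm_group[of A B] hom_obj[of f A B]
  by (auto simp: comm_group_def group_def)

lemma zero_add: "f \<in> Hom C A B \<Longrightarrow> Zero C A B \<boxplus> f = f"
  using monoid.l_one[of "HomGrp C A B" f] hom_comm_group[of A B] hom_obj[of f A B]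
  by (auto simp: comm_group_def group_def)

lemma add_neg: "f \<in> Hom C A B \<Longrightarrow> f \<boxplus> Neg C f = Zero C A B"
  using group.r_inv[of "HomGrp C A B" f] hom_comm_group[of A B] hom_obj[of f A B]
  by (auto simp: comm_group_def Neg_def in_HomD)

lemma neg_unique:
  assumes "f \<in> Hom C A B" "g \<in> Hom C A B" "f \<boxplus> g = Zero C A B"
  shows "g = Neg C f"
  using group.inv_equality[of "HomGrp C A B" g f] hom_comm_group[of A B] hom_obj[of f A B] assms
    add_commute[OF assms(1,2)]
  by (auto simp: comm_group_def Neg_def in_HomD)

lemma eq_if_sub_zero:
  assumes "f \<in> Hom C A B" "g \<in> Hom C A B" "f \<boxplus> Neg C g = Zero C A B"
  shows "f = g"
proof -
  have "f = f \<boxplus> (Neg C g \<boxplus> g)"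
    using assms add_neg[OF assms(2)] add_commute[OF assms(2) neg_closed[OF assms(2)]] add_zero[OF assms(1)] by simp
  also have "\<dots> = (f \<boxplus> Neg C g) \<boxplus> g"
    by (rule add_assoc [symmetric, OF assms(1) neg_closed[OF assms(2)] assms(2)])
  also have "\<dots> = g" using assms by (simp add: zero_add)
  finally show ?thesis .
qed

text \<open>Zero is the only idempotent of a group; additive maps are shown to preserve zero arrows
  through this criterion.\<close>

lemma add_self_zero:
  assumes "f \<in> Hom C A B" "f \<boxplus> f = f"
  shows "f = Zero C A B"
  using group.l_cancel_one'[of "HomGrp C A B" f f] hom_comm_group[of A B] hom_obj[of f A B] assms
  by (auto simp: comm_group_def)

lemma comp_zero [simp]:
  assumes "f \<in> Arr C" "A \<in> Obj C" "B = Dom C f"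
  shows "f \<cdot> Zero C A B = Zero C A (Cod C f)"
proof (rule add_self_zero)
  show "f \<cdot> Zero C A B \<in> Hom C A (Cod C f)" using assms by (simp add: Hom_def)
  show "f \<cdot> Zero C A B \<boxplus> f \<cdot> Zero C A B = f \<cdot> Zero C A B"
    using add_comp[of "Zero C A B" A B "Zero C A B" f "Cod C f"] assms
    by (simp add: add_zero zero_closed Hom_def)
qed

lemma zero_comp [simp]:
  assumes "f \<in> Arr C" "B \<in> Obj C" "A = Cod C f"
  shows "Zero C A B \<cdot> f = Zero C (Dom C f) B"
proof (rule add_self_zero)
  show "Zero C A B \<cdot> f \<in> Hom C (Dom C f) B" using assms by (simp add: Hom_def)
  show "Zero C A B \<cdot> f \<boxplus> Zero C A B \<cdot> f = Zero C A B \<cdot> f"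
    using comp_add[of f "Dom C f" A "Zero C A B" B "Zero C A B"] assms
    by (simp add: add_zero zero_closed Hom_def)
qed

lemma comp_neg:
  assumes "f \<in> Hom C A B" "g \<in> Hom C B D"
  shows "g \<cdot> Neg C f = Neg C (g \<cdot> f)"
  using neg_unique[of "g \<cdot> f" A D "g \<cdot> Neg C f"] add_comp[OF assms(1) neg_closed[OF assms(1)] assms(2)]
    add_neg[OF assms(1)] assms hom_obj[OF assms(1)] by (simp add: Hom_def)

lemma neg_comp:
  assumes "f \<in> Hom C A B" "g \<in> Hom C B D"
  shows "Neg C g \<cdot> f = Neg C (g \<cdot> f)"
  using neg_unique[of "g \<cdot> f" A D "Neg C g \<cdot> f"] comp_add[OF assms(1,2) neg_closed[OF assms(2)]]
    add_neg[OF assms(2)] assms hom_obj[OF assms(2)] by (simp add: Hom_def)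

end

section \<open>Presheaves and presentations\<close>

lemma additive_presheafD:
  assumes F: "additive_presheaf C F"
  shows "X \<in> Obj C \<Longrightarrow> comm_group (OnObj F X)"
    and "u \<in> Hom C X Y \<Longrightarrow> OnArr F u \<in> hom (OnObj F Y) (OnObj F X)"
    and "u \<in> Hom C X Y \<Longrightarrow> x \<in> carrier (OnObj F Y) \<Longrightarrow> OnArr F u x \<in> carrier (OnObj F X)"
    and "X \<in> Obj C \<Longrightarrow> x \<in> carrier (OnObj F X) \<Longrightarrow> OnArr F (Ident C X) x = x"
    and "u \<in> Hom C X Y \<Longrightarrow> v \<in> Hom C Y Z \<Longrightarrow> x \<in> carrier (OnObj F Z) \<Longrightarrow>
           OnArr F (v \<cdot>\<^bsub>C\<^esub> u) x = OnArr F u (OnArr F v x)"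
proof -
  show hom: "OnArr F u \<in> hom (OnObj F Y) (OnObj F X)" if "u \<in> Hom C X Y" for u X Y
    using F that unfolding additive_presheaf_def Hom_def by auto
  show "u \<in> Hom C X Y \<Longrightarrow> x \<in> carrier (OnObj F Y) \<Longrightarrow> OnArr F u x \<in> carrier (OnObj F X)"
    using hom by (auto simp: hom_def)
  show "X \<in> Obj C \<Longrightarrow> comm_group (OnObj F X)"
    and "X \<in> Obj C \<Longrightarrow> x \<in> carrier (OnObj F X) \<Longrightarrow> OnArr F (Ident C X) x = x"
    using F unfolding additive_presheaf_def by blast+
  show "OnArr F (v \<cdot>\<^bsub>C\<^esub> u) x = OnArr F u (OnArr F v x)"
    if "u \<in> Hom C X Y" "v \<in> Hom C Y Z" "x \<in> carrier (OnObj F Z)"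
    using F that unfolding additive_presheaf_def Hom_def by auto
qed

lemma presheaf_mapD:
  assumes "presheaf_map C F G \<alpha>"
  shows "X \<in> Obj C \<Longrightarrow> \<alpha> X \<in> hom (OnObj F X) (OnObj G X)"
    and "X \<in> Obj C \<Longrightarrow> x \<in> carrier (OnObj F X) \<Longrightarrow> \<alpha> X x \<in> carrier (OnObj G X)"
    and "X \<in> Obj C \<Longrightarrow> x \<in> carrier (OnObj F X) \<Longrightarrow> y \<in> carrier (OnObj F X) \<Longrightarrow>
           \<alpha> X (x \<otimes>\<^bsub>OnObj F X\<^esub> y) = \<alpha> X x \<otimes>\<^bsub>OnObj G X\<^esub> \<alpha> X y"
    and "u \<in> Hom C X Y \<Longrightarrow> x \<in> carrier (OnObj F Y) \<Longrightarrow> \<alpha> X (OnArr F u x) = OnArr G u (\<alpha> Y x)"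
  using assms by (fastforce simp: presheaf_map_def Hom_def hom_def)+

lemma presheaf_mapI:
  assumes "\<And>X x. X \<in> Obj C \<Longrightarrow> x \<in> carrier (OnObj F X) \<Longrightarrow> \<alpha> X x \<in> carrier (OnObj G X)"
    and "\<And>X x y. X \<in> Obj C \<Longrightarrow> x \<in> carrier (OnObj F X) \<Longrightarrow> y \<in> carrier (OnObj F X) \<Longrightarrow>
           \<alpha> X (x \<otimes>\<^bsub>OnObj F X\<^esub> y) = \<alpha> X x \<otimes>\<^bsub>OnObj G X\<^esub> \<alpha> X y"
    and "\<And>X Y u x. u \<in> Hom C X Y \<Longrightarrow> x \<in> carrier (OnObj F Y) \<Longrightarrow>
           \<alpha> X (OnArr F u x) = OnArr G u (\<alpha> Y x)"
  shows "presheaf_map C F G \<alpha>"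
  unfolding presheaf_map_def hom_def
  by (auto simp: assms(1,2)) (rule assms(3), auto simp: Hom_def)

lemma presheaf_map_one:
  assumes "additive_presheaf C F" "additive_presheaf C G" "presheaf_map C F G \<alpha>" "X \<in> Obj C"
  shows "\<alpha> X \<one>\<^bsub>OnObj F X\<^esub> = \<one>\<^bsub>OnObj G X\<^esub>"
  using hom_one[OF presheaf_mapD(1)[OF assms(3,4)]] additive_presheafD(1)[OF assms(1,4)]
    additive_presheafD(1)[OF assms(2,4)] by (simp add: comm_group_def)

lemma presheaf_map_comp:
  assumes "category C" and \<alpha>: "presheaf_map C F G \<alpha>" and \<beta>: "presheaf_map C G H \<beta>"
  shows "presheaf_map C F H (\<lambda>X x. \<beta> X (\<alpha> X x))"
proof -
  interpret category C by fact
  show ?thesis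
    by (rule presheaf_mapI) (simp_all add: presheaf_mapD[OF \<alpha>] presheaf_mapD[OF \<beta>] hom_obj)
qed

lemma presheaf_iso_trans:
  assumes "category C" "presheaf_iso C F G" "presheaf_iso C G H"
  shows "presheaf_iso C F H"
proof -
  obtain \<alpha> \<beta> where \<alpha>: "presheaf_map C F G \<alpha>" "\<And>X. X \<in> Obj C \<Longrightarrow> \<alpha> X \<in> iso (OnObj F X) (OnObj G X)"
    and \<beta>: "presheaf_map C G H \<beta>" "\<And>X. X \<in> Obj C \<Longrightarrow> \<beta> X \<in> iso (OnObj G X) (OnObj H X)"
    using assms(2,3) unfolding presheaf_iso_def by blast
  have "(\<lambda>x. \<beta> X (\<alpha> X x)) \<in> iso (OnObj F X) (OnObj H X)" if "X \<in> Obj C" for X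
    using iso_set_trans[OF \<alpha>(2)[OF that] \<beta>(2)[OF that]] by (simp add: comp_def)
  then show ?thesis
    unfolding presheaf_iso_def using presheaf_map_comp[OF assms(1) \<alpha>(1) \<beta>(1)]
    by (intro exI[of _ "\<lambda>X x. \<beta> X (\<alpha> X x)"]) simp
qed

lemma presheaf_isoI:
  assumes \<alpha>: "presheaf_map C F G \<alpha>" and \<beta>: "presheaf_map C G F \<beta>"
    and "\<And>X x. X \<in> Obj C \<Longrightarrow> x \<in> carrier (OnObj F X) \<Longrightarrow> \<beta> X (\<alpha> X x) = x"
    and "\<And>X y. X \<in> Obj C \<Longrightarrow> y \<in> carrier (OnObj G X) \<Longrightarrow> \<alpha> X (\<beta> X y) = y"
  shows "presheaf_iso C F G"
proof -
  have "\<alpha> X \<in> iso (OnObj F X) (OnObj G X)" if X: "X \<in> Obj C" for X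
    unfolding iso_def using presheaf_mapD(1)[OF \<alpha> X]
    by (auto intro!: bij_betwI[of _ _ _ "\<beta> X"] presheaf_mapD(2)[OF \<alpha> X] presheaf_mapD(2)[OF \<beta> X]
        simp: assms(3,4)[OF X])
  then show ?thesis using \<alpha> unfolding presheaf_iso_def by blast
qed

text \<open>The point to check is naturality of the inverse: \<open>\<alpha>\<close> sends both
  sides to the same element, and it is injective.\<close>

lemma presheaf_iso_inverse:
  assumes F: "additive_presheaf C F" and "presheaf_iso C F G" and C: "category C"
  obtains \<alpha> \<beta> where "presheaf_map C F G \<alpha>" "presheaf_map C G F \<beta>"
    "\<And>X x. X \<in> Obj C \<Longrightarrow> x \<in> carrier (OnObj F X) \<Longrightarrow> \<beta> X (\<alpha> X x) = x"
    "\<And>X y. X \<in> Obj C \<Longrightarrow> y \<in> carrier (OnObj G X) \<Longrightarrow> \<alpha> X (\<beta> X y) = y"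
proof -
  interpret category C by fact
  obtain \<alpha> where \<alpha>: "presheaf_map C F G \<alpha>" and iso: "\<And>X. X \<in> Obj C \<Longrightarrow> \<alpha> X \<in> iso (OnObj F X) (OnObj G X)"
    using assms(2) unfolding presheaf_iso_def by blast
  define \<beta> where "\<beta> X = inv_into (carrier (OnObj F X)) (\<alpha> X)" for X
  have bij: "bij_betw (\<alpha> X) (carrier (OnObj F X)) (carrier (OnObj G X))" if "X \<in> Obj C" for X
    using iso[OF that] by (simp add: iso_def)
  have \<beta>\<alpha>: "\<beta> X (\<alpha> X x) = x" if "X \<in> Obj C" "x \<in> carrier (OnObj F X)" for X x
    using bij_betw_inv_into_left[OF bij] that by (simp add: \<beta>_def)
  have \<alpha>\<beta>: "\<alpha> X (\<beta> X y) = y" if "X \<in> Obj C" "y \<in> carrier (OnObj G X)" for X y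
    using bij_betw_inv_into_right[OF bij] that by (simp add: \<beta>_def)
  have \<beta>_hom: "\<beta> X \<in> hom (OnObj G X) (OnObj F X)" if "X \<in> Obj C" for X
    using group.iso_set_sym[OF comm_group.axioms(2)[OF additive_presheafD(1)[OF F that]] iso[OF that]]
    by (simp add: \<beta>_def iso_def)
  have "presheaf_map C G F \<beta>"
  proof (rule presheaf_mapI)
    fix X Y u y assume u: "u \<in> Hom C X Y" and y: "y \<in> carrier (OnObj G Y)"
    have X: "X \<in> Obj C" and Y: "Y \<in> Obj C" using hom_obj u by auto
    have b: "\<beta> Y y \<in> carrier (OnObj F Y)" using \<beta>_hom[OF Y] y by (auto simp: hom_def)
    have "\<alpha> X (OnArr F u (\<beta> Y y)) = OnArr G u y"
      using presheaf_mapD(4)[OF \<alpha> u b] \<alpha>\<beta>[OF Y y] by simp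
    then show "\<beta> X (OnArr G u y) = OnArr F u (\<beta> Y y)"
      using \<beta>\<alpha>[OF X additive_presheafD(3)[OF F u b]] by simp
  qed (use \<beta>_hom in \<open>auto simp: hom_def\<close>)
  with \<alpha> \<beta>\<alpha> \<alpha>\<beta> show ?thesis using that by blast
qed

section \<open>Presentations of functors by arrows, and maps between presented functors\<close>

definition presentation ::
  "('o, 'm, 'x) abcat_scheme \<Rightarrow> 'm \<Rightarrow> ('o \<Rightarrow> 'm \<Rightarrow> 'g) \<Rightarrow> ('o, 'm, 'g) presheaf \<Rightarrow> bool" where
  "presentation C f \<pi> F \<longleftrightarrow>
     f \<in> Arr C \<and> presheaf_map C (representable C (Cod C f)) F \<pi> \<and>
        (\<forall>X \<in> Obj C.
           presheaf_im (representable C (Cod C f)) \<pi> X = carrier (OnObj F X) \<and>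
           kernel (OnObj (representable C (Cod C f)) X) (OnObj F X) (\<pi> X) =
             presheaf_im (representable C (Dom C f)) (representable_map C f) X)"

lemma finitely_presented_iff: "finitely_presented C F \<longleftrightarrow> (\<exists>f \<pi>. presentation C f \<pi> F)"
  unfolding finitely_presented_def presentation_def by blast

lemma representable_simps [simp]:
  "carrier (OnObj (representable C B) X) = Hom C X B"
  "monoid.mult (OnObj (representable C B) X) = Add C"
  "one (OnObj (representable C B) X) = Zero C X B"
  "OnArr (representable C B) u x = x \<cdot>\<^bsub>C\<^esub> u"
  by (simp_all add: representable_def)

lemma ker_functor_simps [simp]:
  "carrier (OnObj (ker_functor C f) X) =
     {x \<in> Hom C X (Dom C f). f \<cdot>\<^bsub>C\<^esub> x = Zero C X (Cod C f)}"
  "monoid.mult (OnObj (ker_functor C f) X) = Add C"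
  "one (OnObj (ker_functor C f) X) = Zero C X (Dom C f)"
  "OnArr (ker_functor C f) u x = x \<cdot>\<^bsub>C\<^esub> u"
  by (simp_all add: ker_functor_def presheaf_ker_def kernel_def representable_map_def
      representable_def HomGrp_def)

lemma presentationD:
  assumes "presentation C f \<pi> F"
  shows "f \<in> Arr C"
    and "X \<in> Obj C \<Longrightarrow> x \<in> Hom C X (Cod C f) \<Longrightarrow> \<pi> X x \<in> carrier (OnObj F X)"
    and "X \<in> Obj C \<Longrightarrow> x \<in> Hom C X (Cod C f) \<Longrightarrow> y \<in> Hom C X (Cod C f) \<Longrightarrow>
           \<pi> X (x \<boxplus>\<^bsub>C\<^esub> y) = \<pi> X x \<otimes>\<^bsub>OnObj F X\<^esub> \<pi> X y"
    and "u \<in> Hom C X Y \<Longrightarrow> x \<in> Hom C Y (Cod C f) \<Longrightarrow> \<pi> X (x \<cdot>\<^bsub>C\<^esub> u) = OnArr F u (\<pi> Y x)"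
    and "X \<in> Obj C \<Longrightarrow> t \<in> carrier (OnObj F X) \<Longrightarrow> \<exists>x \<in> Hom C X (Cod C f). \<pi> X x = t"
    and "X \<in> Obj C \<Longrightarrow> x \<in> Hom C X (Cod C f) \<Longrightarrow>
           \<pi> X x = \<one>\<^bsub>OnObj F X\<^esub> \<longleftrightarrow> (\<exists>z \<in> Hom C X (Dom C f). x = f \<cdot>\<^bsub>C\<^esub> z)"
proof -
  have map: "presheaf_map C (representable C (Cod C f)) F \<pi>"
    using assms by (simp add: presentation_def)
  show "f \<in> Arr C" using assms by (simp add: presentation_def)
  show "X \<in> Obj C \<Longrightarrow> x \<in> Hom C X (Cod C f) \<Longrightarrow> \<pi> X x \<in> carrier (OnObj F X)"
    using presheaf_mapD(2)[OF map] by simp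
  show "X \<in> Obj C \<Longrightarrow> x \<in> Hom C X (Cod C f) \<Longrightarrow> y \<in> Hom C X (Cod C f) \<Longrightarrow>
           \<pi> X (x \<boxplus>\<^bsub>C\<^esub> y) = \<pi> X x \<otimes>\<^bsub>OnObj F X\<^esub> \<pi> X y"
    using presheaf_mapD(3)[OF map] by simp
  show "u \<in> Hom C X Y \<Longrightarrow> x \<in> Hom C Y (Cod C f) \<Longrightarrow> \<pi> X (x \<cdot>\<^bsub>C\<^esub> u) = OnArr F u (\<pi> Y x)"
    using presheaf_mapD(4)[OF map] by simp
  show "X \<in> Obj C \<Longrightarrow> t \<in> carrier (OnObj F X) \<Longrightarrow> \<exists>x \<in> Hom C X (Cod C f). \<pi> X x = t"
  proof -
    assume X: "X \<in> Obj C" and t: "t \<in> carrier (OnObj F X)"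
    have "\<pi> X ` Hom C X (Cod C f) = carrier (OnObj F X)"
      using assms X by (simp add: presentation_def presheaf_im_def)
    then show ?thesis using t by force
  qed
  show "\<pi> X x = \<one>\<^bsub>OnObj F X\<^esub> \<longleftrightarrow> (\<exists>z \<in> Hom C X (Dom C f). x = f \<cdot>\<^bsub>C\<^esub> z)"
    if X: "X \<in> Obj C" and x: "x \<in> Hom C X (Cod C f)"
  proof -
    have "{x \<in> Hom C X (Cod C f). \<pi> X x = \<one>\<^bsub>OnObj F X\<^esub>} = (\<lambda>z. f \<cdot>\<^bsub>C\<^esub> z) ` Hom C X (Dom C f)"
      using assms X by (simp add: presentation_def presheaf_im_def kernel_def representable_map_def)
    then show ?thesis using x by auto
  qed
qed

lemma presentationI:
  assumes "category C" "f \<in> Arr C"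
    and "\<And>X x. X \<in> Obj C \<Longrightarrow> x \<in> Hom C X (Cod C f) \<Longrightarrow> \<pi> X x \<in> carrier (OnObj F X)"
    and "\<And>X x y. X \<in> Obj C \<Longrightarrow> x \<in> Hom C X (Cod C f) \<Longrightarrow> y \<in> Hom C X (Cod C f) \<Longrightarrow>
           \<pi> X (x \<boxplus>\<^bsub>C\<^esub> y) = \<pi> X x \<otimes>\<^bsub>OnObj F X\<^esub> \<pi> X y"
    and "\<And>X Y u x. u \<in> Hom C X Y \<Longrightarrow> x \<in> Hom C Y (Cod C f) \<Longrightarrow> \<pi> X (x \<cdot>\<^bsub>C\<^esub> u) = OnArr F u (\<pi> Y x)"
    and "\<And>X y. X \<in> Obj C \<Longrightarrow> y \<in> carrier (OnObj F X) \<Longrightarrow> \<exists>x \<in> Hom C X (Cod C f). \<pi> X x = y"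
    and "\<And>X x. X \<in> Obj C \<Longrightarrow> x \<in> Hom C X (Cod C f) \<Longrightarrow>
           \<pi> X x = \<one>\<^bsub>OnObj F X\<^esub> \<longleftrightarrow> (\<exists>z \<in> Hom C X (Dom C f). x = f \<cdot>\<^bsub>C\<^esub> z)"
  shows "presentation C f \<pi> F"
proof -
  interpret category C by fact
  have "presheaf_map C (representable C (Cod C f)) F \<pi>"
    by (rule presheaf_mapI) (simp_all add: assms(3,4,5))
  moreover have "\<pi> X ` Hom C X (Cod C f) = carrier (OnObj F X)" if "X \<in> Obj C" for X
    using assms(3,6) that by (auto simp: image_iff) metis
  moreover have "{x \<in> Hom C X (Cod C f). \<pi> X x = \<one>\<^bsub>OnObj F X\<^esub>} = (\<lambda>z. f \<cdot>\<^bsub>C\<^esub> z) ` Hom C X (Dom C f)"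
    if "X \<in> Obj C" for X
    using assms(7)[OF that] comp_closed[of _ X "Dom C f" f "Cod C f"] assms(2)
    by (auto simp: in_HomI)
  ultimately show ?thesis
    using assms(2) by (simp add: presentation_def presheaf_im_def kernel_def representable_map_def)
qed

text \<open>The arrow \<open>b\<close> induces \<open>\<alpha>\<close> on generators, while
  \<open>a\<close> certifies that \<open>b\<close> carries relations to relations. Only
  \<open>b\<close> is recorded, because the dual of \<open>\<alpha>\<close> will be composition with
  the dual of \<open>b\<close>.\<close>

definition lifts ::
  "('o, 'm, 'x) abcat_scheme \<Rightarrow> 'm \<Rightarrow> ('o \<Rightarrow> 'm \<Rightarrow> 'g) \<Rightarrow> 'm \<Rightarrow> ('o \<Rightarrow> 'm \<Rightarrow> 'h) \<Rightarrow>
     ('o \<Rightarrow> 'g \<Rightarrow> 'h) \<Rightarrow> 'm \<Rightarrow> bool" where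
  "lifts C f \<pi> f' \<pi>' \<alpha> b \<longleftrightarrow>
     b \<in> Hom C (Cod C f) (Cod C f') \<and>
     (\<exists>a \<in> Hom C (Dom C f) (Dom C f'). b \<cdot>\<^bsub>C\<^esub> f = f' \<cdot>\<^bsub>C\<^esub> a) \<and>
     (\<forall>X \<in> Obj C. \<forall>x \<in> Hom C X (Cod C f). \<alpha> X (\<pi> X x) = \<pi>' X (b \<cdot>\<^bsub>C\<^esub> x))"

text \<open>Kernels of maps between representables have arrows as elements, while cokernels have
  cosets, that is sets of arrows. Singletons bring both into one type without changing the functor
  up to isomorphism.\<close>

definition singleton_presheaf :: "('o, 'm, 'g) presheaf \<Rightarrow> ('o, 'm, 'g set) presheaf" where
  "singleton_presheaf F =
     \<lparr>OnObj = (\<lambda>X. \<lparr>carrier = (\<lambda>x. {x}) ` carrier (OnObj F X),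
                     monoid.mult = (\<lambda>S T. {the_elem S \<otimes>\<^bsub>OnObj F X\<^esub> the_elem T}),
                     one = {\<one>\<^bsub>OnObj F X\<^esub>}\<rparr>),
      OnArr = (\<lambda>u S. {OnArr F u (the_elem S)})\<rparr>"

lemma singleton_presheaf_simps [simp]:
  "carrier (OnObj (singleton_presheaf F) X) = (\<lambda>x. {x}) ` carrier (OnObj F X)"
  "S \<otimes>\<^bsub>OnObj (singleton_presheaf F) X\<^esub> T = {the_elem S \<otimes>\<^bsub>OnObj F X\<^esub> the_elem T}"
  "one (OnObj (singleton_presheaf F) X) = {\<one>\<^bsub>OnObj F X\<^esub>}"
  "OnArr (singleton_presheaf F) u S = {OnArr F u (the_elem S)}"
  by (simp_all add: singleton_presheaf_def)

lemma singleton_presheaf_iso: "presheaf_iso C (singleton_presheaf F) F"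
  by (rule presheaf_isoI[where \<alpha> = "\<lambda>X. the_elem" and \<beta> = "\<lambda>X x. {x}"])
    (auto intro!: presheaf_mapI)

context preadditive_category
begin

lemma additive_presheaf_singleton:
  assumes F: "additive_presheaf C F"
  shows "additive_presheaf C (singleton_presheaf F)"
proof -
  have "comm_group (OnObj (singleton_presheaf F) X)" if X: "X \<in> Obj C" for X
  proof -
    interpret comm_group "OnObj F X" using additive_presheafD(1)[OF F X] .
    show ?thesis
      by (rule comm_groupI) (auto simp: m_ac intro!: bexI[of _ "inv\<^bsub>OnObj F X\<^esub> _"])
  qed
  moreover have "OnArr F u x \<in> carrier (OnObj F (Dom C u))"
    if "u \<in> Arr C" "x \<in> carrier (OnObj F (Cod C u))" for u x
    using additive_presheafD(3)[OF F, of u] that by (simp add: Hom_def)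
  ultimately show ?thesis
    using F unfolding additive_presheaf_def by (auto simp: hom_def Hom_def)
qed

lemma additive_presheaf_ker_functor:
  assumes f: "f \<in> Arr C"
  shows "additive_presheaf C (ker_functor C f)"
proof -
  have "comm_group (OnObj (ker_functor C f) X)" if X: "X \<in> Obj C" for X
  proof (rule comm_groupI, goal_cases)
    case (1 x y) then show ?case
      using add_comp[of x X "Dom C f" y f "Cod C f"] f X
      by (simp add: add_closed in_HomI add_zero zero_closed)
  next
    case 2 then show ?case using f X by (simp add: zero_closed)
  next
    case (3 x y z) then show ?case by (auto simp: add_assoc[of _ X "Dom C f"])
  next
    case (4 x y) then show ?case by (auto simp: add_commute[of _ X "Dom C f"])
  next
    case (5 x) then show ?case by (auto simp: zero_add)
  next
    case (6 x)
    then have x: "x \<in> Hom C X (Dom C f)" "f \<cdot> x = Zero C X (Cod C f)" by auto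
    have z: "Neg C (Zero C X (Cod C f)) = Zero C X (Cod C f)"
      using neg_unique[OF zero_closed zero_closed add_zero[OF zero_closed]] X f by simp
    show ?case
      using x neg_closed[OF x(1)] comp_neg[OF x(1), of f "Cod C f"] f z
      by (auto intro!: bexI[of _ "Neg C x"] simp: in_HomI add_neg add_commute[OF neg_closed[OF x(1)] x(1)])
  qed
  then show ?thesis
    unfolding additive_presheaf_def
    by (auto simp: hom_def in_HomI f comp_add add_comp comp_closed Hom_def
        comp_assoc_arr [symmetric] simp del: comp_assoc_arr)
qed

lemma presentation_eq_iff:
  assumes F: "additive_presheaf C F" and p: "presentation C f \<pi> F"
    and X: "X \<in> Obj C" and x: "x \<in> Hom C X (Cod C f)" and y: "y \<in> Hom C X (Cod C f)"
  shows "\<pi> X x = \<pi> X y \<longleftrightarrow> (\<exists>z \<in> Hom C X (Dom C f). x \<boxplus> Neg C y = f \<cdot> z)"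
proof -
  interpret F: comm_group "OnObj F X" using additive_presheafD(1)[OF F X] .
  have f: "f \<in> Arr C" using presentationD(1)[OF p] .
  have z: "\<pi> X (Zero C X (Cod C f)) = \<one>\<^bsub>OnObj F X\<^esub>"
    using presentationD(6)[OF p X zero_closed] X f
    by (auto intro!: bexI[of _ "Zero C X (Dom C f)"] zero_closed)
  have "\<pi> X y \<otimes>\<^bsub>OnObj F X\<^esub> \<pi> X (Neg C y) = \<one>\<^bsub>OnObj F X\<^esub>"
    using presentationD(3)[OF p X y neg_closed[OF y]] add_neg[OF y] z by simp
  then have n: "\<pi> X (Neg C y) = inv\<^bsub>OnObj F X\<^esub> \<pi> X y"
    using presentationD(2)[OF p X y] presentationD(2)[OF p X neg_closed[OF y]]
    by (metis F.inv_equality F.m_comm)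
  have "\<pi> X x = \<pi> X y \<longleftrightarrow> \<pi> X x \<otimes>\<^bsub>OnObj F X\<^esub> inv\<^bsub>OnObj F X\<^esub> \<pi> X y = \<one>\<^bsub>OnObj F X\<^esub>"
    using presentationD(2)[OF p X x] presentationD(2)[OF p X y]
    by (metis F.inv_closed F.inv_inv F.inv_equality F.r_inv)
  also have "\<dots> \<longleftrightarrow> \<pi> X (x \<boxplus> Neg C y) = \<one>\<^bsub>OnObj F X\<^esub>"
    using presentationD(3)[OF p X x neg_closed[OF y]] n by simp
  also have "\<dots> \<longleftrightarrow> (\<exists>z \<in> Hom C X (Dom C f). x \<boxplus> Neg C y = f \<cdot> z)"
    using presentationD(6)[OF p X add_closed[OF x neg_closed[OF y]]] .
  finally show ?thesis .
qed

text \<open>By the Yoneda lemma a map out of a representable is determined by the image of the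
  identity. As \<open>\<rho>\<close> is onto, this image comes from an arrow \<open>b\<close>;
  relations are respected because the class of \<open>f\<close> itself is zero.\<close>

lemma presentation_lift:
  assumes F: "additive_presheaf C F" and p: "presentation C f \<pi> F"
    and G: "additive_presheaf C G" and q: "presentation C g \<rho> G"
    and \<alpha>: "presheaf_map C F G \<alpha>"
  shows "\<exists>b. lifts C f \<pi> g \<rho> \<alpha> b"
proof -
  have f: "f \<in> Arr C" and g: "g \<in> Arr C" using presentationD(1)[OF p] presentationD(1)[OF q] .
  let ?B = "Cod C f"
  have B: "?B \<in> Obj C" and A: "Dom C f \<in> Obj C" using f by auto
  have id: "Ident C ?B \<in> Hom C ?B ?B" using ident_closed[OF B] .
  obtain b where b: "b \<in> Hom C ?B (Cod C g)" and \<rho>b: "\<rho> ?B b = \<alpha> ?B (\<pi> ?B (Ident C ?B))"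
    using presentationD(5)[OF q B] presheaf_mapD(2)[OF \<alpha> B presentationD(2)[OF p B id]] by metis
  have nat: "\<alpha> X (\<pi> X x) = \<rho> X (b \<cdot> x)" if x: "x \<in> Hom C X ?B" for X x
  proof -
    have "\<alpha> X (\<pi> X x) = \<alpha> X (OnArr F x (\<pi> ?B (Ident C ?B)))"
      using presentationD(4)[OF p x id] x by (simp add: in_HomD)
    also have "\<dots> = OnArr G x (\<rho> ?B b)"
      using presheaf_mapD(4)[OF \<alpha> x presentationD(2)[OF p B id]] \<rho>b by simp
    also have "\<dots> = \<rho> X (b \<cdot> x)" using presentationD(4)[OF q x b] by simp
    finally show ?thesis .
  qed
  have f': "f \<in> Hom C (Dom C f) ?B" using f by (simp add: in_HomI)
  \<comment> \<open>\<open>f\<close> is the universal relation \<open>f \<cdot> id\<close>, so its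
    class vanishes, and \<open>\<alpha>\<close> carries this to the class of
    \<open>b \<cdot> f\<close>.\<close>
  have "\<pi> (Dom C f) f = \<one>\<^bsub>OnObj F (Dom C f)\<^esub>"
    using presentationD(6)[OF p A f'] f ident_closed[OF A] by (auto intro!: bexI[of _ "Ident C (Dom C f)"])
  then have "\<rho> (Dom C f) (b \<cdot> f) = \<one>\<^bsub>OnObj G (Dom C f)\<^esub>"
    using nat[OF f'] presheaf_map_one[OF F G \<alpha> A] by simp
  then have "\<exists>a \<in> Hom C (Dom C f) (Dom C g). b \<cdot> f = g \<cdot> a"
    using presentationD(6)[OF q A comp_closed[OF f' b]] by simp
  then show ?thesis using b nat unfolding lifts_def by blast
qed

text \<open>The converse of lifting, by the universal property of the cokernel: the class of
  \<open>b \<cdot> x\<close> depends only on the class of \<open>x\<close>, since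
  \<open>b \<cdot> f \<cdot> z = g \<cdot> a \<cdot> z\<close> is again a relation.\<close>

lemma presentation_descend:
  assumes F: "additive_presheaf C F" and p: "presentation C f \<pi> F"
    and G: "additive_presheaf C G" and q: "presentation C g \<rho> G"
    and b: "b \<in> Hom C (Cod C f) (Cod C g)" and a: "a \<in> Hom C (Dom C f) (Dom C g)"
    and ba: "b \<cdot> f = g \<cdot> a"
  shows "\<exists>\<alpha>. presheaf_map C F G \<alpha> \<and> lifts C f \<pi> g \<rho> \<alpha> b"
proof -
  have f: "f \<in> Arr C" and g: "g \<in> Arr C" using presentationD(1)[OF p] presentationD(1)[OF q] .
  have wd: "\<rho> X (b \<cdot> x) = \<rho> X (b \<cdot> y)"
    if X: "X \<in> Obj C" and x: "x \<in> Hom C X (Cod C f)" and y: "y \<in> Hom C X (Cod C f)"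
      and eq: "\<pi> X x = \<pi> X y" for X x y
  proof -
    obtain z where z: "z \<in> Hom C X (Dom C f)" "x \<boxplus> Neg C y = f \<cdot> z"
      using presentation_eq_iff[OF F p X x y] eq by auto
    have "b \<cdot> x \<boxplus> Neg C (b \<cdot> y) = b \<cdot> (f \<cdot> z)"
      using z(2) add_comp[OF x neg_closed[OF y] b] comp_neg[OF y b] by simp
    also have "\<dots> = (b \<cdot> f) \<cdot> z" using b f z(1) by (simp add: Hom_def)
    also have "\<dots> = g \<cdot> (a \<cdot> z)" unfolding ba using a g z(1) by (simp add: Hom_def)
    finally show ?thesis
      using presentation_eq_iff[OF G q X comp_closed[OF x b] comp_closed[OF y b]] comp_closed[OF z(1) a] by blast
  qed
  \<comment> \<open>A set-theoretic section of \<open>\<pi>\<close>, neither additive nor natural in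
    general; \<open>wd\<close> shows that its choice is immaterial.\<close>
  define s where "s X y = (SOME x. x \<in> Hom C X (Cod C f) \<and> \<pi> X x = y)" for X y
  have s: "s X y \<in> Hom C X (Cod C f) \<and> \<pi> X (s X y) = y"
    if "X \<in> Obj C" "y \<in> carrier (OnObj F X)" for X y
    unfolding s_def by (rule someI_ex) (use presentationD(5)[OF p that] in blast)
  define \<alpha> where "\<alpha> X y = \<rho> X (b \<cdot> s X y)" for X y
  have \<alpha>: "\<alpha> X (\<pi> X x) = \<rho> X (b \<cdot> x)" if X: "X \<in> Obj C" and x: "x \<in> Hom C X (Cod C f)" for X x
    unfolding \<alpha>_def using s[OF X presentationD(2)[OF p X x]] by (intro wd[OF X _ x]) auto
  have "presheaf_map C F G \<alpha>"
  proof (rule presheaf_mapI)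
    fix X y assume X: "X \<in> Obj C" and y: "y \<in> carrier (OnObj F X)"
    show "\<alpha> X y \<in> carrier (OnObj G X)"
      unfolding \<alpha>_def using s[OF X y] by (intro presentationD(2)[OF q X] comp_closed[OF _ b]) auto
  next
    fix X y y' assume X: "X \<in> Obj C" and y: "y \<in> carrier (OnObj F X)" and y': "y' \<in> carrier (OnObj F X)"
    obtain x x' where x: "x \<in> Hom C X (Cod C f)" "\<pi> X x = y" and x': "x' \<in> Hom C X (Cod C f)" "\<pi> X x' = y'"
      using presentationD(5)[OF p X] y y' by metis
    have "\<alpha> X (y \<otimes>\<^bsub>OnObj F X\<^esub> y') = \<alpha> X (\<pi> X (x \<boxplus> x'))"
      using presentationD(3)[OF p X x(1) x'(1)] x x' by simp
    also have "\<dots> = \<rho> X (b \<cdot> x \<boxplus> b \<cdot> x')"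
      using \<alpha>[OF X add_closed[OF x(1) x'(1)]] add_comp[OF x(1) x'(1) b] by simp
    also have "\<dots> = \<alpha> X y \<otimes>\<^bsub>OnObj G X\<^esub> \<alpha> X y'"
      using presentationD(3)[OF q X comp_closed[OF x(1) b] comp_closed[OF x'(1) b]]
        \<alpha>[OF X x(1)] \<alpha>[OF X x'(1)] x x' by simp
    finally show "\<alpha> X (y \<otimes>\<^bsub>OnObj F X\<^esub> y') = \<alpha> X y \<otimes>\<^bsub>OnObj G X\<^esub> \<alpha> X y'" .
  next
    fix X Y u y assume u: "u \<in> Hom C X Y" and y: "y \<in> carrier (OnObj F Y)"
    have X: "X \<in> Obj C" and Y: "Y \<in> Obj C" using hom_obj u by auto
    obtain x where x: "x \<in> Hom C Y (Cod C f)" "\<pi> Y x = y"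
      using presentationD(5)[OF p Y y] by metis
    have "\<alpha> X (OnArr F u y) = \<rho> X (b \<cdot> (x \<cdot> u))"
      using presentationD(4)[OF p u x(1)] x(2) \<alpha>[OF X comp_closed[OF u x(1)]] by simp
    also have "\<dots> = \<rho> X ((b \<cdot> x) \<cdot> u)" using u x(1) b by (simp add: comp_assoc)
    also have "\<dots> = OnArr G u (\<rho> Y (b \<cdot> x))"
      using presentationD(4)[OF q u comp_closed[OF x(1) b]] by simp
    also have "\<dots> = OnArr G u (\<alpha> Y y)" using \<alpha>[OF Y x(1)] x(2) by simp
    finally show "\<alpha> X (OnArr F u y) = OnArr G u (\<alpha> Y y)" .
  qed
  moreover have "lifts C f \<pi> g \<rho> \<alpha> b" unfolding lifts_def using a b ba \<alpha> by blast
  ultimately show ?thesis by blast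
qed

text \<open>Identity arrows give a commutative square from \<open>f\<close> to itself; the two maps
  which it induces are inverse to each other on generators.\<close>

lemma presentation_unique:
  assumes F: "additive_presheaf C F" and p: "presentation C f \<pi> F"
    and G: "additive_presheaf C G" and q: "presentation C f \<rho> G"
  shows "presheaf_iso C F G"
proof -
  have f: "f \<in> Arr C" using presentationD(1)[OF p] .
  have sq: "Ident C (Cod C f) \<cdot> f = f \<cdot> Ident C (Dom C f)" using f by simp
  have id: "Ident C (Cod C f) \<in> Hom C (Cod C f) (Cod C f)" "Ident C (Dom C f) \<in> Hom C (Dom C f) (Dom C f)"
    using f by (auto simp: ident_closed)
  obtain \<alpha> where \<alpha>: "presheaf_map C F G \<alpha>"
    and \<alpha>': "\<And>X x. X \<in> Obj C \<Longrightarrow> x \<in> Hom C X (Cod C f) \<Longrightarrow> \<alpha> X (\<pi> X x) = \<rho> X x"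
    using presentation_descend[OF F p G q id sq] by (auto simp: lifts_def Hom_def)
  obtain \<beta> where \<beta>: "presheaf_map C G F \<beta>"
    and \<beta>': "\<And>X x. X \<in> Obj C \<Longrightarrow> x \<in> Hom C X (Cod C f) \<Longrightarrow> \<beta> X (\<rho> X x) = \<pi> X x"
    using presentation_descend[OF G q F p id sq] by (auto simp: lifts_def Hom_def)
  show ?thesis
  proof (rule presheaf_isoI[OF \<alpha> \<beta>])
    show "\<beta> X (\<alpha> X y) = y" if "X \<in> Obj C" "y \<in> carrier (OnObj F X)" for X y
      using presentationD(5)[OF p that] \<alpha>' \<beta>' that by metis
    show "\<alpha> X (\<beta> X y) = y" if "X \<in> Obj C" "y \<in> carrier (OnObj G X)" for X y
      using presentationD(5)[OF q that] \<alpha>' \<beta>' that by metis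
  qed
qed

lemma presentation_iso:
  assumes G: "presheaf_map C F G \<alpha>" "\<And>X. X \<in> Obj C \<Longrightarrow> inj_on (\<alpha> X) (carrier (OnObj F X))"
      "\<And>X. X \<in> Obj C \<Longrightarrow> \<alpha> X ` carrier (OnObj F X) = carrier (OnObj G X)"
    and F: "additive_presheaf C F" "additive_presheaf C G" and p: "presentation C f \<pi> F"
  shows "presentation C f (\<lambda>X x. \<alpha> X (\<pi> X x)) G"
proof (rule presentationI)
  have one: "\<alpha> X \<one>\<^bsub>OnObj F X\<^esub> = \<one>\<^bsub>OnObj G X\<^esub>" if "X \<in> Obj C" for X
    using presheaf_map_one[OF F G(1) that] .
  show "\<alpha> X (\<pi> X x) = \<one>\<^bsub>OnObj G X\<^esub> \<longleftrightarrow> (\<exists>z \<in> Hom C X (Dom C f). x = f \<cdot> z)"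
    if X: "X \<in> Obj C" and x: "x \<in> Hom C X (Cod C f)" for X x
  proof -
    have "\<one>\<^bsub>OnObj F X\<^esub> \<in> carrier (OnObj F X)"
      using additive_presheafD(1)[OF F(1) X] by (simp add: comm_group_def group_def)
    then show ?thesis
      using presentationD(6)[OF p X x] inj_on_eq_iff[OF G(2)[OF X] presentationD(2)[OF p X x], of "\<one>\<^bsub>OnObj F X\<^esub>"]
        one[OF X] by simp
  qed
  show "\<exists>x \<in> Hom C X (Cod C f). \<alpha> X (\<pi> X x) = y" if "X \<in> Obj C" "y \<in> carrier (OnObj G X)" for X y
    using G(3)[OF that(1)] that(2) presentationD(5)[OF p that(1)] by (metis imageE)
qed (use presentationD[OF p] presheaf_mapD[OF G(1)] hom_obj in \<open>auto intro: category_axioms\<close>)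

lemma presentation_singleton:
  assumes F: "additive_presheaf C F" and p: "presentation C f \<pi> F"
  shows "presentation C f (\<lambda>X x. {\<pi> X x}) (singleton_presheaf F)"
  by (rule presentation_iso[OF _ _ _ F additive_presheaf_singleton[OF F] p])
    (auto intro!: presheaf_mapI)

text \<open>The presentation is the projection to cosets of the image of \<open>(-, f)\<close>. The
  delicate point is the action of an arrow on a coset, which is defined as a union over
  representatives.\<close>

lemma coker_functor_presentation:
  assumes f: "f \<in> Arr C"
  shows "additive_presheaf C (coker_functor C f)"
    and "\<exists>\<pi>. presentation C f \<pi> (coker_functor C f)"
proof -
  define A B where "A = Dom C f" and "B = Cod C f"
  have AB: "A \<in> Obj C" "B \<in> Obj C" "f \<in> Hom C A B" using f by (auto simp: A_def B_def Hom_def)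
  let ?Q = "coker_functor C f"
  define I where "I X = (\<lambda>x. f \<cdot> x) ` Hom C X A" for X
  define \<pi> where "\<pi> X x = I X #>\<^bsub>HomGrp C X B\<^esub> x" for X x
  have im: "presheaf_im (representable C A) (representable_map C f) X = I X" for X
    by (simp add: presheaf_im_def representable_map_def I_def)
  have Q: "OnObj ?Q X = HomGrp C X B Mod I X" for X
    by (simp add: coker_functor_def presheaf_coker_def im flip: A_def B_def) (simp add: representable_def)
  have QA: "OnArr ?Q u S = (\<Union>y\<in>S. \<pi> (Dom C u) (y \<cdot> u))" for u S
    by (simp add: coker_functor_def presheaf_coker_def im \<pi>_def flip: A_def B_def) (simp add: representable_def)
  have grp: "comm_group (HomGrp C X B)" if "X \<in> Obj C" for X using hom_comm_group[OF that AB(2)] .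
  have sub: "subgroup (I X) (HomGrp C X B)" if X: "X \<in> Obj C" for X
  proof -
    interpret S: group "HomGrp C X A" using hom_comm_group[OF X AB(1)] by (simp add: comm_group_def)
    interpret T: group "HomGrp C X B" using grp[OF X] by (simp add: comm_group_def)
    have "group_hom (HomGrp C X A) (HomGrp C X B) (\<lambda>x. f \<cdot> x)"
      using AB(3) by unfold_locales (auto simp: hom_def comp_closed add_comp)
    from group_hom.img_is_subgroup[OF this] show ?thesis by (simp add: I_def)
  qed
  have carr: "carrier (OnObj ?Q X) = \<pi> X ` Hom C X B" for X
    by (simp add: Q carrier_FactGroup \<pi>_def [abs_def])
  have mult: "\<pi> X x \<otimes>\<^bsub>OnObj ?Q X\<^esub> \<pi> X y = \<pi> X (x \<boxplus> y)"
    if "X \<in> Obj C" "x \<in> Hom C X B" "y \<in> Hom C X B" for X x y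
  proof -
    interpret normal "I X" "HomGrp C X B"
      by (rule comm_group.subgroup_imp_normal[OF grp[OF that(1)] sub[OF that(1)]])
    show ?thesis using rcos_sum[of x y] that by (simp add: Q \<pi>_def)
  qed
  have one: "\<one>\<^bsub>OnObj ?Q X\<^esub> = I X" for X by (simp add: Q)
  have elem: "y \<in> \<pi> X x \<longleftrightarrow> (\<exists>z \<in> Hom C X A. y = f \<cdot> z \<boxplus> x)" for X x y
    by (auto simp: \<pi>_def r_coset_def I_def)
  have self: "x \<in> \<pi> X x" and indep: "y \<in> \<pi> X x \<Longrightarrow> \<pi> X y = \<pi> X x"
    and ker: "\<pi> X x = I X \<longleftrightarrow> x \<in> I X" if "X \<in> Obj C" "x \<in> Hom C X B" for X x y
  proof -
    interpret comm_group "HomGrp C X B" using grp[OF that(1)] .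
    show "x \<in> \<pi> X x" using rcos_self[OF _ sub[OF that(1)], of x] that(2) by (simp add: \<pi>_def)
    show "y \<in> \<pi> X x \<Longrightarrow> \<pi> X y = \<pi> X x"
      using repr_independence[OF _ _ sub[OF that(1)], of y x] that(2) by (simp add: \<pi>_def)
    show "\<pi> X x = I X \<longleftrightarrow> x \<in> I X"
      using coset_join1[OF _ _ sub[OF that(1)], of x] coset_join2[OF _ sub[OF that(1)], of x] that(2)
      by (auto simp: \<pi>_def)
  qed
  \<comment> \<open>All representatives of a coset have the same image coset, since
    \<open>f \<cdot> z \<cdot> u\<close> is again in the image of \<open>(-, f)\<close>. The union
    thus runs over equal sets, and it is not empty because a coset contains its
    representative.\<close>
  have act: "OnArr ?Q u (\<pi> Y x) = \<pi> X (x \<cdot> u)" if u: "u \<in> Hom C X Y" and x: "x \<in> Hom C Y B" for X Y u x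
  proof -
    have X: "X \<in> Obj C" and Y: "Y \<in> Obj C" using hom_obj u by auto
    have "\<pi> X (y \<cdot> u) = \<pi> X (x \<cdot> u)" if "y \<in> \<pi> Y x" for y
    proof (rule indep[OF X comp_closed[OF u x]])
      obtain z where z: "z \<in> Hom C Y A" "y = f \<cdot> z \<boxplus> x" using \<open>y \<in> \<pi> Y x\<close> elem by auto
      have "y \<cdot> u = f \<cdot> (z \<cdot> u) \<boxplus> x \<cdot> u"
        using z AB(3) u x comp_add[OF u comp_closed[OF z(1) AB(3)] x] by (simp add: comp_assoc)
      then show "y \<cdot> u \<in> \<pi> X (x \<cdot> u)" using elem comp_closed[OF u z(1)] by auto
    qed
    moreover have "Dom C u = X" using u by (simp add: in_HomD)
    ultimately show ?thesis using self[OF Y x] unfolding QA by (intro equalityI UN_least) blast+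
  qed
  have grpQ: "comm_group (OnObj ?Q X)" if "X \<in> Obj C" for X
    using comm_group.abelian_FactGroup[OF grp[OF that] sub[OF that]] by (simp add: Q)
  have hom: "u \<in> Arr C \<Longrightarrow> u \<in> Hom C (Dom C u) (Cod C u)" for u by (simp add: in_HomI)
  show "additive_presheaf C ?Q"
    unfolding additive_presheaf_def
  proof (intro conjI ballI impI, goal_cases)
    case (1 X) then show ?case by (rule grpQ)
  next
    case (2 u)
    then show ?case
      using hom[OF 2]
      by (auto simp: hom_def carr act[OF hom[OF 2]] comp_closed mult add_closed comp_add)
  next
    case (3 X x)
    then obtain t where "t \<in> Hom C X B" "x = \<pi> X t" by (auto simp: carr)
    then show ?case using act[OF ident_closed[OF 3(1)]] by (simp add: comp_ident)
  next
    case (4 u v x)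
    then obtain t where t: "t \<in> Hom C (Cod C v) B" "x = \<pi> (Cod C v) t" by (auto simp: carr)
    have u: "u \<in> Hom C (Dom C u) (Dom C v)" and v: "v \<in> Hom C (Dom C v) (Cod C v)"
      using 4 by (auto simp: Hom_def)
    show ?case using act[OF comp_closed[OF u v] t(1)] act[OF v t(1)] act[OF u comp_closed[OF v t(1)]] t u v
      by (simp add: comp_assoc)
  next
    case (5 X Y u v y)
    then obtain t where t: "t \<in> Hom C Y B" "y = \<pi> Y t" by (auto simp: carr)
    show ?case
      using 5 t by (simp add: act[OF add_closed[OF 5(3,4)] t(1)] act mult comp_closed add_comp)
  qed
  have "\<pi> X x = \<one>\<^bsub>OnObj ?Q X\<^esub> \<longleftrightarrow> (\<exists>z \<in> Hom C X A. x = f \<cdot> z)" if "X \<in> Obj C" "x \<in> Hom C X B" for X x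
    using ker[OF that] by (auto simp: one I_def)
  then have "presentation C f \<pi> ?Q"
    by (intro presentationI)
      (auto simp: category_axioms f carr mult act simp flip: A_def B_def)
  then show "\<exists>\<pi>. presentation C f \<pi> ?Q" by blast
qed

end

section \<open>The category of finitely presented functors\<close>

lemma mod_cat_simps:
  "Obj (mod_cat C) = {F. additive_presheaf C F \<and> finitely_presented C F}"
  "Dom (mod_cat C) (F, \<alpha>, G) = F"
  "Cod (mod_cat C) (F, \<alpha>, G) = G"
  "Ident (mod_cat C) F = (F, (\<lambda>X\<in>Obj C. \<lambda>x\<in>carrier (OnObj F X). x), F)"
  "Comp (mod_cat C) (G, \<beta>, H) (F, \<alpha>, G') =
     (F, (\<lambda>X\<in>Obj C. \<lambda>x\<in>carrier (OnObj F X). \<beta> X (\<alpha> X x)), H)"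
  by (simp_all add: mod_cat_def Let_def)

lemma mod_cat_hom_iff:
  "m \<in> Hom (mod_cat C) F G \<longleftrightarrow>
     (\<exists>\<alpha>. m = (F, \<alpha>, G) \<and> F \<in> Obj (mod_cat C) \<and> G \<in> Obj (mod_cat C) \<and> presheaf_map C F G \<alpha> \<and>
       \<alpha> \<in> extensional (Obj C) \<and> (\<forall>X \<in> Obj C. \<alpha> X \<in> extensional (carrier (OnObj F X))))"
  by (cases m) (auto simp: mod_cat_def Let_def Hom_def)

text \<open>The action of \<open>F\<close> and its group operations stay inside the carriers, so
  values of \<open>\<alpha>\<close> elsewhere do not enter. This permits the restriction to
  extensional functions that arrows of \<open>mod_cat\<close> require.\<close>

lemma presheaf_map_cong:
  assumes "category C" "additive_presheaf C F" "presheaf_map C F G \<alpha>"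
    and "\<And>X x. X \<in> Obj C \<Longrightarrow> x \<in> carrier (OnObj F X) \<Longrightarrow> \<beta> X x = \<alpha> X x"
  shows "presheaf_map C F G \<beta>"
proof -
  interpret category C by fact
  show ?thesis
  proof (rule presheaf_mapI)
    fix X x y assume "X \<in> Obj C" "x \<in> carrier (OnObj F X)" "y \<in> carrier (OnObj F X)"
    moreover have "x \<otimes>\<^bsub>OnObj F X\<^esub> y \<in> carrier (OnObj F X)" if "X \<in> Obj C"
      using additive_presheafD(1)[OF assms(2) that] calculation
      by (simp add: comm_group_def group_def monoid.m_closed)
    ultimately show "\<beta> X (x \<otimes>\<^bsub>OnObj F X\<^esub> y) = \<beta> X x \<otimes>\<^bsub>OnObj G X\<^esub> \<beta> X y"
      by (simp add: assms(4) presheaf_mapD[OF assms(3)])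
  next
    fix X Y u x assume u: "u \<in> Hom C X Y" and x: "x \<in> carrier (OnObj F Y)"
    then show "\<beta> X (OnArr F u x) = OnArr G u (\<beta> Y x)"
      using additive_presheafD(3)[OF assms(2) u x] hom_obj[OF u]
      by (simp add: assms(4) presheaf_mapD(4)[OF assms(3)])
  qed (simp add: assms(4) presheaf_mapD[OF assms(3)])
qed

lemma mod_cat_restrict_hom:
  assumes "category C" "F \<in> Obj (mod_cat C)" "G \<in> Obj (mod_cat C)" "presheaf_map C F G \<alpha>"
  shows "(F, (\<lambda>X\<in>Obj C. \<lambda>x\<in>carrier (OnObj F X). \<alpha> X x), G) \<in> Hom (mod_cat C) F G"
  unfolding mod_cat_hom_iff using assms
  by (auto intro!: presheaf_map_cong[OF assms(1) _ assms(4)] simp: mod_cat_simps)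

lemma mod_cat_hom_eqI:
  assumes "(F, \<alpha>, G) \<in> Hom (mod_cat C) F G" "(F, \<beta>, G) \<in> Hom (mod_cat C) F G"
    and "\<And>X x. X \<in> Obj C \<Longrightarrow> x \<in> carrier (OnObj F X) \<Longrightarrow> \<alpha> X x = \<beta> X x"
  shows "(F, \<alpha>, G) = (F, \<beta>, G)"
proof -
  have "\<alpha> X = \<beta> X" if "X \<in> Obj C" for X
    by (rule extensionalityI[of _ "carrier (OnObj F X)"]) (use assms that in \<open>auto simp: mod_cat_hom_iff\<close>)
  then have "\<alpha> = \<beta>"
    by (intro extensionalityI[of \<alpha> "Obj C" \<beta>]) (use assms in \<open>auto simp: mod_cat_hom_iff\<close>)
  then show ?thesis by simp
qed

lemma category_mod_cat:
  assumes "category C"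
  shows "category (mod_cat C)"
proof
  interpret category C by fact
  fix F G H K :: "('a, 'b, 'g) presheaf" and f g h
  show "Dom (mod_cat C) f \<in> Obj (mod_cat C)" "Cod (mod_cat C) f \<in> Obj (mod_cat C)"
    if "f \<in> Arr (mod_cat C)" for f
    using that by (auto simp: mod_cat_def Let_def)
  show ident: "Ident (mod_cat C) F \<in> Hom (mod_cat C) F F" if "F \<in> Obj (mod_cat C)" for F :: "('a, 'b, 'g) presheaf"
    unfolding mod_cat_simps(4)
    by (rule mod_cat_restrict_hom[OF assms that that]) (rule presheaf_mapI, auto)
  show comp: "g \<cdot>\<^bsub>mod_cat C\<^esub> f \<in> Hom (mod_cat C) F H"
    if f: "f \<in> Hom (mod_cat C) F G" and g: "g \<in> Hom (mod_cat C) G H" for F G H :: "('a, 'b, 'g) presheaf" and f g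
  proof -
    obtain \<alpha> \<beta> where "f = (F, \<alpha>, G)" "g = (G, \<beta>, H)" "presheaf_map C F G \<alpha>" "presheaf_map C G H \<beta>"
      "F \<in> Obj (mod_cat C)" "H \<in> Obj (mod_cat C)"
      using f g by (auto simp: mod_cat_hom_iff)
    then show ?thesis
      by (simp add: mod_cat_simps(5) mod_cat_restrict_hom[OF assms] presheaf_map_comp[OF assms])
  qed
  show "(h \<cdot>\<^bsub>mod_cat C\<^esub> g) \<cdot>\<^bsub>mod_cat C\<^esub> f = h \<cdot>\<^bsub>mod_cat C\<^esub> (g \<cdot>\<^bsub>mod_cat C\<^esub> f)"
    if fgh: "f \<in> Hom (mod_cat C) F G" "g \<in> Hom (mod_cat C) G H" "h \<in> Hom (mod_cat C) H K"
  proof -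
    obtain \<alpha> \<beta> \<gamma> where e: "f = (F, \<alpha>, G)" "g = (G, \<beta>, H)" "h = (H, \<gamma>, K)"
      and m: "presheaf_map C F G \<alpha>"
      using fgh unfolding mod_cat_hom_iff by blast
    show ?thesis
      unfolding e mod_cat_simps using presheaf_mapD(2)[OF m] by (auto intro!: restrict_ext)
  qed
  show "f \<cdot>\<^bsub>mod_cat C\<^esub> Ident (mod_cat C) F = f" if f: "f \<in> Hom (mod_cat C) F G"
  proof -
    obtain \<alpha> where e: "f = (F, \<alpha>, G)" and F: "F \<in> Obj (mod_cat C)" using f by (auto simp: mod_cat_hom_iff)
    have "f \<cdot>\<^bsub>mod_cat C\<^esub> Ident (mod_cat C) F \<in> Hom (mod_cat C) F G" by (rule comp[OF ident[OF F] f])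
    then show ?thesis
      using f unfolding e mod_cat_simps by (intro mod_cat_hom_eqI) auto
  qed
  show "Ident (mod_cat C) G \<cdot>\<^bsub>mod_cat C\<^esub> f = f" if f: "f \<in> Hom (mod_cat C) F G"
  proof -
    obtain \<alpha> where e: "f = (F, \<alpha>, G)" and G: "G \<in> Obj (mod_cat C)" and m: "presheaf_map C F G \<alpha>"
      using f by (auto simp: mod_cat_hom_iff)
    have "Ident (mod_cat C) G \<cdot>\<^bsub>mod_cat C\<^esub> f \<in> Hom (mod_cat C) F G" by (rule comp[OF f ident[OF G]])
    then show ?thesis
      using f presheaf_mapD(2)[OF m] unfolding e mod_cat_simps by (intro mod_cat_hom_eqI) auto
  qed
qed

lemma mod_cat_iso_objs:
  assumes "category C" and F: "F \<in> Obj (mod_cat C)" and G: "G \<in> Obj (mod_cat C)" and "presheaf_iso C F G"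
  shows "iso_objs (mod_cat C) F G"
proof -
  interpret M: category "mod_cat C" using category_mod_cat assms(1) .
  have "additive_presheaf C F" using F by (simp add: mod_cat_simps)
  then obtain \<alpha> \<beta> where \<alpha>: "presheaf_map C F G \<alpha>" and \<beta>: "presheaf_map C G F \<beta>"
    and inv: "\<And>X x. X \<in> Obj C \<Longrightarrow> x \<in> carrier (OnObj F X) \<Longrightarrow> \<beta> X (\<alpha> X x) = x"
      "\<And>X y. X \<in> Obj C \<Longrightarrow> y \<in> carrier (OnObj G X) \<Longrightarrow> \<alpha> X (\<beta> X y) = y"
    using presheaf_iso_inverse[OF _ assms(4,1)] by metis
  let ?a = "(F, (\<lambda>X\<in>Obj C. \<lambda>x\<in>carrier (OnObj F X). \<alpha> X x), G)"
  let ?b = "(G, (\<lambda>X\<in>Obj C. \<lambda>x\<in>carrier (OnObj G X). \<beta> X x), F)"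
  have a: "?a \<in> Hom (mod_cat C) F G" and b: "?b \<in> Hom (mod_cat C) G F"
    using mod_cat_restrict_hom[OF assms(1) F G \<alpha>] mod_cat_restrict_hom[OF assms(1) G F \<beta>] by auto
  have "iso_arr (mod_cat C) ?a"
    by (rule M.iso_arrI[OF a b])
      (auto simp: mod_cat_simps inv presheaf_mapD(2)[OF \<alpha>] presheaf_mapD(2)[OF \<beta>] intro!: restrict_ext)
  then show ?thesis using a unfolding iso_objs_def by blast
qed

section \<open>The duality on finitely presented functors\<close>

definition weak_kernel :: "('o, 'm, 'x) abcat_scheme \<Rightarrow> 'm \<Rightarrow> 'm \<Rightarrow> bool" where
  "weak_kernel C f g \<longleftrightarrow>
     f \<in> Hom C (Dom C f) (Dom C g) \<and> g \<in> Arr C \<and> g \<cdot>\<^bsub>C\<^esub> f = Zero C (Dom C f) (Cod C g) \<and>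
     (\<forall>X. \<forall>x \<in> Hom C X (Dom C g). g \<cdot>\<^bsub>C\<^esub> x = Zero C X (Cod C g) \<longrightarrow>
        (\<exists>y \<in> Hom C X (Dom C f). x = f \<cdot>\<^bsub>C\<^esub> y))"

definition weak_cokernel :: "('o, 'm, 'x) abcat_scheme \<Rightarrow> 'm \<Rightarrow> 'm \<Rightarrow> bool" where
  "weak_cokernel C g f \<longleftrightarrow>
     g \<in> Hom C (Cod C f) (Cod C g) \<and> f \<in> Arr C \<and> g \<cdot>\<^bsub>C\<^esub> f = Zero C (Dom C f) (Cod C g) \<and>
     (\<forall>X. \<forall>x \<in> Hom C (Cod C f) X. x \<cdot>\<^bsub>C\<^esub> f = Zero C (Dom C f) X \<longrightarrow>
        (\<exists>y \<in> Hom C (Cod C g) X. x = y \<cdot>\<^bsub>C\<^esub> g))"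

text \<open>Exactness at both middle terms: the kernel of \<open>(-, h)\<close> is the image of
  \<open>(-, g)\<close>, and the kernel of \<open>(-, g)\<close> is the image of
  \<open>(-, f)\<close>. Composition with \<open>g\<close> thus exhibits the kernel of
  \<open>(-, h)\<close> as a copy of the cokernel of \<open>(-, f)\<close>.\<close>

lemma (in preadditive_category) ker_functor_presentation:
  assumes gh: "weak_kernel C g h" and fg: "weak_kernel C f g"
  shows "presentation C f (\<lambda>X x. g \<cdot> x) (ker_functor C h)"
proof (rule presentationI)
  have f: "f \<in> Hom C (Dom C f) (Dom C g)" and g: "g \<in> Hom C (Dom C g) (Dom C h)" and h: "h \<in> Arr C"
    and z: "g \<cdot> f = Zero C (Dom C f) (Dom C h)" "h \<cdot> g = Zero C (Dom C g) (Cod C h)"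
    using assms by (auto simp: weak_kernel_def Hom_def)
  note F = in_HomD[OF f] and G = in_HomD[OF g]
  have codf: "Cod C f = Dom C g" using F by simp
  show "f \<in> Arr C" using F by simp
  show "\<exists>x\<in>Hom C X (Cod C f). g \<cdot> x = y" if "X \<in> Obj C" "y \<in> carrier (OnObj (ker_functor C h) X)" for X y
    using gh that unfolding codf weak_kernel_def by auto
  show "(g \<cdot> x = \<one>\<^bsub>OnObj (ker_functor C h) X\<^esub>) = (\<exists>z\<in>Hom C X (Dom C f). x = f \<cdot> z)"
    if X: "X \<in> Obj C" and x: "x \<in> Hom C X (Cod C f)" for X x
  proof
    assume "g \<cdot> x = \<one>\<^bsub>OnObj (ker_functor C h) X\<^esub>"
    then show "\<exists>z\<in>Hom C X (Dom C f). x = f \<cdot> z"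
      using fg x G unfolding codf weak_kernel_def by auto
  next
    assume "\<exists>z\<in>Hom C X (Dom C f). x = f \<cdot> z"
    then obtain y where y: "y \<in> Hom C X (Dom C f)" "x = f \<cdot> y" by blast
    have "g \<cdot> x = (g \<cdot> f) \<cdot> y" using comp_assoc[OF y(1) f g] y(2) by simp
    then show "g \<cdot> x = \<one>\<^bsub>OnObj (ker_functor C h) X\<^esub>"
      unfolding z(1) using y(1) h F by (simp add: Hom_def)
  qed
  show "g \<cdot> x \<in> carrier (OnObj (ker_functor C h) X)" if "X \<in> Obj C" "x \<in> Hom C X (Cod C f)" for X x
  proof -
    have "h \<cdot> (g \<cdot> x) = (h \<cdot> g) \<cdot> x" using that g h codf by (simp add: Hom_def)
    then show ?thesis unfolding z(2) using that g h codf by (simp add: Hom_def)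
  qed
  show "g \<cdot> (x \<boxplus> y) = g \<cdot> x \<otimes>\<^bsub>OnObj (ker_functor C h) X\<^esub> g \<cdot> y"
    if "X \<in> Obj C" "x \<in> Hom C X (Cod C f)" "y \<in> Hom C X (Cod C f)" for X x y
    using add_comp[of x X "Dom C g" y g] that g codf by simp
  show "g \<cdot> (x \<cdot> u) = OnArr (ker_functor C h) u (g \<cdot> x)"
    if "u \<in> Hom C X Y" "x \<in> Hom C Y (Cod C f)" for X Y u x
    using that g codf by (simp add: Hom_def)
qed (rule category_axioms)

text \<open>What the argument on functors takes from the tensor triangulated category: an additive
  contravariant self-map of \<open>K\<close> that is fully faithful and essentially surjective, and
  the continuation of each arrow to an exact sequence, which triangles will supply.\<close>

locale preadditive_duality = preadditive_category K
  for K :: "('o, 'm, 'x) abcat_scheme" (structure) +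
  fixes dob :: "'o \<Rightarrow> 'o" and dar :: "'m \<Rightarrow> 'm"
  assumes dob_obj: "A \<in> Obj K \<Longrightarrow> dob A \<in> Obj K"
    and dar_hom: "f \<in> Hom K A B \<Longrightarrow> dar f \<in> Hom K (dob B) (dob A)"
    and dar_comp: "f \<in> Hom K A B \<Longrightarrow> g \<in> Hom K B D \<Longrightarrow> dar (g \<cdot> f) = dar f \<cdot> dar g"
    and dar_ident: "A \<in> Obj K \<Longrightarrow> dar (Ident K A) = Ident K (dob A)"
    and dar_add: "f \<in> Hom K A B \<Longrightarrow> g \<in> Hom K A B \<Longrightarrow> dar (f \<boxplus> g) = dar f \<boxplus> dar g"
    and dar_inj: "f \<in> Hom K A B \<Longrightarrow> g \<in> Hom K A B \<Longrightarrow> dar f = dar g \<Longrightarrow> f = g"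
    and dar_surj: "A \<in> Obj K \<Longrightarrow> B \<in> Obj K \<Longrightarrow> m \<in> Hom K (dob B) (dob A) \<Longrightarrow>
                     \<exists>f \<in> Hom K A B. dar f = m"
    and dob_surj: "A \<in> Obj K \<Longrightarrow> \<exists>B \<in> Obj K. iso_objs K A (dob B)"
    and exact_sequence: "f \<in> Arr K \<Longrightarrow> \<exists>g h. weak_kernel K f g \<and> weak_kernel K g h \<and>
                     weak_cokernel K g f \<and> weak_cokernel K h g"
begin

lemma dar_zero:
  assumes "A \<in> Obj K" "B \<in> Obj K"
  shows "dar (Zero K A B) = Zero K (dob B) (dob A)"
  using add_self_zero[OF dar_hom[OF zero_closed[OF assms]]]
    dar_add[OF zero_closed[OF assms] zero_closed[OF assms]] add_zero[OF zero_closed[OF assms]] by simp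

lemma dar_simps [simp]:
  assumes "f \<in> Arr K"
  shows "dar f \<in> Arr K" "Dom K (dar f) = dob (Cod K f)" "Cod K (dar f) = dob (Dom K f)"
  using dar_hom[of f "Dom K f" "Cod K f"] assms by (auto simp: Hom_def)

text \<open>The universal property is transported along \<open>dar\<close>. A test object is only
  isomorphic to a dual \<open>dob Y\<close>, so the test arrow is moved to \<open>dob Y\<close>,
  where it is the dual of an arrow out of \<open>Cod K f\<close>, and the factorisation is carried
  back along \<open>i\<close>.\<close>

lemma weak_kernel_dar:
  assumes "weak_cokernel K g f"
  shows "weak_kernel K (dar g) (dar f)"
  unfolding weak_kernel_def
proof (intro conjI allI ballI impI)
  have g: "g \<in> Hom K (Cod K f) (Cod K g)" and f: "f \<in> Arr K"
    and gf: "g \<cdot> f = Zero K (Dom K f) (Cod K g)"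
    and univ: "\<And>X x. x \<in> Hom K (Cod K f) X \<Longrightarrow> x \<cdot> f = Zero K (Dom K f) X \<Longrightarrow> \<exists>y \<in> Hom K (Cod K g) X. x = y \<cdot> g"
    using assms by (auto simp: weak_cokernel_def)
  note G = in_HomD[OF g]
  have f': "f \<in> Hom K (Dom K f) (Cod K f)" using f by (simp add: Hom_def)
  show "dar g \<in> Hom K (Dom K (dar g)) (Dom K (dar f))" using dar_hom[OF g] G f by simp
  show "dar f \<in> Arr K" using f by simp
  show "dar f \<cdot> dar g = Zero K (Dom K (dar g)) (Cod K (dar f))"
    using dar_comp[OF f' g] gf G f by (simp add: dar_zero)
  fix X x assume "x \<in> Hom K X (Dom K (dar f))" and fx: "dar f \<cdot> x = Zero K X (Cod K (dar f))"
  then have x: "x \<in> Hom K X (dob (Cod K f))" and X: "X \<in> Obj K" using f by (auto simp: Hom_def)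
  obtain Y i where Y: "Y \<in> Obj K" and i: "i \<in> Hom K X (dob Y)" "iso_arr K i"
    using dob_surj[OF X] by (auto simp: iso_objs_def)
  obtain j where j: "j \<in> Hom K (dob Y) X" "j \<cdot> i = Ident K X"
    using iso_arrE[OF i(2,1)] by metis
  have Cf: "Cod K f \<in> Obj K" using f by simp
  obtain \<xi> where \<xi>: "\<xi> \<in> Hom K (Cod K f) Y" "dar \<xi> = x \<cdot> j"
    using dar_surj[OF Cf Y comp_closed[OF j(1) x]] by blast
  have "dar (\<xi> \<cdot> f) = (dar f \<cdot> x) \<cdot> j"
    using dar_comp[OF f' \<xi>(1)] \<xi>(2) x j(1) f by (simp add: Hom_def)
  also have "\<dots> = dar (Zero K (Dom K f) Y)"
    unfolding fx using j(1) f Y by (auto simp: Hom_def dar_zero dob_obj)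
  finally have "\<xi> \<cdot> f = Zero K (Dom K f) Y"
    by (intro dar_inj[OF comp_closed[OF f' \<xi>(1)] zero_closed]) (use f Y in auto)
  then obtain \<zeta> where \<zeta>: "\<zeta> \<in> Hom K (Cod K g) Y" "\<xi> = \<zeta> \<cdot> g" using univ[OF \<xi>(1)] by blast
  have "x = x \<cdot> (j \<cdot> i)" unfolding j(2) using x by (simp add: comp_ident)
  also have "\<dots> = dar \<xi> \<cdot> i" unfolding \<xi>(2) using x j(1) i(1) by (simp add: comp_assoc)
  also have "\<dots> = dar g \<cdot> (dar \<zeta> \<cdot> i)"
    unfolding \<zeta>(2) using dar_comp[OF g \<zeta>(1)] comp_assoc[OF i(1) dar_hom[OF \<zeta>(1)] dar_hom[OF g]] by simp
  finally show "\<exists>y\<in>Hom K X (Dom K (dar g)). x = dar g \<cdot> y"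
    using comp_closed[OF i(1) dar_hom[OF \<zeta>(1)]] G by auto
qed

lemma dar_neg:
  assumes "f \<in> Hom K A B"
  shows "dar (Neg K f) = Neg K (dar f)"
  using neg_unique[OF dar_hom[OF assms] dar_hom[OF neg_closed[OF assms]]]
    dar_add[OF assms neg_closed[OF assms]] add_neg[OF assms] hom_obj[OF assms] by (simp add: dar_zero)

section \<open>Kernels of dual arrows, and their independence of the presentation\<close>

abbreviation dual_ker :: "'m \<Rightarrow> ('o, 'm, 'm) presheaf" where
  "dual_ker f \<equiv> ker_functor K (dar f)"

lemma dual_ker_carrier:
  assumes "f \<in> Hom K A B"
  shows "carrier (OnObj (dual_ker f) X) = {x \<in> Hom K X (dob B). dar f \<cdot> x = Zero K X (dob A)}"
  using assms by (auto simp: Hom_def)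

text \<open>Dualising \<open>b \<cdot> f = g \<cdot> a\<close> gives
  \<open>dar f \<cdot> dar b = dar a \<cdot> dar g\<close>, so \<open>dar b\<close> maps the kernel
  of \<open>dar g\<close> into that of \<open>dar f\<close>.\<close>

lemma dual_ker_map:
  assumes f: "f \<in> Hom K A B" and g: "g \<in> Hom K A' B'" and b: "b \<in> Hom K B B'" and a: "a \<in> Hom K A A'"
    and ba: "b \<cdot> f = g \<cdot> a"
  shows "presheaf_map K (dual_ker g) (dual_ker f) (\<lambda>X x. dar b \<cdot> x)"
proof (rule presheaf_mapI)
  fix X x assume "x \<in> carrier (OnObj (dual_ker g) X)"
  then have x: "x \<in> Hom K X (dob B')" "dar g \<cdot> x = Zero K X (dob A')"
    by (auto simp: dual_ker_carrier[OF g] simp del: ker_functor_simps)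
  have "dar f \<cdot> (dar b \<cdot> x) = dar (b \<cdot> f) \<cdot> x"
    using comp_assoc[OF x(1) dar_hom[OF b] dar_hom[OF f]] dar_comp[OF f b] by simp
  also have "\<dots> = dar a \<cdot> (dar g \<cdot> x)"
    unfolding ba using comp_assoc[OF x(1) dar_hom[OF g] dar_hom[OF a]] dar_comp[OF a g] by simp
  also have "\<dots> = Zero K X (dob A)"
    unfolding x(2) using dar_hom[OF a] x(1) by (auto simp: Hom_def)
  finally show "dar b \<cdot> x \<in> carrier (OnObj (dual_ker f) X)"
    using comp_closed[OF x(1) dar_hom[OF b]]
    by (simp add: dual_ker_carrier[OF f] del: ker_functor_simps)
next
  fix X x y assume "x \<in> carrier (OnObj (dual_ker g) X)" "y \<in> carrier (OnObj (dual_ker g) X)"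
  then have "x \<in> Hom K X (dob B')" "y \<in> Hom K X (dob B')"
    by (auto simp: dual_ker_carrier[OF g] simp del: ker_functor_simps)
  then show "dar b \<cdot> (x \<otimes>\<^bsub>OnObj (dual_ker g) X\<^esub> y) = dar b \<cdot> x \<otimes>\<^bsub>OnObj (dual_ker f) X\<^esub> dar b \<cdot> y"
    using add_comp dar_hom[OF b] by simp
next
  fix X Y u x assume u: "u \<in> Hom K X Y" and "x \<in> carrier (OnObj (dual_ker g) Y)"
  then have "x \<in> Hom K Y (dob B')"
    by (auto simp: dual_ker_carrier[OF g] simp del: ker_functor_simps)
  then show "dar b \<cdot> OnArr (dual_ker g) u x = OnArr (dual_ker f) u (dar b \<cdot> x)"
    using comp_assoc[OF u _ dar_hom[OF b]] by simp
qed

text \<open>Two lifts of the same map differ by some \<open>g \<cdot> s\<close>, as when resolutions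
  are compared up to homotopy. The dual \<open>dar s \<cdot> dar g\<close> vanishes on the kernel of
  \<open>dar g\<close>, so the dual of a map is well defined.\<close>

lemma lifts_dar_eq:
  assumes F: "additive_presheaf K F" and p: "presentation K f \<pi> F"
    and G: "additive_presheaf K G" and q: "presentation K g \<rho> G"
    and b: "lifts K f \<pi> g \<rho> \<alpha> b" and c: "lifts K f \<pi> g \<rho> \<alpha> c"
    and x: "x \<in> carrier (OnObj (dual_ker g) X)"
  shows "dar b \<cdot> x = dar c \<cdot> x"
proof -
  have f: "f \<in> Arr K" and g: "g \<in> Arr K" using presentationD(1)[OF p] presentationD(1)[OF q] .
  have B: "Cod K f \<in> Obj K" using f by simp
  have bH: "b \<in> Hom K (Cod K f) (Cod K g)" and cH: "c \<in> Hom K (Cod K f) (Cod K g)"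
    using b c by (auto simp: lifts_def)
  have id: "Ident K (Cod K f) \<in> Hom K (Cod K f) (Cod K f)" using B by (rule ident_closed)
  have "\<rho> (Cod K f) b = \<rho> (Cod K f) c"
  proof -
    have "\<rho> (Cod K f) (b \<cdot> Ident K (Cod K f)) = \<rho> (Cod K f) (c \<cdot> Ident K (Cod K f))"
      using b c id B unfolding lifts_def by metis
    then show ?thesis using bH cH by (simp add: comp_ident)
  qed
  \<comment> \<open>Evaluated on the identity, both lifts represent the same class, so their
    difference is a relation.\<close>
  then obtain s where s: "s \<in> Hom K (Cod K f) (Dom K g)" "b \<boxplus> Neg K c = g \<cdot> s"
    using presentation_eq_iff[OF G q B bH cH] by blast
  have gH: "g \<in> Hom K (Dom K g) (Cod K g)" using g by (simp add: Hom_def)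
  have x': "x \<in> Hom K X (dob (Cod K g))" "dar g \<cdot> x = Zero K X (dob (Dom K g))"
    using x by (auto simp: dual_ker_carrier[OF gH] simp del: ker_functor_simps)
  have X: "X \<in> Obj K" using x'(1) hom_obj by blast
  have "dar b \<cdot> x \<boxplus> Neg K (dar c \<cdot> x) = dar (b \<boxplus> Neg K c) \<cdot> x"
    using dar_add[OF bH neg_closed[OF cH]] dar_neg[OF cH] neg_comp[OF x'(1) dar_hom[OF cH]]
      comp_add[OF x'(1) dar_hom[OF bH] neg_closed[OF dar_hom[OF cH]]] by simp
  also have "\<dots> = dar s \<cdot> (dar g \<cdot> x)"
    unfolding s(2) using dar_comp[OF s(1) gH] comp_assoc[OF x'(1) dar_hom[OF gH] dar_hom[OF s(1)]] by simp
  also have "\<dots> = Zero K X (dob (Cod K f))"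
    unfolding x'(2) using in_HomD[OF s(1)] X by simp
  finally show ?thesis
    by (intro eq_if_sub_zero[OF comp_closed[OF x'(1) dar_hom[OF bH]] comp_closed[OF x'(1) dar_hom[OF cH]]])
qed

lemma lifts_comp:
  assumes b: "lifts K f \<pi> g \<rho> \<alpha> b" and c: "lifts K g \<rho> h \<sigma> \<beta> c"
    and fgh: "f \<in> Arr K" "g \<in> Arr K" "h \<in> Arr K"
  shows "lifts K f \<pi> h \<sigma> (\<lambda>X x. \<beta> X (\<alpha> X x)) (c \<cdot> b)"
  unfolding lifts_def
proof (intro conjI ballI)
  have bH: "b \<in> Hom K (Cod K f) (Cod K g)" and cH: "c \<in> Hom K (Cod K g) (Cod K h)"
    using b c by (auto simp: lifts_def)
  then show "c \<cdot> b \<in> Hom K (Cod K f) (Cod K h)" by (rule comp_closed)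
  obtain a where a: "a \<in> Hom K (Dom K f) (Dom K g)" "b \<cdot> f = g \<cdot> a" using b by (auto simp: lifts_def)
  obtain e where e: "e \<in> Hom K (Dom K g) (Dom K h)" "c \<cdot> g = h \<cdot> e" using c by (auto simp: lifts_def)
  have "(c \<cdot> b) \<cdot> f = c \<cdot> (g \<cdot> a)" using bH cH fgh a(2) by (simp add: Hom_def)
  also have "\<dots> = (c \<cdot> g) \<cdot> a" using cH a(1) fgh by (simp add: Hom_def)
  also have "\<dots> = h \<cdot> (e \<cdot> a)" unfolding e(2) using fgh a(1) e(1) by (simp add: Hom_def)
  finally show "\<exists>a\<in>Hom K (Dom K f) (Dom K h). (c \<cdot> b) \<cdot> f = h \<cdot> a"
    using comp_closed[OF a(1) e(1)] by blast
  fix X x assume X: "X \<in> Obj K" and x: "x \<in> Hom K X (Cod K f)"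
  have "\<beta> X (\<alpha> X (\<pi> X x)) = \<sigma> X (c \<cdot> (b \<cdot> x))"
    using b c X x comp_closed[OF x bH] unfolding lifts_def by metis
  then show "\<beta> X (\<alpha> X (\<pi> X x)) = \<sigma> X ((c \<cdot> b) \<cdot> x)" using x bH cH by (simp add: comp_assoc)
qed

lemma lifts_ident: 
  assumes "f \<in> Arr K"
  shows "lifts K f \<pi> f \<pi> (\<lambda>X x. x) (Ident K (Cod K f))"
  unfolding lifts_def using assms
  by (auto simp: ident_closed ident_comp intro!: bexI[of _ "Ident K (Dom K f)"])

lemma lifts_cong:
  assumes "lifts K f \<pi> g \<rho> \<alpha> b" and p: "presentation K f \<pi> F"
    and "\<And>X x. X \<in> Obj K \<Longrightarrow> x \<in> carrier (OnObj F X) \<Longrightarrow> \<alpha> X x = \<beta> X x"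
  shows "lifts K f \<pi> g \<rho> \<beta> b"
  using assms(1) unfolding lifts_def by (auto simp: assms(3) [symmetric] presentationD(2)[OF p])

text \<open>Lifts of the identity in both directions compose to lifts of the identity, and by
  \<open>lifts_dar_eq\<close> these act on the kernels as identity arrows do.\<close>

lemma dual_ker_iso:
  assumes F: "additive_presheaf K F" and p: "presentation K f \<pi> F" and q: "presentation K g \<rho> F"
  shows "presheaf_iso K (dual_ker f) (dual_ker g)"
proof -
  have f: "f \<in> Arr K" and g: "g \<in> Arr K" using presentationD(1)[OF p] presentationD(1)[OF q] .
  have fH: "f \<in> Hom K (Dom K f) (Cod K f)" and gH: "g \<in> Hom K (Dom K g) (Cod K g)"
    using f g by (auto simp: Hom_def)
  have id: "presheaf_map K F F (\<lambda>X x. x)" by (rule presheaf_mapI) auto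
  obtain b where b: "lifts K f \<pi> g \<rho> (\<lambda>X x. x) b" using presentation_lift[OF F p F q id] by blast
  obtain c where c: "lifts K g \<rho> f \<pi> (\<lambda>X x. x) c" using presentation_lift[OF F q F p id] by blast
  have bH: "b \<in> Hom K (Cod K f) (Cod K g)" and cH: "c \<in> Hom K (Cod K g) (Cod K f)"
    using b c by (auto simp: lifts_def)
  have mb: "presheaf_map K (dual_ker g) (dual_ker f) (\<lambda>X x. dar b \<cdot> x)"
    using b dual_ker_map[OF fH gH bH] unfolding lifts_def by blast
  have mc: "presheaf_map K (dual_ker f) (dual_ker g) (\<lambda>X x. dar c \<cdot> x)"
    using c dual_ker_map[OF gH fH cH] unfolding lifts_def by blast
  have "dar b \<cdot> (dar c \<cdot> x) = x" if "x \<in> carrier (OnObj (dual_ker f) X)" for X x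
  proof -
    have x: "x \<in> Hom K X (dob (Cod K f))"
      using that by (auto simp: dual_ker_carrier[OF fH] simp del: ker_functor_simps)
    have "dar (c \<cdot> b) \<cdot> x = dar (Ident K (Cod K f)) \<cdot> x"
      by (rule lifts_dar_eq[OF F p F p lifts_comp[OF b c f g f] lifts_ident[OF f] that])
    then show ?thesis
      using dar_comp[OF bH cH] comp_assoc[OF x dar_hom[OF cH] dar_hom[OF bH]] f x
      by (simp add: dar_ident ident_comp)
  qed
  moreover have "dar c \<cdot> (dar b \<cdot> x) = x" if "x \<in> carrier (OnObj (dual_ker g) X)" for X x
  proof -
    have x: "x \<in> Hom K X (dob (Cod K g))"
      using that by (auto simp: dual_ker_carrier[OF gH] simp del: ker_functor_simps)
    have "dar (b \<cdot> c) \<cdot> x = dar (Ident K (Cod K g)) \<cdot> x"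
      by (rule lifts_dar_eq[OF F q F q lifts_comp[OF c b g f g] lifts_ident[OF g] that])
    then show ?thesis
      using dar_comp[OF cH bH] comp_assoc[OF x dar_hom[OF bH] dar_hom[OF cH]] g x
      by (simp add: dar_ident ident_comp)
  qed
  ultimately show ?thesis by (intro presheaf_isoI[OF mc mb])
qed

text \<open>The exact sequence \<open>f\<close>, \<open>g\<close>, \<open>h\<close> dualises to
  \<open>dar h\<close>, \<open>dar g\<close>, \<open>dar f\<close>, again exact by
  \<open>weak_kernel_dar\<close>; so \<open>dar h\<close> presents the kernel of
  \<open>dar f\<close>, with projection \<open>dar g\<close>.\<close>

lemma dual_ker_presentation:
  assumes "f \<in> Arr K"
  shows "\<exists>h \<sigma>. presentation K h \<sigma> (dual_ker f)"
  using exact_sequence[OF assms] ker_functor_presentation weak_kernel_dar by blast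

section \<open>The dual functor, built on chosen presentations\<close>

definition pres_arr :: "('o, 'm, 'g) presheaf \<Rightarrow> 'm" where
  "pres_arr F = (SOME f. \<exists>\<pi>. presentation K f \<pi> F)"

definition pres_map :: "('o, 'm, 'g) presheaf \<Rightarrow> 'o \<Rightarrow> 'm \<Rightarrow> 'g" where
  "pres_map F = (SOME \<pi>. presentation K (pres_arr F) \<pi> F)"

lemma pres:
  assumes "F \<in> Obj (mod_cat K)"
  shows "presentation K (pres_arr F) (pres_map F) F"
proof -
  have "\<exists>f \<pi>. presentation K f \<pi> F" using assms by (simp add: mod_cat_simps finitely_presented_iff)
  then have "\<exists>\<pi>. presentation K (pres_arr F) \<pi> F" unfolding pres_arr_def by (rule someI_ex)
  then show ?thesis unfolding pres_map_def by (rule someI_ex)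
qed

lemma mod_cat_additive: "F \<in> Obj (mod_cat K) \<Longrightarrow> additive_presheaf K F"
  by (simp add: mod_cat_simps)

abbreviation pres_lifts where
  "pres_lifts F G \<equiv> lifts K (pres_arr F) (pres_map F) (pres_arr G) (pres_map G)"

text \<open>The formula refers to a presenting arrow, whereas a functor must depend on
  \<open>F\<close> alone; hence the chosen \<open>pres_arr F\<close>. By \<open>dual_ker_iso\<close>
  any other presentation gives an isomorphic kernel.\<close>

definition dual_obj :: "('o, 'm, 'm set) presheaf \<Rightarrow> ('o, 'm, 'm set) presheaf" where
  "dual_obj F = singleton_presheaf (dual_ker (pres_arr F))"

definition dual_map ::
  "('o, 'm, 'm set) presheaf \<Rightarrow> ('o, 'm, 'm set) presheaf \<Rightarrow> 'm \<Rightarrow> 'o \<Rightarrow> 'm set \<Rightarrow> 'm set" where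
  "dual_map F G b = (\<lambda>X\<in>Obj K. \<lambda>S\<in>carrier (OnObj (dual_obj G) X). {dar b \<cdot> the_elem S})"

text \<open>The lift is chosen as well, but by \<open>dual_map_eq\<close> every lift gives the same
  arrow; from then on \<open>dual_ftr_arr\<close> replaces the chosen lift by any convenient
  one.\<close>

definition dual_ftr where
  "dual_ftr = \<lparr>OnObj = dual_obj,
     OnArr = (\<lambda>(F, \<alpha>, G). (dual_obj G, dual_map F G (SOME b. pres_lifts F G \<alpha> b), dual_obj F))\<rparr>"

lemma dual_ftr_obj [simp]: "OnObj dual_ftr = dual_obj"
  by (simp add: dual_ftr_def)

lemma dual_obj_closed:
  assumes "F \<in> Obj (mod_cat K)"
  shows "dual_obj F \<in> Obj (mod_cat K)"
proof -
  have f: "pres_arr F \<in> Arr K" using presentationD(1)[OF pres[OF assms]] .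
  have "additive_presheaf K (dual_ker (pres_arr F))" by (rule additive_presheaf_ker_functor) (use f in simp)
  then show ?thesis
    using dual_ker_presentation[OF f] presentation_singleton additive_presheaf_singleton
    unfolding dual_obj_def mod_cat_simps finitely_presented_iff by blast
qed

lemma dual_map_hom:
  assumes F: "F \<in> Obj (mod_cat K)" and G: "G \<in> Obj (mod_cat K)" and b: "pres_lifts F G \<alpha> b"
  shows "(dual_obj G, dual_map F G b, dual_obj F) \<in> Hom (mod_cat K) (dual_obj G) (dual_obj F)"
proof -
  have f: "pres_arr F \<in> Arr K" and g: "pres_arr G \<in> Arr K"
    using presentationD(1)[OF pres[OF F]] presentationD(1)[OF pres[OF G]] .
  have fH: "pres_arr F \<in> Hom K (Dom K (pres_arr F)) (Cod K (pres_arr F))"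
    and gH: "pres_arr G \<in> Hom K (Dom K (pres_arr G)) (Cod K (pres_arr G))"
    using f g by (auto simp: Hom_def)
  have "presheaf_map K (dual_ker (pres_arr G)) (dual_ker (pres_arr F)) (\<lambda>X x. dar b \<cdot> x)"
    using b dual_ker_map[OF fH gH] unfolding lifts_def by blast
  note m = presheaf_mapD[OF this]
  have "presheaf_map K (dual_obj G) (dual_obj F) (\<lambda>X S. {dar b \<cdot> the_elem S})"
    unfolding dual_obj_def
    by (rule presheaf_mapI) (use m(2-4) in \<open>auto simp del: ker_functor_simps\<close>)
  then show ?thesis
    unfolding dual_map_def
    by (rule mod_cat_restrict_hom[OF category_axioms dual_obj_closed[OF G] dual_obj_closed[OF F]])
qed

lemma pres_lifts_exists:
  assumes "(F, \<alpha>, G) \<in> Hom (mod_cat K) F G"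
  shows "\<exists>b. pres_lifts F G \<alpha> b"
  using assms presentation_lift[OF mod_cat_additive pres mod_cat_additive pres]
  unfolding mod_cat_hom_iff by blast

lemma dual_map_eq:
  assumes F: "F \<in> Obj (mod_cat K)" and G: "G \<in> Obj (mod_cat K)"
    and b: "pres_lifts F G \<alpha> b" and c: "pres_lifts F G \<alpha> c"
  shows "dual_map F G b = dual_map F G c"
  unfolding dual_map_def dual_obj_def
  using lifts_dar_eq[OF mod_cat_additive[OF F] pres[OF F] mod_cat_additive[OF G] pres[OF G] b c]
  by (auto intro!: restrict_ext simp del: ker_functor_simps)

lemma dual_ftr_arr:
  assumes "(F, \<alpha>, G) \<in> Hom (mod_cat K) F G" and "pres_lifts F G \<alpha> b"
  shows "OnArr dual_ftr (F, \<alpha>, G) = (dual_obj G, dual_map F G b, dual_obj F)"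
  using dual_map_eq[OF _ _ someI_ex[OF pres_lifts_exists[OF assms(1)]] assms(2)] assms(1)
  by (auto simp: dual_ftr_def mod_cat_hom_iff)

text \<open>Identities lift identities and composites of lifts lift composites, so functoriality is
  inherited from \<open>dar\<close> through \<open>dual_ftr_arr\<close>.\<close>

lemma dual_ftr_functor: "is_functor (op_cat (mod_cat K)) (mod_cat K) dual_ftr"
  unfolding is_functor_def op_cat_simps Hom_op_cat
proof (intro conjI ballI impI)
  fix F :: "('o, 'm, 'm set) presheaf" assume F: "F \<in> Obj (mod_cat K)"
  then show "OnObj dual_ftr F \<in> Obj (mod_cat K)" by (simp add: dual_ftr_def dual_obj_closed)
  interpret M: category "mod_cat K :: (('o, 'm, 'm set) presheaf, _) cat"
    using category_mod_cat[OF category_axioms] .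
  have f: "pres_arr F \<in> Arr K" using presentationD(1)[OF pres[OF F]] .
  have "pres_lifts F F (\<lambda>X\<in>Obj K. \<lambda>x\<in>carrier (OnObj F X). x) (Ident K (Cod K (pres_arr F)))"
    by (rule lifts_cong[OF lifts_ident[OF f] pres[OF F]]) simp
  then have "OnArr dual_ftr (Ident (mod_cat K) F) =
      (dual_obj F, dual_map F F (Ident K (Cod K (pres_arr F))), dual_obj F)"
    using M.ident_closed[OF F] unfolding mod_cat_simps by (rule dual_ftr_arr[rotated])
  also have "dual_map F F (Ident K (Cod K (pres_arr F))) = (\<lambda>X\<in>Obj K. \<lambda>x\<in>carrier (OnObj (dual_obj F) X). x)"
    unfolding dual_map_def dual_obj_def using f
    by (auto intro!: restrict_ext simp: dar_ident ident_comp)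
  finally show "OnArr dual_ftr (Ident (mod_cat K) F) = Ident (mod_cat K) (OnObj dual_ftr F)"
    by (simp only: mod_cat_simps dual_ftr_obj)
next
  fix F G :: "('o, 'm, 'm set) presheaf" and m
  assume G: "F \<in> Obj (mod_cat K)" and F: "G \<in> Obj (mod_cat K)" and m: "m \<in> Hom (mod_cat K) G F"
  obtain \<alpha> where e: "m = (G, \<alpha>, F)" using m by (auto simp: mod_cat_hom_iff)
  obtain b where b: "pres_lifts G F \<alpha> b" using pres_lifts_exists m e by blast
  show "OnArr dual_ftr m \<in> Hom (mod_cat K) (OnObj dual_ftr F) (OnObj dual_ftr G)"
    using dual_ftr_arr[OF m[unfolded e] b] dual_map_hom[OF F G b] by (simp add: e dual_ftr_def)
next
  fix m n :: "('o, 'm, 'm set) presheaf \<times> ('o \<Rightarrow> 'm set \<Rightarrow> 'm set) \<times> ('o, 'm, 'm set) presheaf"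
  assume mn: "m \<in> Arr (mod_cat K)" "n \<in> Arr (mod_cat K)" "Dom (mod_cat K) m = Cod (mod_cat K) n"
  interpret M: category "mod_cat K :: (('o, 'm, 'm set) presheaf, _) cat"
    using category_mod_cat[OF category_axioms] .
  obtain F G H where n: "n \<in> Hom (mod_cat K) F G" and m: "m \<in> Hom (mod_cat K) G H"
    using mn by (auto simp: Hom_def)
  have nm: "m \<cdot>\<^bsub>mod_cat K\<^esub> n \<in> Hom (mod_cat K) F H" using M.comp_closed[OF n m] .
  obtain \<alpha> \<beta> where e: "n = (F, \<alpha>, G)" "m = (G, \<beta>, H)" and F: "F \<in> Obj (mod_cat K)"
    and G: "G \<in> Obj (mod_cat K)" and H: "H \<in> Obj (mod_cat K)"
    using n m by (auto simp: mod_cat_hom_iff)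
  obtain b where b: "pres_lifts F G \<alpha> b" using pres_lifts_exists n e by blast
  obtain c where c: "pres_lifts G H \<beta> c" using pres_lifts_exists m e by blast
  have f: "pres_arr F \<in> Arr K" and g: "pres_arr G \<in> Arr K" and h: "pres_arr H \<in> Arr K"
    using presentationD(1)[OF pres[OF F]] presentationD(1)[OF pres[OF G]] presentationD(1)[OF pres[OF H]] .
  have bH: "b \<in> Hom K (Cod K (pres_arr F)) (Cod K (pres_arr G))"
    and cH: "c \<in> Hom K (Cod K (pres_arr G)) (Cod K (pres_arr H))"
    using b c by (auto simp: lifts_def)
  let ?\<gamma> = "\<lambda>X\<in>Obj K. \<lambda>x\<in>carrier (OnObj F X). \<beta> X (\<alpha> X x)"
  have cb: "pres_lifts F H ?\<gamma> (c \<cdot> b)"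
    by (rule lifts_cong[OF lifts_comp[OF b c f g h] pres[OF F]]) simp
  have "OnArr dual_ftr (m \<cdot>\<^bsub>mod_cat K\<^esub> n) = (dual_obj H, dual_map F H (c \<cdot> b), dual_obj F)"
    using nm unfolding e mod_cat_simps by (intro dual_ftr_arr[OF _ cb])
  also have "dual_map F H (c \<cdot> b) = (\<lambda>X\<in>Obj K. \<lambda>S\<in>carrier (OnObj (dual_obj H) X).
      dual_map F G b X (dual_map G H c X S))"
  proof -
    have "(dual_obj H, dual_map G H c, dual_obj G) \<in> Hom (mod_cat K) (dual_obj H) (dual_obj G)"
      by (rule dual_map_hom[OF G H c])
    \<comment> \<open>\<open>dual_map\<close> is restricted to carriers, so the inner value must be
      known to lie in one before the outer map can be unfolded.\<close>
    then have cl: "dual_map G H c X S \<in> carrier (OnObj (dual_obj G) X)"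
      if "X \<in> Obj K" "S \<in> carrier (OnObj (dual_obj H) X)" for X S
      using that presheaf_mapD(2) by (auto simp: mod_cat_hom_iff)
    have "{dar (c \<cdot> b) \<cdot> the_elem S} = dual_map F G b X (dual_map G H c X S)"
      if X: "X \<in> Obj K" and S: "S \<in> carrier (OnObj (dual_obj H) X)" for X S
    proof -
      obtain x where x: "S = {x}" "x \<in> Hom K X (dob (Cod K (pres_arr H)))"
        using S h unfolding dual_obj_def by (auto simp: Hom_def)
      show ?thesis
        using cl[OF X S] X S x(1) comp_assoc[OF x(2) dar_hom[OF cH] dar_hom[OF bH]] dar_comp[OF bH cH]
        by (simp add: dual_map_def)
    qed
    then show ?thesis by (subst dual_map_def) (auto intro!: restrict_ext)
  qed
  finally show "OnArr dual_ftr (m \<cdot>\<^bsub>mod_cat K\<^esub> n) = OnArr dual_ftr n \<cdot>\<^bsub>mod_cat K\<^esub> OnArr dual_ftr m"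
    unfolding e dual_ftr_arr[OF n[unfolded e] b] dual_ftr_arr[OF m[unfolded e] c] mod_cat_simps .
qed

text \<open>The dual maps are compared on a single element. For a weak cokernel \<open>u\<close> of
  \<open>g\<close>, the arrow \<open>dar u\<close> generates the kernel of \<open>dar g\<close>.
  Equality there gives \<open>u \<cdot> b = u \<cdot> c\<close>, and since \<open>g\<close> is a
  weak kernel of \<open>u\<close>, the difference of the two lifts is a relation.\<close>

lemma dual_ftr_faithful: "faithful_functor (op_cat (mod_cat K)) dual_ftr"
  unfolding faithful_functor_def op_cat_simps Hom_op_cat
proof (intro ballI inj_onI)
  fix F G :: "('o, 'm, 'm set) presheaf" and m n
  assume G: "G \<in> Obj (mod_cat K)" and F: "F \<in> Obj (mod_cat K)"
    and m: "m \<in> Hom (mod_cat K) F G" and n: "n \<in> Hom (mod_cat K) F G"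
    and eq: "OnArr dual_ftr m = OnArr dual_ftr n"
  obtain \<alpha> where \<alpha>: "m = (F, \<alpha>, G)" using m by (auto simp: mod_cat_hom_iff)
  obtain \<beta> where \<beta>: "n = (F, \<beta>, G)" using n by (auto simp: mod_cat_hom_iff)
  obtain b where b: "pres_lifts F G \<alpha> b" using pres_lifts_exists m \<alpha> by blast
  obtain c where c: "pres_lifts F G \<beta> c" using pres_lifts_exists n \<beta> by blast
  let ?f = "pres_arr F" and ?g = "pres_arr G"
  have bH: "b \<in> Hom K (Cod K ?f) (Cod K ?g)" and cH: "c \<in> Hom K (Cod K ?f) (Cod K ?g)"
    using b c by (auto simp: lifts_def)
  have g: "?g \<in> Arr K" using presentationD(1)[OF pres[OF G]] .
  obtain u where wk: "weak_kernel K ?g u" and wc: "weak_cokernel K u ?g"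
    using exact_sequence[OF g] by blast
  have u: "u \<in> Hom K (Cod K ?g) (Cod K u)" and ug: "u \<cdot> ?g = Zero K (Dom K ?g) (Cod K u)"
    using wc by (auto simp: weak_cokernel_def)
  have X: "dob (Cod K u) \<in> Obj K" using hom_obj(2)[OF u] by (rule dob_obj)
  have gH: "?g \<in> Hom K (Dom K ?g) (Cod K ?g)" using g by (simp add: Hom_def)
  have "dar u \<in> carrier (OnObj (dual_ker ?g) (dob (Cod K u)))"
    using dar_hom[OF u] dar_comp[OF gH u] ug g hom_obj(2)[OF u]
    by (simp add: dual_ker_carrier[OF gH] dar_zero del: ker_functor_simps)
  then have du: "{dar u} \<in> carrier (OnObj (dual_obj G) (dob (Cod K u)))" by (simp add: dual_obj_def)
  have "dual_map F G b (dob (Cod K u)) {dar u} = dual_map F G c (dob (Cod K u)) {dar u}"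
    using eq dual_ftr_arr[OF m[unfolded \<alpha>] b] dual_ftr_arr[OF n[unfolded \<beta>] c] by (simp add: \<alpha> \<beta>)
  then have "dar (u \<cdot> b) = dar (u \<cdot> c)"
    using du X dar_comp[OF bH u] dar_comp[OF cH u] by (simp add: dual_map_def)
  then have ubc: "u \<cdot> b = u \<cdot> c"
    by (rule dar_inj[OF comp_closed[OF bH u] comp_closed[OF cH u]])
  have "u \<cdot> (b \<boxplus> Neg K c) = Zero K (Cod K ?f) (Cod K u)"
    using add_comp[OF bH neg_closed[OF cH] u] comp_neg[OF cH u] ubc add_neg[OF comp_closed[OF cH u]] by simp
  moreover have "b \<boxplus> Neg K c \<in> Hom K (Cod K ?f) (Dom K u)"
    using add_closed[OF bH neg_closed[OF cH]] in_HomD[OF u] by simp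
  ultimately obtain s where s: "s \<in> Hom K (Cod K ?f) (Dom K ?g)" "b \<boxplus> Neg K c = ?g \<cdot> s"
    using wk by (auto simp: weak_kernel_def)
  have "\<alpha> X y = \<beta> X y" if X: "X \<in> Obj K" and y: "y \<in> carrier (OnObj F X)" for X y
  proof -
    obtain x where x: "x \<in> Hom K X (Cod K ?f)" "pres_map F X x = y"
      using presentationD(5)[OF pres[OF F] X y] by blast
    have "b \<cdot> x \<boxplus> Neg K (c \<cdot> x) = ?g \<cdot> (s \<cdot> x)"
      using comp_add[OF x(1) bH neg_closed[OF cH]] neg_comp[OF x(1) cH] s(2) comp_assoc[OF x(1) s(1) gH] by simp
    then have "pres_map G X (b \<cdot> x) = pres_map G X (c \<cdot> x)"
      using presentation_eq_iff[OF mod_cat_additive[OF G] pres[OF G] X comp_closed[OF x(1) bH] comp_closed[OF x(1) cH]]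
        comp_closed[OF x(1) s(1)] by blast
    then show ?thesis using b c x X unfolding lifts_def by metis
  qed
  then show "m = n" using m n unfolding \<alpha> \<beta> by (intro mod_cat_hom_eqI)
qed

text \<open>A map \<open>\<beta>\<close> between dual kernels is determined by its value
  \<open>q\<close> on the generator \<open>dar u\<close>, and \<open>q\<close> is the dual of some
  \<open>\<mu>\<close>. Two vanishing conditions on \<open>\<mu>\<close>, one from the target of
  \<open>\<beta>\<close> and one from the relations of its source, turn \<open>\<mu>\<close> into a
  lift \<open>b\<close>.\<close>

lemma dual_ftr_full: "full_functor (op_cat (mod_cat K)) (mod_cat K) dual_ftr"
  unfolding full_functor_def op_cat_simps Hom_op_cat
proof (intro ballI subsetI)
  fix F G :: "('o, 'm, 'm set) presheaf" and m
  assume G: "G \<in> Obj (mod_cat K)" and F: "F \<in> Obj (mod_cat K)"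
    and m: "m \<in> Hom (mod_cat K) (OnObj dual_ftr G) (OnObj dual_ftr F)"
  obtain \<beta> where e: "m = (dual_obj G, \<beta>, dual_obj F)"
    and \<beta>: "presheaf_map K (dual_obj G) (dual_obj F) \<beta>"
    using m by (auto simp: mod_cat_hom_iff dual_ftr_def)
  define f g where "f = pres_arr F" and "g = pres_arr G"
  have pF: "presentation K f (pres_map F) F" and pG: "presentation K g (pres_map G) G"
    using pres[OF F] pres[OF G] by (auto simp: f_def g_def)
  have f: "f \<in> Arr K" and g: "g \<in> Arr K" using presentationD(1)[OF pF] presentationD(1)[OF pG] .
  have fH: "f \<in> Hom K (Dom K f) (Cod K f)" and gH: "g \<in> Hom K (Dom K g) (Cod K g)"
    using f g by (auto simp: Hom_def)
  obtain u v where wk: "weak_kernel K g u" "weak_kernel K u v" and wc: "weak_cokernel K u g" "weak_cokernel K v u"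
    using exact_sequence[OF g] by blast
  have u: "u \<in> Hom K (Cod K g) (Cod K u)" and ug: "u \<cdot> g = Zero K (Dom K g) (Cod K u)"
    and v: "v \<in> Hom K (Cod K u) (Cod K v)" and vu: "v \<cdot> u = Zero K (Dom K u) (Cod K v)"
    using wc by (auto simp: weak_cokernel_def)
  have U: "Cod K u \<in> Obj K" "Cod K f \<in> Obj K" "Cod K v \<in> Obj K" "Cod K g \<in> Obj K" "Dom K f \<in> Obj K"
    "Dom K u = Cod K g"
    using hom_obj[OF u] hom_obj[OF v] in_HomD(2)[OF u] f g by simp_all
  let ?X = "dob (Cod K u)"
  have carF: "carrier (OnObj (dual_obj F) X) = (\<lambda>x. {x}) ` {x \<in> Hom K X (dob (Cod K f)). dar f \<cdot> x = Zero K X (dob (Dom K f))}"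
    and carG: "carrier (OnObj (dual_obj G) X) = (\<lambda>x. {x}) ` {x \<in> Hom K X (dob (Cod K g)). dar g \<cdot> x = Zero K X (dob (Dom K g))}" for X
    using f g by (simp_all add: dual_obj_def flip: f_def g_def)
  have act: "OnArr (dual_obj F) w S = {the_elem S \<cdot> w}" "OnArr (dual_obj G) w S = {the_elem S \<cdot> w}" for w S
    by (simp_all add: dual_obj_def)
  have du: "{dar u} \<in> carrier (OnObj (dual_obj G) ?X)"
    using dar_hom[OF u] dar_comp[OF gH u] ug g U by (simp add: carG dar_zero)
  have "\<beta> ?X {dar u} \<in> carrier (OnObj (dual_obj F) ?X)"
    by (rule presheaf_mapD(2)[OF \<beta> dob_obj[OF U(1)] du])
  then obtain q where q: "\<beta> ?X {dar u} = {q}" "q \<in> Hom K ?X (dob (Cod K f))" "dar f \<cdot> q = Zero K ?X (dob (Dom K f))"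
    by (auto simp: carF)
  obtain \<mu> where \<mu>: "\<mu> \<in> Hom K (Cod K f) (Cod K u)" "dar \<mu> = q"
    using dar_surj[OF U(2,1) q(2)] by blast
  have nat: "\<beta> Y {dar u \<cdot> w} = {q \<cdot> w}" if w: "w \<in> Hom K Y ?X" for w Y
    using presheaf_mapD(4)[OF \<beta> w du] q(1) by (simp add: act)
  \<comment> \<open>That \<open>q\<close> lies in the kernel of \<open>dar f\<close> means
    \<open>\<mu> \<cdot> f = 0\<close>, by faithfulness of \<open>dar\<close>.\<close>
  have "dar (\<mu> \<cdot> f) = dar (Zero K (Dom K f) (Cod K u))"
    using dar_comp[OF fH \<mu>(1)] \<mu>(2) q(3) U by (simp add: dar_zero)
  then have \<mu>f: "\<mu> \<cdot> f = Zero K (Dom K f) (Cod K u)"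
    by (rule dar_inj[OF comp_closed[OF fH \<mu>(1)] zero_closed[OF U(5,1)]])
  \<comment> \<open>\<open>dar v\<close> is a relation on the generator \<open>dar u\<close>, so
    \<open>q \<cdot> dar v\<close> must vanish as well; this is the condition
    \<open>v \<cdot> \<mu> = 0\<close>.\<close>
  have "dar u \<cdot> dar v = Zero K (dob (Cod K v)) (dob (Cod K g))"
    using dar_comp[OF u v] vu U by (simp add: dar_zero)
  then have "{q \<cdot> dar v} = \<beta> (dob (Cod K v)) {Zero K (dob (Cod K v)) (dob (Cod K g))}"
    using nat[OF dar_hom[OF v]] by simp
  also have "\<dots> = {Zero K (dob (Cod K v)) (dob (Cod K f))}"
    using presheaf_map_one[OF mod_cat_additive[OF dual_obj_closed[OF G]] mod_cat_additive[OF dual_obj_closed[OF F]] \<beta>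
      dob_obj[OF U(3)]] f g by (simp add: dual_obj_def flip: f_def g_def)
  finally have "dar (v \<cdot> \<mu>) = dar (Zero K (Cod K f) (Cod K v))"
    using dar_comp[OF \<mu>(1) v] \<mu>(2) U by (simp add: dar_zero)
  then have "v \<cdot> \<mu> = Zero K (Cod K f) (Cod K v)"
    by (rule dar_inj[OF comp_closed[OF \<mu>(1) v] zero_closed[OF U(2,3)]])
  \<comment> \<open>\<open>u\<close> is a weak kernel of \<open>v\<close>, which yields
    \<open>b\<close>. Then \<open>u \<cdot> b \<cdot> f\<close> vanishes, and \<open>g\<close> being
    a weak kernel of \<open>u\<close> yields \<open>a\<close>.\<close>
  then obtain b where b: "b \<in> Hom K (Cod K f) (Cod K g)" "\<mu> = u \<cdot> b"
    using wk(2) \<mu>(1) in_HomD(2)[OF v] U by (auto simp: weak_kernel_def)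
  have "u \<cdot> (b \<cdot> f) = Zero K (Dom K f) (Cod K u)"
    using \<mu>f b comp_assoc[OF fH b(1) u] by simp
  then obtain a where a: "a \<in> Hom K (Dom K f) (Dom K g)" "b \<cdot> f = g \<cdot> a"
    using wk(1) comp_closed[OF fH b(1)] U by (auto simp: weak_kernel_def)
  obtain \<alpha> where \<alpha>: "presheaf_map K F G \<alpha>" "lifts K f (pres_map F) g (pres_map G) \<alpha> b"
    using presentation_descend[OF mod_cat_additive[OF F] pF mod_cat_additive[OF G] pG b(1) a] by blast
  define \<alpha>' where "\<alpha>' = (\<lambda>X\<in>Obj K. \<lambda>x\<in>carrier (OnObj F X). \<alpha> X x)"
  have hom: "(F, \<alpha>', G) \<in> Hom (mod_cat K) F G"
    unfolding \<alpha>'_def by (rule mod_cat_restrict_hom[OF category_axioms F G \<alpha>(1)])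
  have l: "pres_lifts F G \<alpha>' b"
    unfolding f_def [symmetric] g_def [symmetric] by (rule lifts_cong[OF \<alpha>(2) pF]) (simp add: \<alpha>'_def)
  have "(dual_obj G, dual_map F G b, dual_obj F) = (dual_obj G, \<beta>, dual_obj F)"
  proof (rule mod_cat_hom_eqI)
    show "(dual_obj G, dual_map F G b, dual_obj F) \<in> Hom (mod_cat K) (dual_obj G) (dual_obj F)"
      by (rule dual_map_hom[OF F G l])
    show "(dual_obj G, \<beta>, dual_obj F) \<in> Hom (mod_cat K) (dual_obj G) (dual_obj F)"
      using m by (simp add: e dual_ftr_def)
    fix X S assume X: "X \<in> Obj K" and S: "S \<in> carrier (OnObj (dual_obj G) X)"
    then obtain x where x: "S = {x}" "x \<in> Hom K X (dob (Cod K g))" "dar g \<cdot> x = Zero K X (dob (Dom K g))"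
      by (auto simp: carG)
    \<comment> \<open>Each element of the kernel of \<open>dar g\<close> is the generator composed
      with some \<open>w\<close>, so agreement of the two maps on \<open>dar u\<close>
      suffices.\<close>
    obtain w where w: "w \<in> Hom K X ?X" "x = dar u \<cdot> w"
      using weak_kernel_dar[OF wc(1)] x(2,3) g in_HomD[OF u] by (auto simp: weak_kernel_def)
    have "\<beta> X S = {q \<cdot> w}" using nat[OF w(1)] x(1) w(2) by simp
    also have "q \<cdot> w = dar b \<cdot> x"
      using \<mu>(2) b(2) dar_comp[OF b(1) u] w comp_assoc[OF w(1) dar_hom[OF u] dar_hom[OF b(1)]] by simp
    finally show "dual_map F G b X S = \<beta> X S" using X S x(1) by (simp add: dual_map_def)
  qed
  then have "m = OnArr dual_ftr (F, \<alpha>', G)" using dual_ftr_arr[OF hom l] e by simp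
  then show "m \<in> OnArr dual_ftr ` Hom (mod_cat K) F G" using hom by blast
qed

text \<open>The presentation chosen for the cokernel may differ from \<open>f\<close>;
  \<open>dual_ker_iso\<close> compares the two.\<close>

lemma dual_ftr_coker:
  assumes f: "f \<in> Arr K"
  shows "presheaf_iso K (OnObj dual_ftr (coker_functor K f)) (dual_ker f)"
proof -
  let ?F = "coker_functor K f"
  obtain \<pi> where \<pi>: "presentation K f \<pi> ?F" and F: "additive_presheaf K ?F"
    using coker_functor_presentation[OF f] by blast
  have "?F \<in> Obj (mod_cat K)" using F \<pi> by (auto simp: mod_cat_simps finitely_presented_iff)
  then have "presheaf_iso K (dual_ker (pres_arr ?F)) (dual_ker f)"
    by (rule dual_ker_iso[OF F pres \<pi>])
  then show ?thesis
    by (auto simp: dual_ftr_def dual_obj_def intro!: presheaf_iso_trans[OF category_axioms singleton_presheaf_iso])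
qed

text \<open>If \<open>f\<close> presents \<open>F\<close> and \<open>f\<close>, \<open>g\<close>,
  \<open>h\<close> is exact, then \<open>F\<close> is the kernel of \<open>(-, h)\<close>. Up to
  isomorphism \<open>h\<close> is a dual \<open>dar k\<close>, and the cokernel of
  \<open>(-, k)\<close> is the required preimage.\<close>

lemma dual_ftr_ess_surj: "ess_surj_functor (op_cat (mod_cat K)) (mod_cat K) dual_ftr"
  unfolding ess_surj_functor_def op_cat_simps
proof (intro ballI)
  fix F :: "('o, 'm, 'm set) presheaf" assume F: "F \<in> Obj (mod_cat K)"
  define f where "f = pres_arr F"
  have pF: "presentation K f (pres_map F) F" using pres[OF F] by (simp add: f_def)
  have f: "f \<in> Arr K" using presentationD(1)[OF pF] .
  obtain g h where fg: "weak_kernel K f g" and gh: "weak_kernel K g h"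
    using exact_sequence[OF f] by blast
  have h: "h \<in> Hom K (Dom K h) (Cod K h)" and g: "g \<in> Hom K (Dom K g) (Dom K h)"
    and hg: "h \<cdot> g = Zero K (Dom K g) (Cod K h)"
    and gf: "g \<cdot> f = Zero K (Dom K f) (Cod K g)"
    and f': "f \<in> Hom K (Dom K f) (Dom K g)"
    using fg gh by (auto simp: weak_kernel_def Hom_def)
  obtain C i where C: "C \<in> Obj K" and i: "i \<in> Hom K (Dom K h) (dob C)" "iso_arr K i"
    using dob_surj[OF hom_obj(1)[OF h]] by (auto simp: iso_objs_def)
  obtain E j where E: "E \<in> Obj K" and j: "j \<in> Hom K (Cod K h) (dob E)" "iso_arr K j"
    using dob_surj[OF hom_obj(2)[OF h]] by (auto simp: iso_objs_def)
  obtain i' where i': "i' \<in> Hom K (dob C) (Dom K h)" "i' \<cdot> i = Ident K (Dom K h)" "i \<cdot> i' = Ident K (dob C)"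
    using iso_arrE[OF i(2,1)] by metis
  obtain j' where j': "j' \<in> Hom K (dob E) (Cod K h)" "j' \<cdot> j = Ident K (Cod K h)"
    using iso_arrE[OF j(2,1)] by metis
  \<comment> \<open>\<open>h\<close> with both ends replaced by isomorphic dual objects; being a
    preimage under \<open>dar\<close>, the arrow \<open>k\<close> runs the other way, from
    \<open>E\<close> to \<open>C\<close>.\<close>
  obtain k where k: "k \<in> Hom K E C" "dar k = j \<cdot> (h \<cdot> i')"
    using dar_surj[OF E C] comp_closed[OF comp_closed[OF i'(1) h] j(1)] by blast
  note H = in_HomD[OF g] in_HomD[OF h] in_HomD[OF i(1)] in_HomD[OF j(1)] in_HomD[OF i'(1)] in_HomD[OF j'(1)]
    in_HomD[OF k(1)] in_HomD[OF f']
  \<comment> \<open>The isomorphisms preserve exactness, so the sequence \<open>f\<close>,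
    \<open>i \<cdot> g\<close>, \<open>dar k\<close> replaces \<open>f\<close>, \<open>g\<close>,
    \<open>h\<close>.\<close>
  have 1: "weak_kernel K (i \<cdot> g) (dar k)"
    unfolding weak_kernel_def
  proof (intro conjI allI ballI impI)
    show "i \<cdot> g \<in> Hom K (Dom K (i \<cdot> g)) (Dom K (dar k))" "dar k \<in> Arr K"
      using H by (auto simp: Hom_def)
    have "dar k \<cdot> (i \<cdot> g) = j \<cdot> (h \<cdot> ((i' \<cdot> i) \<cdot> g))" unfolding k(2) using H by simp
    also have "\<dots> = j \<cdot> (h \<cdot> g)" unfolding i'(2) using H by simp
    finally show "dar k \<cdot> (i \<cdot> g) = Zero K (Dom K (i \<cdot> g)) (Cod K (dar k))" unfolding hg using H by simp
    fix X x assume "x \<in> Hom K X (Dom K (dar k))" and kx: "dar k \<cdot> x = Zero K X (Cod K (dar k))"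
    then have x: "x \<in> Hom K X (dob C)" using H by simp
    note H = H in_HomD[OF x]
    have "h \<cdot> (i' \<cdot> x) = (j' \<cdot> j) \<cdot> (h \<cdot> (i' \<cdot> x))" unfolding j'(2) using H by simp
    also have "\<dots> = j' \<cdot> (dar k \<cdot> x)" unfolding k(2) using H by simp
    also have "\<dots> = Zero K X (Cod K h)" unfolding kx using H hom_obj(1)[OF x] by simp
    finally obtain y where y: "y \<in> Hom K X (Dom K g)" "i' \<cdot> x = g \<cdot> y"
      using gh comp_closed[OF x i'(1)] by (auto simp: weak_kernel_def)
    have "x = (i \<cdot> i') \<cdot> x" unfolding i'(3) using H by simp
    also have "\<dots> = (i \<cdot> g) \<cdot> y" using H y in_HomD[OF y(1)] by simp
    finally show "\<exists>y\<in>Hom K X (Dom K (i \<cdot> g)). x = (i \<cdot> g) \<cdot> y" using y(1) H by auto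
  qed
  have 2: "weak_kernel K f (i \<cdot> g)"
    unfolding weak_kernel_def
  proof (intro conjI allI ballI impI)
    show "f \<in> Hom K (Dom K f) (Dom K (i \<cdot> g))" "i \<cdot> g \<in> Arr K" using H by (auto simp: Hom_def)
    have "(i \<cdot> g) \<cdot> f = i \<cdot> (g \<cdot> f)" using H by simp
    then show "(i \<cdot> g) \<cdot> f = Zero K (Dom K f) (Cod K (i \<cdot> g))" unfolding gf using H by simp
    fix X x assume "x \<in> Hom K X (Dom K (i \<cdot> g))" and gx: "(i \<cdot> g) \<cdot> x = Zero K X (Cod K (i \<cdot> g))"
    then have x: "x \<in> Hom K X (Dom K g)" using H by simp
    note H = H in_HomD[OF x]
    have "g \<cdot> x = (i' \<cdot> i) \<cdot> (g \<cdot> x)" unfolding i'(2) using H by simp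
    also have "\<dots> = i' \<cdot> ((i \<cdot> g) \<cdot> x)" using H by simp
    also have "\<dots> = Zero K X (Cod K g)" unfolding gx using H hom_obj(1)[OF x] by simp
    finally show "\<exists>y\<in>Hom K X (Dom K f). x = f \<cdot> y" using fg x by (auto simp: weak_kernel_def)
  qed
  have k': "k \<in> Arr K" using k(1) by (rule in_HomD(1))
  have addk: "additive_presheaf K (dual_ker k)" by (rule additive_presheaf_ker_functor) (use k' in simp)
  have "presheaf_iso K (dual_ker k) F"
    by (rule presentation_unique[OF addk ker_functor_presentation[OF 1 2] mod_cat_additive[OF F] pF])
  then have iso: "presheaf_iso K (OnObj dual_ftr (coker_functor K k)) F"
    by (rule presheaf_iso_trans[OF category_axioms dual_ftr_coker[OF k']])
  have G: "coker_functor K k \<in> Obj (mod_cat K)"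
    using coker_functor_presentation[OF k'] by (auto simp: mod_cat_simps finitely_presented_iff)
  show "\<exists>G \<in> Obj (mod_cat K). iso_objs (mod_cat K) (OnObj dual_ftr G) F"
  proof
    show "iso_objs (mod_cat K) (OnObj dual_ftr (coker_functor K k)) F"
      using dual_obj_closed[OF G] by (intro mod_cat_iso_objs[OF category_axioms _ F iso]) (simp add: dual_ftr_def)
  qed (rule G)
qed

theorem dual_ftr_contravariant_equivalence:
  "contravariant_equivalence (mod_cat K) (mod_cat K) dual_ftr"
  unfolding contravariant_equivalence_def
  by (intro fully_faithful_ess_surj_imp_equivalence category_op_cat category_mod_cat category_axioms
      dual_ftr_functor dual_ftr_faithful dual_ftr_full dual_ftr_ess_surj)

end

section \<open>Exactness of triangles\<close>

lemma (in preadditive_category) zero_object_iff: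
  "zero_object C Z \<longleftrightarrow> Z \<in> Obj C \<and> Ident C Z = Zero C Z Z"
proof
  assume Z: "zero_object C Z"
  then have O: "Z \<in> Obj C" by (simp add: zero_object_def)
  then have "\<exists>!f. f \<in> Hom C Z Z" using Z by (auto simp: zero_object_def)
  then show "Z \<in> Obj C \<and> Ident C Z = Zero C Z Z"
    using ident_closed[OF O] zero_closed[OF O O] O by auto
next
  assume Z: "Z \<in> Obj C \<and> Ident C Z = Zero C Z Z"
  have "f = Zero C A Z" if "f \<in> Hom C A Z" for A f
    using ident_comp[OF that] Z that hom_obj[OF that] by (auto simp: Hom_def)
  moreover have "f = Zero C Z A" if "f \<in> Hom C Z A" for A f
    using comp_ident[OF that] Z that hom_obj[OF that] by (auto simp: Hom_def)
  ultimately show "zero_object C Z"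
    using Z zero_closed unfolding zero_object_def by blast
qed

lemma (in preadditive_category) zero_object_hom:
  assumes "zero_object C Z"
  shows "f \<in> Hom C A Z \<Longrightarrow> f = Zero C A Z" and "f \<in> Hom C Z A \<Longrightarrow> f = Zero C Z A"
  using assms zero_closed[of A Z] zero_closed[of Z A] hom_obj[of f A Z] hom_obj[of f Z A]
  unfolding zero_object_def by blast+

lemma (in preadditive_category) neg_zero:
  "A \<in> Obj C \<Longrightarrow> B \<in> Obj C \<Longrightarrow> Neg C (Zero C A B) = Zero C A B"
  using neg_unique[of "Zero C A B" A B "Zero C A B"] by (simp add: zero_closed add_zero)

context triangulated_category
begin

abbreviation "\<Sigma>\<^sub>o \<equiv> OnObj (Sus T)"
abbreviation "\<Sigma>\<^sub>a \<equiv> OnArr (Sus T)"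

lemma sus_functor: "is_functor T T (Sus T)"
  using sus_additive by (simp add: additive_functor_def)

lemma sus_simps [simp]:
  "A \<in> Obj T \<Longrightarrow> \<Sigma>\<^sub>o A \<in> Obj T"
  "f \<in> Arr T \<Longrightarrow> \<Sigma>\<^sub>a f \<in> Arr T"
  "f \<in> Arr T \<Longrightarrow> Dom T (\<Sigma>\<^sub>a f) = \<Sigma>\<^sub>o (Dom T f)"
  "f \<in> Arr T \<Longrightarrow> Cod T (\<Sigma>\<^sub>a f) = \<Sigma>\<^sub>o (Cod T f)"
  "A \<in> Obj T \<Longrightarrow> \<Sigma>\<^sub>a (Ident T A) = Ident T (\<Sigma>\<^sub>o A)"
  "f \<in> Arr T \<Longrightarrow> g \<in> Arr T \<Longrightarrow> Dom T g = Cod T f \<Longrightarrow> \<Sigma>\<^sub>a (g \<cdot> f) = \<Sigma>\<^sub>a g \<cdot> \<Sigma>\<^sub>a f"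
  using functor_arr_simps[OF category_axioms sus_functor] sus_functor by (auto simp: is_functor_def)

lemma sus_zero [simp]:
  assumes "A \<in> Obj T" "B \<in> Obj T"
  shows "\<Sigma>\<^sub>a (Zero T A B) = Zero T (\<Sigma>\<^sub>o A) (\<Sigma>\<^sub>o B)"
proof (rule add_self_zero)
  show "\<Sigma>\<^sub>a (Zero T A B) \<in> Hom T (\<Sigma>\<^sub>o A) (\<Sigma>\<^sub>o B)" using assms by (simp add: Hom_def)
  show "\<Sigma>\<^sub>a (Zero T A B) \<boxplus> \<Sigma>\<^sub>a (Zero T A B) = \<Sigma>\<^sub>a (Zero T A B)"
    using sus_additive assms zero_closed[OF assms] add_zero[OF zero_closed[OF assms]]
    unfolding additive_functor_def by metis
qed

lemma sus_zero_object: "zero_object T Z \<Longrightarrow> zero_object T (\<Sigma>\<^sub>o Z)"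
  unfolding zero_object_iff by (metis sus_simps(1,5) sus_zero)

lemma triD:
  assumes "(f, g, h) \<in> Tri T"
  shows "f \<in> Arr T" "g \<in> Arr T" "h \<in> Arr T" "Dom T g = Cod T f" "Dom T h = Cod T g"
    "Cod T h = \<Sigma>\<^sub>o (Dom T f)" "f \<in> Hom T (Dom T f) (Cod T f)" "g \<in> Hom T (Cod T f) (Cod T g)"
    "h \<in> Hom T (Cod T g) (\<Sigma>\<^sub>o (Dom T f))"
  using tri_candidate[OF assms] by (auto simp: candidate_triangle_def Hom_def)

lemma tri_rotate_left: "(f, g, h) \<in> Tri T \<Longrightarrow> (g, h, Neg T (\<Sigma>\<^sub>a f)) \<in> Tri T"
  using tri_rotate tri_candidate by blast

text \<open>The identity triangle of \<open>Y\<close> rotated backwards. It is taken with the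
  suspension of \<open>Z\<close> as zero object, so that its last arrow is the suspension of
  \<open>0 \<rightarrow> Y\<close>; the sign disappears because that arrow is zero.\<close>

lemma tri_ident_right:
  assumes Y: "Y \<in> Obj T" and Z: "zero_object T Z"
  shows "(Zero T Z Y, Ident T Y, Zero T Y (\<Sigma>\<^sub>o Z)) \<in> Tri T"
proof -
  have Zo: "Z \<in> Obj T" using Z by (simp add: zero_object_def)
  have "(Ident T Y, Zero T Y (\<Sigma>\<^sub>o Z), Neg T (\<Sigma>\<^sub>a (Zero T Z Y))) \<in> Tri T"
    using tri_ident[OF Y sus_zero_object[OF Z]] Y Zo by (simp add: neg_zero)
  then show ?thesis
    using Y Zo by (subst tri_rotate) (auto simp: candidate_triangle_def)
qed

text \<open>Comparison with the triangle on the identity of \<open>Dom T f\<close>: the square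
  formed by that identity and \<open>f\<close> makes \<open>g \<cdot> f\<close> factor through
  zero.\<close>

lemma tri_comp_zero:
  assumes "(f, g, h) \<in> Tri T"
  shows "g \<cdot> f = Zero T (Dom T f) (Cod T g)"
proof -
  note t = triD[OF assms]
  obtain Z where Z: "zero_object T Z" using has_zero_object by blast
  have Zo: "Z \<in> Obj T" using Z by (simp add: zero_object_def)
  have A: "Dom T f \<in> Obj T" using t by simp
  obtain c where c: "c \<in> Hom T Z (Cod T g)" "c \<cdot> Zero T (Dom T f) Z = g \<cdot> f"
    using tri_morphism[OF tri_ident[OF A Z] assms, of "Ident T (Dom T f)" f] t A Zo
    by (auto simp: ident_closed)
  then show ?thesis using in_HomD[OF c(1)] A by simp
qed

text \<open>An arrow \<open>x\<close> with \<open>x \<cdot> f = 0\<close> is part of a morphism to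
  the triangle \<open>0 \<rightarrow> Y = Y\<close>, whose third component is the wanted
  factorisation.\<close>

lemma tri_weak_cokernel:
  assumes "(f, g, h) \<in> Tri T"
  shows "weak_cokernel T g f"
  unfolding weak_cokernel_def
proof (intro conjI allI ballI impI)
  note t = triD[OF assms]
  show "g \<in> Hom T (Cod T f) (Cod T g)" "f \<in> Arr T" using t by auto
  show "g \<cdot> f = Zero T (Dom T f) (Cod T g)" by (rule tri_comp_zero[OF assms])
  fix Y x assume x: "x \<in> Hom T (Cod T f) Y" and xf: "x \<cdot> f = Zero T (Dom T f) Y"
  have Y: "Y \<in> Obj T" using hom_obj[OF x] by blast
  obtain Z where Z: "zero_object T Z" using has_zero_object by blast
  have Zo: "Z \<in> Obj T" using Z by (simp add: zero_object_def)
  show "\<exists>y\<in>Hom T (Cod T g) Y. x = y \<cdot> g"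
    using tri_morphism[OF assms tri_ident_right[OF Y Z], of "Zero T (Dom T f) Z" x] t x xf Y Zo in_HomD[OF x]
    by (auto simp: zero_closed)
qed

lemma sus_inj:
  assumes "\<Sigma>\<^sub>a f = \<Sigma>\<^sub>a g" "f \<in> Hom T A B" "g \<in> Hom T A B"
  shows "f = g"
  using equivalence_fully_faithful(1)[OF category_axioms category_axioms sus_equivalence] assms
    hom_obj[OF assms(2)] unfolding faithful_functor_def inj_on_def by blast

lemma sus_surj:
  assumes "k \<in> Hom T (\<Sigma>\<^sub>o A) (\<Sigma>\<^sub>o B)" "A \<in> Obj T" "B \<in> Obj T"
  shows "\<exists>f \<in> Hom T A B. \<Sigma>\<^sub>a f = k"
  using equivalence_fully_faithful(2)[OF category_axioms category_axioms sus_equivalence] assms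
  unfolding full_functor_def by blast

lemma neg_neg: "f \<in> Hom T A B \<Longrightarrow> Neg T (Neg T f) = f"
  using neg_unique[OF neg_closed, of f A B f] add_neg[of f A B] add_commute[OF neg_closed, of f A B f]
  by simp

text \<open>The axiom on morphisms of triangles supplies a third arrow, while here the first is
  wanted. Both triangles are rotated so that the suspension of \<open>y\<close> becomes the third,
  and \<open>y\<close> is recovered because suspension is fully faithful.\<close>

lemma tri_weak_kernel:
  assumes "(f, g, h) \<in> Tri T"
  shows "weak_kernel T f g"
  unfolding weak_kernel_def
proof (intro conjI allI ballI impI)
  note t = triD[OF assms]
  show "f \<in> Hom T (Dom T f) (Dom T g)" "g \<in> Arr T" using t by auto
  show "g \<cdot> f = Zero T (Dom T f) (Cod T g)" by (rule tri_comp_zero[OF assms])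
  fix X x assume x: "x \<in> Hom T X (Dom T g)" and gx: "g \<cdot> x = Zero T X (Cod T g)"
  note x' = in_HomD[OF x]
  have X: "X \<in> Obj T" using hom_obj[OF x] by blast
  obtain Z where Z: "zero_object T Z" using has_zero_object by blast
  have Zo: "Z \<in> Obj T" using Z by (simp add: zero_object_def)
  have "(Zero T X Z, Zero T Z (\<Sigma>\<^sub>o X), Neg T (\<Sigma>\<^sub>a (Ident T X))) \<in> Tri T"
    by (rule tri_rotate_left[OF tri_ident[OF X Z]])
  from tri_morphism[OF this tri_rotate_left[OF assms], of x "Zero T Z (Cod T g)"]
  obtain c where c: "c \<in> Hom T (\<Sigma>\<^sub>o X) (\<Sigma>\<^sub>o (Dom T f))"
    and eq: "\<Sigma>\<^sub>a x \<cdot> Neg T (Ident T (\<Sigma>\<^sub>o X)) = Neg T (\<Sigma>\<^sub>a f) \<cdot> c"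
    using t x gx X Zo x' by (auto simp: zero_closed)
  have A: "Dom T f \<in> Obj T" using t by simp
  obtain y where y: "y \<in> Hom T X (Dom T f)" "\<Sigma>\<^sub>a y = c" using sus_surj[OF c X A] by blast
  note y' = in_HomD[OF y(1)]
  have Sx: "\<Sigma>\<^sub>a x \<in> Hom T (\<Sigma>\<^sub>o X) (\<Sigma>\<^sub>o (Cod T f))" and Sf: "\<Sigma>\<^sub>a f \<in> Hom T (\<Sigma>\<^sub>o (Dom T f)) (\<Sigma>\<^sub>o (Cod T f))"
    using x' t by (auto intro!: in_HomI)
  have I: "Ident T (\<Sigma>\<^sub>o X) \<in> Hom T (\<Sigma>\<^sub>o X) (\<Sigma>\<^sub>o X)" using X by (simp add: ident_closed)
  have fy: "\<Sigma>\<^sub>a (f \<cdot> y) = \<Sigma>\<^sub>a f \<cdot> c" using y(2) t(1) y' by simp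
  \<comment> \<open>The rotations put a minus sign on both sides, and these cancel.\<close>
  have "Neg T (\<Sigma>\<^sub>a x) = Neg T (\<Sigma>\<^sub>a f \<cdot> c)"
    using eq comp_neg[OF I Sx] neg_comp[OF c Sf] comp_ident[OF Sx] by simp
  then have "Neg T (Neg T (\<Sigma>\<^sub>a x)) = Neg T (Neg T (\<Sigma>\<^sub>a f \<cdot> c))" by simp
  then have "\<Sigma>\<^sub>a x = \<Sigma>\<^sub>a (f \<cdot> y)"
    unfolding neg_neg[OF Sx] neg_neg[OF comp_closed[OF c Sf]] fy .
  then have "x = f \<cdot> y"
    by (rule sus_inj[of _ _ X "Dom T g"]) (use x x' y' t in \<open>auto simp: Hom_def\<close>)
  then show "\<exists>y\<in>Hom T X (Dom T f). x = f \<cdot> y" using y(1) by blast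
qed

end

section \<open>Compact objects\<close>

lemma (in category) iso_cancel_right:
  assumes "iso_arr C k" "k \<in> Hom C A B" "t \<in> Hom C B D" "t' \<in> Hom C B D" "t \<cdot> k = t' \<cdot> k"
  shows "t = t'"
proof -
  obtain i where i: "i \<in> Hom C B A" "k \<cdot> i = Ident C B" using iso_arrE[OF assms(1,2)] by metis
  have "t = (t \<cdot> k) \<cdot> i"
    using comp_assoc[OF i(1) assms(2,3)] i(2) comp_ident[OF assms(3)] by simp
  also have "\<dots> = t'"
    unfolding assms(5) using comp_assoc[OF i(1) assms(2,4)] i(2) comp_ident[OF assms(4)] by simp
  finally show ?thesis .
qed

text \<open>The endomorphism of \<open>S\<close> that projects onto the summands indexed by \<open>F\<close>. It turns compactness into
  an equation without sums, which every functor preserving coproducts and zero arrows transports.\<close>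

definition coproduct_part ::
  "('o, 'm, 'x) abcat_scheme \<Rightarrow> 'i set \<Rightarrow> ('i \<Rightarrow> 'o) \<Rightarrow> 'o \<Rightarrow> ('i \<Rightarrow> 'm) \<Rightarrow> 'i set \<Rightarrow> 'm" where
  "coproduct_part C I X S \<iota> F =
     (THE e. e \<in> Hom C S S \<and> (\<forall>i \<in> I. e \<cdot>\<^bsub>C\<^esub> \<iota> i = (if i \<in> F then \<iota> i else Zero C (X i) S)))"

context preadditive_category
begin

section \<open>Coproducts in a preadditive category, and compactness without sums\<close>

lemma coproduct_ex1:
  assumes "is_coproduct C I X S \<iota>" "Y \<in> Obj C" "\<And>i. i \<in> I \<Longrightarrow> f i \<in> Hom C (X i) Y"
  shows "\<exists>!h. h \<in> Hom C S Y \<and> (\<forall>i \<in> I. h \<cdot> \<iota> i = f i)"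
proof -
  have "\<forall>Y \<in> Obj C. \<forall>f. (\<forall>i \<in> I. f i \<in> Hom C (X i) Y) \<longrightarrow>
      (\<exists>!h. h \<in> Hom C S Y \<and> (\<forall>i \<in> I. h \<cdot> \<iota> i = f i))"
    using assms(1) unfolding is_coproduct_def by (elim conjE)
  from this[rule_format, OF assms(2), of f] assms(3) show ?thesis by simp
qed

lemma coproduct_ex:
  assumes "is_coproduct C I X S \<iota>" "Y \<in> Obj C" "\<And>i. i \<in> I \<Longrightarrow> f i \<in> Hom C (X i) Y"
  shows "\<exists>h \<in> Hom C S Y. \<forall>i \<in> I. h \<cdot> \<iota> i = f i"
  using ex1_implies_ex[OF coproduct_ex1[OF assms]] by blast

lemma coproduct_eqI:
  assumes "is_coproduct C I X S \<iota>" "f \<in> Hom C S Y" "g \<in> Hom C S Y"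
    and "\<And>i. i \<in> I \<Longrightarrow> f \<cdot> \<iota> i = g \<cdot> \<iota> i"
  shows "f = g"
proof -
  have \<iota>: "\<iota> i \<in> Hom C (X i) S" if "i \<in> I" for i using assms(1) that by (auto simp: is_coproduct_def)
  obtain h where h: "\<forall>k. k \<in> Hom C S Y \<and> (\<forall>i \<in> I. k \<cdot> \<iota> i = g \<cdot> \<iota> i) \<longrightarrow> k = h"
    using coproduct_ex1[OF assms(1) hom_obj(2)[OF assms(3)] comp_closed[OF \<iota> assms(3)]]
    unfolding Ex1_def by blast
  have "f = h" "g = h" using h[rule_format, of f] h[rule_format, of g] assms(2-4) by simp_all
  then show ?thesis by simp
qed

lemma coproductD:
  assumes "is_coproduct C I X S \<iota>"
  shows "S \<in> Obj C" "i \<in> I \<Longrightarrow> X i \<in> Obj C" "i \<in> I \<Longrightarrow> \<iota> i \<in> Hom C (X i) S"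
  using assms by (auto simp: is_coproduct_def)

lemma coproduct_part:
  assumes S: "is_coproduct C I X S \<iota>"
  shows "coproduct_part C I X S \<iota> F \<in> Hom C S S"
    and "i \<in> I \<Longrightarrow> coproduct_part C I X S \<iota> F \<cdot> \<iota> i = (if i \<in> F then \<iota> i else Zero C (X i) S)"
proof -
  let ?P = "\<lambda>e. e \<in> Hom C S S \<and> (\<forall>i \<in> I. e \<cdot> \<iota> i = (if i \<in> F then \<iota> i else Zero C (X i) S))"
  have "(if i \<in> F then \<iota> i else Zero C (X i) S) \<in> Hom C (X i) S" if "i \<in> I" for i
    using coproductD(3)[OF S that] zero_closed[OF coproductD(2)[OF S that] coproductD(1)[OF S]] by simp
  from coproduct_ex[OF S coproductD(1)[OF S] this] obtain e where "?P e" by blast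
  moreover have "e' = e" if "?P e'" for e'
    by (rule coproduct_eqI[OF S]) (use that \<open>?P e\<close> in auto)
  ultimately have "?P (coproduct_part C I X S \<iota> F)"
    unfolding coproduct_part_def by (rule theI)
  then show "coproduct_part C I X S \<iota> F \<in> Hom C S S"
    and "i \<in> I \<Longrightarrow> coproduct_part C I X S \<iota> F \<cdot> \<iota> i = (if i \<in> F then \<iota> i else Zero C (X i) S)"
    by auto
qed

lemma coproduct_part_eqI:
  assumes S: "is_coproduct C I X S \<iota>" and "e \<in> Hom C S S"
    and "\<And>i. i \<in> I \<Longrightarrow> e \<cdot> \<iota> i = (if i \<in> F then \<iota> i else Zero C (X i) S)"
  shows "coproduct_part C I X S \<iota> F = e"
  by (rule coproduct_eqI[OF S coproduct_part(1)[OF S] assms(2)]) (simp add: coproduct_part(2)[OF S] assms(3))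

text \<open>Allows finite index sets to be enlarged: an arrow fixed by the part for \<open>F\<close>
  is fixed by the part for every larger \<open>H\<close>.\<close>

lemma coproduct_part_absorb:
  assumes S: "is_coproduct C I X S \<iota>" and "F \<subseteq> H"
  shows "coproduct_part C I X S \<iota> H \<cdot> coproduct_part C I X S \<iota> F = coproduct_part C I X S \<iota> F"
proof -
  note e = coproduct_part[OF S]
  show ?thesis
  proof (rule coproduct_part_eqI[OF S, symmetric])
    fix i assume i: "i \<in> I"
    show "(coproduct_part C I X S \<iota> H \<cdot> coproduct_part C I X S \<iota> F) \<cdot> \<iota> i =
        (if i \<in> F then \<iota> i else Zero C (X i) S)"
      using comp_assoc[OF coproductD(3)[OF S i] e(1) e(1)] e(2)[OF i] \<open>F \<subseteq> H\<close> coproductD[OF S] i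
        in_HomD[OF e(1)] by auto
  qed (rule comp_closed[OF e(1) e(1)])
qed

lemma comp_finprod:
  assumes "finite J" "\<And>i. i \<in> J \<Longrightarrow> f i \<in> Hom C A B" "g \<in> Hom C B D" "A \<in> Obj C"
  shows "g \<cdot> finprod (HomGrp C A B) f J = finprod (HomGrp C A D) (\<lambda>i. g \<cdot> f i) J"
proof -
  interpret B: comm_group "HomGrp C A B" using hom_comm_group assms(4) hom_obj[OF assms(3)] by auto
  interpret D: comm_group "HomGrp C A D" using hom_comm_group assms(4) hom_obj[OF assms(3)] by auto
  show ?thesis
    using assms(1,2)
  proof (induction J rule: finite_induct)
    case empty then show ?case using assms(3,4) in_HomD[OF assms(3)] by simp
  next
    case (insert j J)
    then have "finprod (HomGrp C A B) f J \<in> Hom C A B"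
      using B.finprod_closed[of f J] by (auto simp: Pi_iff)
    moreover have "(\<lambda>i. g \<cdot> f i) \<in> J \<rightarrow> Hom C A D" "g \<cdot> f j \<in> Hom C A D"
      using insert.prems comp_closed[OF _ assms(3)] by auto
    ultimately show ?case
      using insert add_comp[of _ A B _ g, OF _ _ assms(3)] by (simp add: B.finprod_insert D.finprod_insert Pi_iff)
  qed
qed

lemma finprod_comp:
  assumes "finite J" "\<And>i. i \<in> J \<Longrightarrow> f i \<in> Hom C B D" "g \<in> Hom C A B" "D \<in> Obj C"
  shows "finprod (HomGrp C B D) f J \<cdot> g = finprod (HomGrp C A D) (\<lambda>i. f i \<cdot> g) J"
proof -
  interpret B: comm_group "HomGrp C B D" using hom_comm_group assms(4) hom_obj[OF assms(3)] by auto
  interpret D: comm_group "HomGrp C A D" using hom_comm_group assms(4) hom_obj[OF assms(3)] by auto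
  show ?thesis
    using assms(1,2)
  proof (induction J rule: finite_induct)
    case empty then show ?case using assms(3,4) in_HomD[OF assms(3)] by simp
  next
    case (insert j J)
    then have "finprod (HomGrp C B D) f J \<in> Hom C B D"
      using B.finprod_closed[of f J] by (auto simp: Pi_iff)
    moreover have "(\<lambda>i. f i \<cdot> g) \<in> J \<rightarrow> Hom C A D" "f j \<cdot> g \<in> Hom C A D"
      using insert.prems comp_closed[OF assms(3)] by auto
    ultimately show ?case
      using insert comp_add[of g A B _ D, OF assms(3)] by (simp add: B.finprod_insert D.finprod_insert Pi_iff)
  qed
qed

lemma coproduct_proj:
  assumes S: "is_coproduct C I X S \<iota>"
  obtains p where "\<And>i. i \<in> I \<Longrightarrow> p i \<in> Hom C S (X i)"
    "\<And>i j. i \<in> I \<Longrightarrow> j \<in> I \<Longrightarrow> p i \<cdot> \<iota> j = (if i = j then Ident C (X i) else Zero C (X j) (X i))"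
proof -
  have "\<exists>p. i \<in> I \<longrightarrow> p \<in> Hom C S (X i) \<and>
      (\<forall>j \<in> I. p \<cdot> \<iota> j = (if i = j then Ident C (X i) else Zero C (X j) (X i)))" for i
  proof (cases "i \<in> I")
    case True
    note Xi = coproductD(2)[OF S True]
    have "(if i = j then Ident C (X i) else Zero C (X j) (X i)) \<in> Hom C (X j) (X i)" if "j \<in> I" for j
      using ident_closed[OF Xi] zero_closed[OF coproductD(2)[OF S that] Xi] by auto
    from coproduct_ex[OF S Xi this] show ?thesis by blast
  qed simp
  then show ?thesis using that by metis
qed

text \<open>The endomorphism is characterised by its composites with the inclusions, and the sum of
  the \<open>\<iota> i \<cdot> p i\<close> composed with \<open>\<iota> j\<close> has at most one
  nonzero term, that for \<open>i = j\<close>.\<close>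

lemma coproduct_part_finite:
  assumes S: "is_coproduct C I X S \<iota>" and F: "finite F" "F \<subseteq> I"
    and p: "\<And>i. i \<in> I \<Longrightarrow> p i \<in> Hom C S (X i)"
    "\<And>i j. i \<in> I \<Longrightarrow> j \<in> I \<Longrightarrow> p i \<cdot> \<iota> j = (if i = j then Ident C (X i) else Zero C (X j) (X i))"
  shows "coproduct_part C I X S \<iota> F = finprod (HomGrp C S S) (\<lambda>i. \<iota> i \<cdot> p i) F"
proof (rule coproduct_part_eqI[OF S])
  note cop = coproductD[OF S]
  interpret SS: comm_group "HomGrp C S S" using hom_comm_group cop(1) by auto
  have ip: "\<iota> i \<cdot> p i \<in> Hom C S S" if "i \<in> I" for i using comp_closed[OF p(1) cop(3)] that by auto
  show "finprod (HomGrp C S S) (\<lambda>i. \<iota> i \<cdot> p i) F \<in> Hom C S S"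
    using SS.finprod_closed[of "\<lambda>i. \<iota> i \<cdot> p i" F] ip F by (auto simp: Pi_iff)
  fix j assume j: "j \<in> I"
  interpret XS: comm_group "HomGrp C (X j) S" using hom_comm_group cop j by auto
  have "finprod (HomGrp C S S) (\<lambda>i. \<iota> i \<cdot> p i) F \<cdot> \<iota> j =
      finprod (HomGrp C (X j) S) (\<lambda>i. (\<iota> i \<cdot> p i) \<cdot> \<iota> j) F"
    using F ip cop j by (intro finprod_comp) auto
  also have "\<dots> = finprod (HomGrp C (X j) S) (\<lambda>i. if j = i then \<iota> j else Zero C (X j) S) F"
  proof (rule XS.finprod_cong')
    show "(\<lambda>i. if j = i then \<iota> j else Zero C (X j) S) \<in> F \<rightarrow> carrier (HomGrp C (X j) S)"
      using cop j zero_closed by (auto simp: Pi_iff)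
    fix i assume "i \<in> F"
    then have i: "i \<in> I" using F by auto
    show "(\<iota> i \<cdot> p i) \<cdot> \<iota> j = (if j = i then \<iota> j else Zero C (X j) S)"
      using comp_assoc[OF cop(3)[OF j] p(1)[OF i] cop(3)[OF i]] p(2)[OF i j] comp_ident[OF cop(3)[OF i]]
        in_HomD[OF cop(3)[OF i]] cop(2)[OF j] by auto
  qed simp
  also have "\<dots> = (if j \<in> F then \<iota> j else Zero C (X j) S)"
  proof (cases "j \<in> F")
    case True
    then show ?thesis
      using XS.finprod_singleton[of j F "\<lambda>_. \<iota> j", unfolded HomGrp_simps(3)] F(1) cop(3)[OF j] by simp
  next
    case False
    then show ?thesis by (subst XS.finprod_cong'[where g = "\<lambda>i. Zero C (X j) S" and B = F])
        (use XS.finprod_one[of F] zero_closed cop j in \<open>auto simp: Pi_iff\<close>)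
  qed
  finally show "finprod (HomGrp C S S) (\<lambda>i. \<iota> i \<cdot> p i) F \<cdot> \<iota> j = (if j \<in> F then \<iota> j else Zero C (X j) S)" .
qed

lemma finprod_support:
  assumes S: "is_coproduct C I X S \<iota>" and A: "A \<in> Obj C"
    and x: "\<And>i. i \<in> I \<Longrightarrow> x i \<in> Hom C A (X i)" and J: "finite J" "J \<subseteq> I" "{i \<in> I. x i \<noteq> Zero C A (X i)} \<subseteq> J"
  shows "finprod (HomGrp C A S) (\<lambda>i. \<iota> i \<cdot> x i) {i \<in> I. x i \<noteq> Zero C A (X i)} =
      finprod (HomGrp C A S) (\<lambda>i. \<iota> i \<cdot> x i) J"
proof -
  note cop = coproductD[OF S]
  interpret AS: comm_group "HomGrp C A S" using hom_comm_group cop A by auto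
  show ?thesis
  proof (rule AS.finprod_mono_neutral_cong_left[OF J(1,3)])
    fix i assume i: "i \<in> J - {i \<in> I. x i \<noteq> Zero C A (X i)}"
    then have "i \<in> I" "x i = Zero C A (X i)" using J by auto
    then show "\<iota> i \<cdot> x i = \<one>\<^bsub>HomGrp C A S\<^esub>" using in_HomD[OF cop(3)] A by simp
  qed (use J x comp_closed[OF x cop(3)] in auto)
qed

text \<open>The canonical map from the direct sum is always an injective homomorphism, since
  \<open>p j\<close> recovers the coordinate \<open>j\<close>. Only surjectivity is in question, and
  \<open>\<phi>\<close> is in the image iff it is fixed by the part for some finite set of
  indices.\<close>

lemma compact_object_iff:
  "compact_object (U :: 'u set) C A \<longleftrightarrow> A \<in> Obj C \<and>
     (\<forall>(I :: 'u set) X S \<iota>. small U I \<longrightarrow> is_coproduct C I X S \<iota> \<longrightarrow>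
        (\<forall>\<phi> \<in> Hom C A S. \<exists>F. finite F \<and> F \<subseteq> I \<and> coproduct_part C I X S \<iota> F \<cdot> \<phi> = \<phi>))"
proof -
  have "(\<lambda>x. finprod (HomGrp C A S) (\<lambda>i. \<iota> i \<cdot> x i) {i \<in> I. x i \<noteq> Zero C A (X i)})
          \<in> iso (sum_group I (\<lambda>i. HomGrp C A (X i))) (HomGrp C A S) \<longleftrightarrow>
      (\<forall>\<phi> \<in> Hom C A S. \<exists>F. finite F \<and> F \<subseteq> I \<and> coproduct_part C I X S \<iota> F \<cdot> \<phi> = \<phi>)"
    (is "?h \<in> iso ?G _ \<longleftrightarrow> ?R")
    if A: "A \<in> Obj C" and S: "is_coproduct C I X S \<iota>" for I :: "'u set" and X S \<iota>
  proof -
    note cop = coproductD[OF S]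
    let ?e = "coproduct_part C I X S \<iota>"
    interpret AS: comm_group "HomGrp C A S" using hom_comm_group cop A by auto
    have grp: "group (HomGrp C A (X i))" if "i \<in> I" for i
      using hom_comm_group[OF A cop(2)[OF that]] by (simp add: comm_group_def)
    have carr: "x \<in> carrier ?G \<longleftrightarrow> x \<in> (\<Pi>\<^sub>E i\<in>I. Hom C A (X i)) \<and> finite {i \<in> I. x i \<noteq> Zero C A (X i)}" for x
      using grp by (subst carrier_sum_group) auto
    have \<iota>x: "\<iota> i \<cdot> x i \<in> Hom C A S" if "x \<in> carrier ?G" "i \<in> I" for x i
      using comp_closed[OF _ cop(3)[OF that(2)], of "x i" A] that by (auto simp: carr PiE_iff)
    have h_closed: "?h x \<in> Hom C A S" if "x \<in> carrier ?G" for x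
      using AS.finprod_closed[of "\<lambda>i. \<iota> i \<cdot> x i"] \<iota>x[OF that] by (auto simp: Pi_iff)
    obtain p where p: "\<And>i. i \<in> I \<Longrightarrow> p i \<in> Hom C S (X i)"
      "\<And>i j. i \<in> I \<Longrightarrow> j \<in> I \<Longrightarrow> p i \<cdot> \<iota> j = (if i = j then Ident C (X i) else Zero C (X j) (X i))"
      using coproduct_proj[OF S] by metis
    have h_fin: "?h x = finprod (HomGrp C A S) (\<lambda>i. \<iota> i \<cdot> x i) J"
      if "x \<in> carrier ?G" "finite J" "J \<subseteq> I" "{i \<in> I. x i \<noteq> Zero C A (X i)} \<subseteq> J" for x J
      using finprod_support[OF S A _ that(2-4)] that(1) by (auto simp: carr PiE_iff)
    have p_h: "p j \<cdot> ?h x = x j" if x: "x \<in> carrier ?G" and j: "j \<in> I" for x j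
    proof -
      \<comment> \<open>\<open>j\<close> is added to the support so that the singleton sum applies
        also when \<open>x j\<close> is zero.\<close>
      let ?J = "insert j {i \<in> I. x i \<noteq> Zero C A (X i)}"
      interpret AX: comm_group "HomGrp C A (X j)" using hom_comm_group cop(2)[OF j] A by auto
      have J: "finite ?J" "?J \<subseteq> I" using x j by (auto simp: carr)
      have xj: "x j \<in> Hom C A (X j)" using x j by (auto simp: carr PiE_iff)
      have "p j \<cdot> ?h x = p j \<cdot> finprod (HomGrp C A S) (\<lambda>i. \<iota> i \<cdot> x i) ?J"
        using h_fin[OF x J] by (simp add: subset_insertI)
      also have "\<dots> = finprod (HomGrp C A (X j)) (\<lambda>i. p j \<cdot> (\<iota> i \<cdot> x i)) ?J"
        using J \<iota>x[OF x] p(1)[OF j] A by (intro comp_finprod) auto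
      also have "\<dots> = finprod (HomGrp C A (X j)) (\<lambda>i. if j = i then x j else Zero C A (X j)) ?J"
      proof (rule AX.finprod_cong')
        show "(\<lambda>i. if j = i then x j else Zero C A (X j)) \<in> ?J \<rightarrow> carrier (HomGrp C A (X j))"
          using xj zero_closed A cop(2)[OF j] by auto
        fix i assume "i \<in> ?J"
        then have i: "i \<in> I" using j by auto
        have xi: "x i \<in> Hom C A (X i)" using x i by (auto simp: carr PiE_iff)
        show "p j \<cdot> (\<iota> i \<cdot> x i) = (if j = i then x j else Zero C A (X j))"
          using comp_assoc[OF xi cop(3)[OF i] p(1)[OF j]] p(2)[OF j i] ident_comp[OF xj] in_HomD[OF xi] cop(2)[OF j]
          by auto
      qed simp
      also have "\<dots> = x j"
        using AX.finprod_singleton[of j ?J "\<lambda>_. x j", unfolded HomGrp_simps(3)] J xj by simp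
      finally show ?thesis .
    qed
    have h_hom: "?h \<in> hom ?G (HomGrp C A S)"
    proof (rule homI)
      show "?h x \<in> carrier (HomGrp C A S)" if "x \<in> carrier ?G" for x using h_closed[OF that] by simp
      fix x y assume x: "x \<in> carrier ?G" and y: "y \<in> carrier ?G"
      have xy: "x \<otimes>\<^bsub>?G\<^esub> y \<in> carrier ?G"
        by (rule monoid.m_closed[OF group.is_monoid x y]) (rule sum_group[OF grp])
      have xyi: "(x \<otimes>\<^bsub>?G\<^esub> y) i = x i \<boxplus> y i" if "i \<in> I" for i using that by simp
      \<comment> \<open>The three sums run over different supports, as terms may cancel; all are
        rewritten over the union of the supports of \<open>x\<close> and \<open>y\<close>.\<close>
      let ?J = "{i \<in> I. x i \<noteq> Zero C A (X i)} \<union> {i \<in> I. y i \<noteq> Zero C A (X i)}"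
      have J: "finite ?J" "?J \<subseteq> I" using x y by (auto simp: carr)
      have sub: "{i \<in> I. (x \<otimes>\<^bsub>?G\<^esub> y) i \<noteq> Zero C A (X i)} \<subseteq> ?J"
        using xyi zero_closed[OF A cop(2)] add_zero by auto
      have "?h (x \<otimes>\<^bsub>?G\<^esub> y) = finprod (HomGrp C A S) (\<lambda>i. \<iota> i \<cdot> (x \<otimes>\<^bsub>?G\<^esub> y) i) ?J"
        by (rule h_fin[OF xy J sub])
      also have "\<dots> = finprod (HomGrp C A S) (\<lambda>i. (\<iota> i \<cdot> x i) \<otimes>\<^bsub>HomGrp C A S\<^esub> (\<iota> i \<cdot> y i)) ?J"
      proof (rule AS.finprod_cong')
        show "(\<lambda>i. (\<iota> i \<cdot> x i) \<otimes>\<^bsub>HomGrp C A S\<^esub> (\<iota> i \<cdot> y i)) \<in> ?J \<rightarrow> carrier (HomGrp C A S)"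
          using \<iota>x[OF x] \<iota>x[OF y] add_closed by auto
        fix i assume "i \<in> ?J"
        then have i: "i \<in> I" using J by auto
        have "x i \<in> Hom C A (X i)" "y i \<in> Hom C A (X i)" using x y i by (auto simp: carr PiE_iff)
        then show "\<iota> i \<cdot> (x \<otimes>\<^bsub>?G\<^esub> y) i = (\<iota> i \<cdot> x i) \<otimes>\<^bsub>HomGrp C A S\<^esub> (\<iota> i \<cdot> y i)"
          using add_comp[OF _ _ cop(3)[OF i]] i by simp
      qed simp
      also have "\<dots> = finprod (HomGrp C A S) (\<lambda>i. \<iota> i \<cdot> x i) ?J \<otimes>\<^bsub>HomGrp C A S\<^esub>
          finprod (HomGrp C A S) (\<lambda>i. \<iota> i \<cdot> y i) ?J"
      proof (rule AS.finprod_multf)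
        show "(\<lambda>i. \<iota> i \<cdot> x i) \<in> ?J \<rightarrow> carrier (HomGrp C A S)" using \<iota>x[OF x] by auto
        show "(\<lambda>i. \<iota> i \<cdot> y i) \<in> ?J \<rightarrow> carrier (HomGrp C A S)" using \<iota>x[OF y] by auto
      qed
      also have "\<dots> = ?h x \<otimes>\<^bsub>HomGrp C A S\<^esub> ?h y"
        using h_fin[OF x J] h_fin[OF y J] by simp
      finally show "?h (x \<otimes>\<^bsub>?G\<^esub> y) = ?h x \<otimes>\<^bsub>HomGrp C A S\<^esub> ?h y" .
    qed
    have h_inj: "inj_on ?h (carrier ?G)"
    proof (rule inj_onI)
      fix x y assume x: "x \<in> carrier ?G" and y: "y \<in> carrier ?G" and "?h x = ?h y"
      then have "x j = y j" if "j \<in> I" for j using p_h[OF x that] p_h[OF y that] by simp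
      then show "x = y" using x y by (intro PiE_ext[of x I "\<lambda>i. Hom C A (X i)" y]) (auto simp: carr)
    qed
    have "?h \<in> iso ?G (HomGrp C A S) \<longleftrightarrow> Hom C A S \<subseteq> ?h ` carrier ?G"
      using h_hom h_inj h_closed by (auto simp: iso_def bij_betw_def)
    also have "\<dots> \<longleftrightarrow> ?R"
    proof (intro iffI ballI subsetI)
      fix \<phi> assume "Hom C A S \<subseteq> ?h ` carrier ?G" and "\<phi> \<in> Hom C A S"
      then obtain x where x: "x \<in> carrier ?G" and \<phi>: "\<phi> = ?h x" by blast
      let ?F = "{i \<in> I. x i \<noteq> Zero C A (X i)}"
      have "?e ?F \<cdot> ?h x = finprod (HomGrp C A S) (\<lambda>i. ?e ?F \<cdot> (\<iota> i \<cdot> x i)) ?F"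
        using x \<iota>x[OF x] coproduct_part(1)[OF S] A by (intro comp_finprod) (auto simp: carr)
      also have "\<dots> = ?h x"
      proof (rule AS.finprod_cong')
        show "(\<lambda>i. \<iota> i \<cdot> x i) \<in> ?F \<rightarrow> carrier (HomGrp C A S)" using \<iota>x[OF x] by auto
        fix i assume i: "i \<in> ?F"
        then have xi: "x i \<in> Hom C A (X i)" using x by (auto simp: carr PiE_iff)
        have iI: "i \<in> I" using i by simp
        show "?e ?F \<cdot> (\<iota> i \<cdot> x i) = \<iota> i \<cdot> x i"
          using comp_assoc[OF xi cop(3)[OF iI] coproduct_part(1)[OF S, of ?F]] coproduct_part(2)[OF S iI, of ?F] i
          by simp
      qed simp
      finally show "\<exists>F. finite F \<and> F \<subseteq> I \<and> ?e F \<cdot> \<phi> = \<phi>"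
        using x \<phi> by (intro exI[of _ ?F]) (auto simp: carr)
    next
      fix \<phi> assume ?R and \<phi>: "\<phi> \<in> Hom C A S"
      then obtain F where F: "finite F" "F \<subseteq> I" "?e F \<cdot> \<phi> = \<phi>" by blast
      \<comment> \<open>The coordinates of \<open>\<phi>\<close> are its projections, cut off
        outside \<open>F\<close> to land in the direct sum. The sum of the
        \<open>\<iota> i \<cdot> p i\<close> over \<open>F\<close> is the part that fixes
        \<open>\<phi>\<close>.\<close>
      define x where "x = (\<lambda>i\<in>I. if i \<in> F then p i \<cdot> \<phi> else Zero C A (X i))"
      have x: "x \<in> carrier ?G"
      proof -
        have "finite {i \<in> I. x i \<noteq> Zero C A (X i)}"
          by (rule finite_subset[OF _ F(1)]) (auto simp: x_def)
        then show ?thesis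
          using comp_closed[OF \<phi> p(1)] zero_closed[OF A cop(2)] by (auto simp: carr x_def)
      qed
      have "?h x = finprod (HomGrp C A S) (\<lambda>i. \<iota> i \<cdot> x i) F"
        by (rule h_fin[OF x F(1,2)]) (auto simp: x_def)
      also have "\<dots> = finprod (HomGrp C A S) (\<lambda>i. (\<iota> i \<cdot> p i) \<cdot> \<phi>) F"
      proof (rule AS.finprod_cong')
        show "(\<lambda>i. (\<iota> i \<cdot> p i) \<cdot> \<phi>) \<in> F \<rightarrow> carrier (HomGrp C A S)"
          using comp_closed[OF \<phi> comp_closed[OF p(1) cop(3)]] F(2) by auto
        fix i assume "i \<in> F"
        moreover have "i \<in> I" using \<open>i \<in> F\<close> F(2) by auto
        ultimately show "\<iota> i \<cdot> x i = (\<iota> i \<cdot> p i) \<cdot> \<phi>"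
          using comp_assoc[OF \<phi> p(1) cop(3)] by (simp add: x_def)
      qed simp
      also have "\<dots> = finprod (HomGrp C S S) (\<lambda>i. \<iota> i \<cdot> p i) F \<cdot> \<phi>"
        by (rule finprod_comp [symmetric, OF F(1) comp_closed[OF p(1) cop(3)] \<phi> cop(1)]) (use F(2) in auto)
      also have "finprod (HomGrp C S S) (\<lambda>i. \<iota> i \<cdot> p i) F = ?e F"
        by (rule coproduct_part_finite[OF S F(1,2) p, symmetric])
      also note F(3)
      finally show "\<phi> \<in> ?h ` carrier ?G" using x by (intro image_eqI[of \<phi> ?h x]) (simp_all only:)
    qed
    finally show ?thesis .
  qed
  then show ?thesis unfolding compact_object_def by (simp cong: conj_cong)
qed

section \<open>Permanence properties of compact objects\<close>

lemma compact_objectD: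
  assumes "compact_object (U :: 'u set) C A" "small U (I :: 'u set)" "is_coproduct C I X S \<iota>" "\<phi> \<in> Hom C A S"
  obtains F where "finite F" "F \<subseteq> I" "coproduct_part C I X S \<iota> F \<cdot> \<phi> = \<phi>"
  using assms unfolding compact_object_iff by blast

text \<open>A finite set of indices that works for \<open>\<phi> \<cdot> r\<close> also works for
  \<open>\<phi> = \<phi> \<cdot> r \<cdot> s\<close>.\<close>

lemma compact_object_retract:
  assumes A: "compact_object (U :: 'u set) C A" and s: "s \<in> Hom C B A" and r: "r \<in> Hom C A B" and rs: "r \<cdot> s = Ident C B"
  shows "compact_object U C B"
  unfolding compact_object_iff
proof (intro conjI allI impI ballI)
  show "B \<in> Obj C" using hom_obj[OF s] by blast
  fix I :: "'u set" and X S \<iota> \<phi>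
  assume I: "small U I" and S: "is_coproduct C I X S \<iota>" and \<phi>: "\<phi> \<in> Hom C B S"
  obtain F where F: "finite F" "F \<subseteq> I" "coproduct_part C I X S \<iota> F \<cdot> (\<phi> \<cdot> r) = \<phi> \<cdot> r"
    using compact_objectD[OF A I S comp_closed[OF r \<phi>]] .
  let ?e = "coproduct_part C I X S \<iota> F"
  have e: "?e \<in> Hom C S S" by (rule coproduct_part(1)[OF S])
  have "?e \<cdot> \<phi> = ?e \<cdot> (\<phi> \<cdot> (r \<cdot> s))" unfolding rs using comp_ident[OF \<phi>] by simp
  also have "\<dots> = (?e \<cdot> (\<phi> \<cdot> r)) \<cdot> s"
    using in_HomD[OF e] in_HomD[OF \<phi>] in_HomD[OF r] in_HomD[OF s] by simp
  also have "\<dots> = \<phi> \<cdot> (r \<cdot> s)" unfolding F(3) using comp_assoc[OF s r \<phi>] .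
  also have "\<dots> = \<phi>" unfolding rs using comp_ident[OF \<phi>] .
  finally show "\<exists>F. finite F \<and> F \<subseteq> I \<and> coproduct_part C I X S \<iota> F \<cdot> \<phi> = \<phi>" using F(1,2) by blast
qed

text \<open>If \<open>R\<close> preserves coproducts then a left adjoint of \<open>R\<close> preserves compact objects. Only the
  value \<open>L\<close> of the left adjoint at \<open>A\<close> matters, and only injectivity of \<open>(L, -) \<rightarrow> (A, R -)\<close>.\<close>

lemma compact_object_left_adjoint:
  assumes A: "compact_object (U :: 'u set) C A" and L: "L \<in> Obj C" and R: "is_functor C C R"
    and zero: "\<And>X Y. X \<in> Obj C \<Longrightarrow> Y \<in> Obj C \<Longrightarrow> OnArr R (Zero C X Y) = Zero C (OnObj R X) (OnObj R Y)"
    and cop: "\<And>(I :: 'u set) X S \<iota>. is_coproduct C I X S \<iota> \<Longrightarrow>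
        is_coproduct C I (\<lambda>i. OnObj R (X i)) (OnObj R S) (\<lambda>i. OnArr R (\<iota> i))"
    and \<Phi>: "\<And>S \<phi>. S \<in> Obj C \<Longrightarrow> \<phi> \<in> Hom C L S \<Longrightarrow> \<Phi> S \<phi> \<in> Hom C A (OnObj R S)"
    and inj: "\<And>S. S \<in> Obj C \<Longrightarrow> inj_on (\<Phi> S) (Hom C L S)"
    and nat: "\<And>S e \<phi>. e \<in> Hom C S S \<Longrightarrow> \<phi> \<in> Hom C L S \<Longrightarrow> \<Phi> S (e \<cdot> \<phi>) = OnArr R e \<cdot> \<Phi> S \<phi>"
  shows "compact_object U C L"
  unfolding compact_object_iff
proof (intro conjI allI impI ballI)
  fix I :: "'u set" and X S \<iota> \<phi>
  assume I: "small U I" and S: "is_coproduct C I X S \<iota>" and \<phi>: "\<phi> \<in> Hom C L S"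
  let ?R = "is_coproduct C I (\<lambda>i. OnObj R (X i)) (OnObj R S) (\<lambda>i. OnArr R (\<iota> i))"
  have So: "S \<in> Obj C" using coproductD[OF S] by blast
  obtain F where F: "finite F" "F \<subseteq> I"
    "coproduct_part C I (\<lambda>i. OnObj R (X i)) (OnObj R S) (\<lambda>i. OnArr R (\<iota> i)) F \<cdot> \<Phi> S \<phi> = \<Phi> S \<phi>"
    using compact_objectD[OF A I cop[OF S] \<Phi>[OF So \<phi>]] .
  let ?e = "coproduct_part C I X S \<iota> F"
  have e: "?e \<in> Hom C S S" by (rule coproduct_part(1)[OF S])
  \<comment> \<open>As \<open>R\<close> preserves coproducts and zero arrows, the part of the
    coproduct \<open>R S\<close> for \<open>F\<close> is the image of the part of \<open>S\<close>;
    injectivity of \<open>\<Phi> S\<close> then brings the equation back.\<close>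
  have "coproduct_part C I (\<lambda>i. OnObj R (X i)) (OnObj R S) (\<lambda>i. OnArr R (\<iota> i)) F = OnArr R ?e"
  proof (rule coproduct_part_eqI[OF cop[OF S] functor_hom[OF R So So e]])
    fix i assume i: "i \<in> I"
    show "OnArr R ?e \<cdot> OnArr R (\<iota> i) = (if i \<in> F then OnArr R (\<iota> i) else Zero C (OnObj R (X i)) (OnObj R S))"
      using functor_comp[OF R coproductD(3)[OF S i] e] coproduct_part(2)[OF S i, of F]
        zero[OF coproductD(2)[OF S i] So] by auto
  qed
  then have "\<Phi> S (?e \<cdot> \<phi>) = \<Phi> S \<phi>" using F(3) nat[OF e \<phi>] by simp
  then have "?e \<cdot> \<phi> = \<phi>" using inj[OF So] comp_closed[OF \<phi> e] \<phi> by (auto simp: inj_on_def)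
  then show "\<exists>F. finite F \<and> F \<subseteq> I \<and> coproduct_part C I X S \<iota> F \<cdot> \<phi> = \<phi>" using F(1,2) by blast
qed (rule L)

text \<open>The bijection, natural in \<open>X\<close>, translates the equations for an arrow from
  \<open>R S\<close> to \<open>Y\<close> into equations for an arrow from the coproduct
  \<open>S\<close> to \<open>Q Y\<close>, where they have exactly one solution.\<close>

lemma left_adjoint_coproduct:
  assumes R: "is_functor C C R" and Q: "\<And>Y. Y \<in> Obj C \<Longrightarrow> Q Y \<in> Obj C"
    and bij: "\<And>X Y. X \<in> Obj C \<Longrightarrow> Y \<in> Obj C \<Longrightarrow> bij_betw (\<Psi> X Y) (Hom C (OnObj R X) Y) (Hom C X (Q Y))"
    and nat: "\<And>X X' Y u t. u \<in> Hom C X' X \<Longrightarrow> t \<in> Hom C (OnObj R X) Y \<Longrightarrow>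
                 \<Psi> X' Y (t \<cdot> OnArr R u) = \<Psi> X Y t \<cdot> u"
    and S: "is_coproduct C I X S \<iota>"
  shows "is_coproduct C I (\<lambda>i. OnObj R (X i)) (OnObj R S) (\<lambda>i. OnArr R (\<iota> i))"
proof -
  note cop = coproductD[OF S]
  have Robj: "OnObj R A \<in> Obj C" if "A \<in> Obj C" for A using R that by (auto simp: is_functor_def)
  have R\<iota>: "OnArr R (\<iota> i) \<in> Hom C (OnObj R (X i)) (OnObj R S)" if "i \<in> I" for i
    using functor_hom[OF R cop(2)[OF that] cop(1) cop(3)[OF that]] .
  have "\<exists>!h. h \<in> Hom C (OnObj R S) Y \<and> (\<forall>i \<in> I. h \<cdot> OnArr R (\<iota> i) = f i)"
    if Y: "Y \<in> Obj C" and f: "\<forall>i \<in> I. f i \<in> Hom C (OnObj R (X i)) Y" for Y f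
  proof -
    have b: "bij_betw (\<Psi> S Y) (Hom C (OnObj R S) Y) (Hom C S (Q Y))" by (rule bij[OF cop(1) Y])
    have bi: "bij_betw (\<Psi> (X i) Y) (Hom C (OnObj R (X i)) Y) (Hom C (X i) (Q Y))" if "i \<in> I" for i
      by (rule bij[OF cop(2)[OF that] Y])
    have "\<exists>k \<in> Hom C S (Q Y). \<forall>i \<in> I. k \<cdot> \<iota> i = \<Psi> (X i) Y (f i)"
      using bij_betwE[OF bi] f by (intro coproduct_ex[OF S Q[OF Y]]) auto
    then obtain k where k: "k \<in> Hom C S (Q Y)" "\<And>i. i \<in> I \<Longrightarrow> k \<cdot> \<iota> i = \<Psi> (X i) Y (f i)" by blast
    then obtain h where h: "h \<in> Hom C (OnObj R S) Y" "\<Psi> S Y h = k"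
      using b unfolding bij_betw_def by (metis imageE)
    have iff: "h' \<cdot> OnArr R (\<iota> i) = f i \<longleftrightarrow> \<Psi> S Y h' \<cdot> \<iota> i = k \<cdot> \<iota> i"
      if "h' \<in> Hom C (OnObj R S) Y" "i \<in> I" for h' i
      using inj_on_eq_iff[OF bij_betw_imp_inj_on[OF bi[OF that(2)]] comp_closed[OF R\<iota>[OF that(2)] that(1)], of "f i"]
        f that nat[OF cop(3)[OF that(2)] that(1)] k(2)[OF that(2)] by auto
    show ?thesis
    proof (intro ex1I conjI ballI)
      show "h \<in> Hom C (OnObj R S) Y" by (rule h(1))
      show "h \<cdot> OnArr R (\<iota> i) = f i" if "i \<in> I" for i using iff[OF h(1) that] h(2) by simp
      fix h' assume h': "h' \<in> Hom C (OnObj R S) Y \<and> (\<forall>i \<in> I. h' \<cdot> OnArr R (\<iota> i) = f i)"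
      then have "\<Psi> S Y h' \<in> Hom C S (Q Y)" using bij_betwE[OF b] by blast
      then have "\<Psi> S Y h' = \<Psi> S Y h"
        unfolding h(2) by (rule coproduct_eqI[OF S _ k(1)]) (use h' iff in auto)
      then show "h' = h" using bij_betw_imp_inj_on[OF b] h' h(1) by (auto simp: inj_on_def)
    qed
  qed
  then show ?thesis unfolding is_coproduct_def using Robj cop R\<iota> by auto
qed

text \<open>For a zero object \<open>Z\<close> the bijection leaves only one arrow from
  \<open>R Z\<close> to any object, so \<open>R\<close> kills every arrow that factors through
  \<open>Z\<close>. Preservation of zero arrows thus comes from adjointness alone.\<close>

lemma left_adjoint_zero:
  assumes R: "is_functor C C R" and Q: "\<And>Y. Y \<in> Obj C \<Longrightarrow> Q Y \<in> Obj C"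
    and bij: "\<And>X Y. X \<in> Obj C \<Longrightarrow> Y \<in> Obj C \<Longrightarrow> bij_betw (\<Psi> X Y) (Hom C (OnObj R X) Y) (Hom C X (Q Y))"
    and Z: "zero_object C Z" and X: "X \<in> Obj C" and Y: "Y \<in> Obj C"
  shows "OnArr R (Zero C X Y) = Zero C (OnObj R X) (OnObj R Y)"
proof -
  have Robj: "OnObj R A \<in> Obj C" if "A \<in> Obj C" for A using R that by (auto simp: is_functor_def)
  have Zo: "Z \<in> Obj C" using Z by (simp add: zero_object_def)
  let ?a = "OnArr R (Zero C Z Y)" and ?b = "Zero C (OnObj R Z) (OnObj R Y)"
  have a: "?a \<in> Hom C (OnObj R Z) (OnObj R Y)" "?b \<in> Hom C (OnObj R Z) (OnObj R Y)"
    using functor_hom[OF R Zo Y zero_closed[OF Zo Y]] zero_closed Robj Zo Y by auto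
  have b: "bij_betw (\<Psi> Z (OnObj R Y)) (Hom C (OnObj R Z) (OnObj R Y)) (Hom C Z (Q (OnObj R Y)))"
    by (rule bij[OF Zo Robj[OF Y]])
  have "\<Psi> Z (OnObj R Y) ?a = \<Psi> Z (OnObj R Y) ?b"
    using zero_object_hom(2)[OF Z] bij_betwE[OF b] a by metis
  then have ab: "?a = ?b" using bij_betw_imp_inj_on[OF b] a by (auto simp: inj_on_def)
  have "OnArr R (Zero C X Y) = OnArr R (Zero C Z Y \<cdot> Zero C X Z)" using X Y Zo by simp
  also have "\<dots> = ?b \<cdot> OnArr R (Zero C X Z)"
    using functor_comp[OF R zero_closed[OF X Zo] zero_closed[OF Zo Y]] ab by simp
  also have "\<dots> = Zero C (OnObj R X) (OnObj R Y)"
    using in_HomD[OF functor_hom[OF R X Zo zero_closed[OF X Zo]]] Robj Y by simp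
  finally show ?thesis .
qed

end

context triangulated_category
begin

text \<open>A diagram chase as in the five lemma, on a single arrow \<open>\<phi>\<close>. A finite
  part fixes \<open>\<phi> \<cdot> g\<close>, so the defect of \<open>\<phi>\<close> vanishes on
  \<open>g\<close> and factors through \<open>h\<close> and the compact suspension; the union of
  both index sets then fixes \<open>\<phi>\<close>.\<close>

lemma compact_object_cone:
  assumes t: "(f, g, h) \<in> Tri T" and B: "compact_object (U :: 'u set) T (Cod T f)"
    and A: "compact_object U T (\<Sigma>\<^sub>o (Dom T f))"
  shows "compact_object U T (Cod T g)"
  unfolding compact_object_iff
proof (intro conjI allI impI ballI)
  note t' = triD[OF t]
  show "Cod T g \<in> Obj T" using t' by simp
  fix I :: "'u set" and X S \<iota> \<phi>
  assume I: "small U I" and S: "is_coproduct T I X S \<iota>" and \<phi>: "\<phi> \<in> Hom T (Cod T g) S"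
  let ?e = "coproduct_part T I X S \<iota>"
  note e = coproduct_part(1)[OF S]
  obtain F where F: "finite F" "F \<subseteq> I" "?e F \<cdot> (\<phi> \<cdot> g) = \<phi> \<cdot> g"
    using compact_objectD[OF B I S comp_closed[OF t'(8) \<phi>]] .
  have e\<phi>: "?e F \<cdot> \<phi> \<in> Hom T (Cod T g) S" by (rule comp_closed[OF \<phi> e[of F]])
  let ?\<delta> = "\<phi> \<boxplus> Neg T (?e F \<cdot> \<phi>)"
  have \<delta>: "?\<delta> \<in> Hom T (Cod T g) S" by (rule add_closed[OF \<phi> neg_closed[OF e\<phi>]])
  have "?\<delta> \<cdot> g = \<phi> \<cdot> g \<boxplus> Neg T ((?e F \<cdot> \<phi>) \<cdot> g)"
    using comp_add[OF t'(8) \<phi> neg_closed[OF e\<phi>]] neg_comp[OF t'(8) e\<phi>] by simp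
  also have "(?e F \<cdot> \<phi>) \<cdot> g = \<phi> \<cdot> g" using comp_assoc[OF t'(8) \<phi> e[of F]] F(3) by simp
  also have "\<phi> \<cdot> g \<boxplus> Neg T (\<phi> \<cdot> g) = Zero T (Dom T g) S"
    using add_neg[OF comp_closed[OF t'(8) \<phi>]] t'(4) by simp
  finally obtain \<psi> where \<psi>: "\<psi> \<in> Hom T (\<Sigma>\<^sub>o (Dom T f)) S" "?\<delta> = \<psi> \<cdot> h"
    using tri_weak_cokernel[OF tri_rotate_left[OF t]] \<delta> t'(6) by (auto simp: weak_cokernel_def)
  obtain G where G: "finite G" "G \<subseteq> I" "?e G \<cdot> \<psi> = \<psi>" using compact_objectD[OF A I S \<psi>(1)] .
  let ?H = "F \<union> G"
  have "?e ?H \<cdot> \<psi> = (?e ?H \<cdot> ?e G) \<cdot> \<psi>" using comp_assoc[OF \<psi>(1) e[of G] e[of ?H]] G(3) by simp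
  also have "\<dots> = \<psi>" using coproduct_part_absorb[OF S, of G ?H] G(3) by simp
  finally have H\<psi>: "?e ?H \<cdot> \<psi> = \<psi>" .
  have "?e ?H \<cdot> ?\<delta> = ?\<delta>"
    unfolding \<psi>(2) using comp_assoc[OF t'(9) \<psi>(1) e[of ?H]] H\<psi> by simp
  \<comment> \<open>The part for \<open>?H\<close> absorbs the part for \<open>F\<close>, so the
    correction term is unchanged and cancels from the two expressions for
    \<open>?e ?H \<cdot> ?\<delta>\<close>.\<close>
  moreover have "?e ?H \<cdot> ?\<delta> = ?e ?H \<cdot> \<phi> \<boxplus> Neg T (?e F \<cdot> \<phi>)"
    using add_comp[OF \<phi> neg_closed[OF e\<phi>] e[of ?H]] comp_neg[OF e\<phi> e[of ?H]] comp_assoc[OF \<phi> e[of F] e[of ?H]]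
      coproduct_part_absorb[OF S, of F ?H] by simp
  ultimately have eq: "?e ?H \<cdot> \<phi> \<boxplus> Neg T (?e F \<cdot> \<phi>) = \<phi> \<boxplus> Neg T (?e F \<cdot> \<phi>)" by simp
  have cancel: "\<alpha> = (\<alpha> \<boxplus> Neg T (?e F \<cdot> \<phi>)) \<boxplus> ?e F \<cdot> \<phi>" if "\<alpha> \<in> Hom T (Cod T g) S" for \<alpha>
    using add_assoc[OF that neg_closed[OF e\<phi>] e\<phi>] add_commute[OF neg_closed[OF e\<phi>] e\<phi>] add_neg[OF e\<phi>]
      add_zero[OF that] by simp
  have "?e ?H \<cdot> \<phi> = \<phi>" using cancel[OF comp_closed[OF \<phi> e[of ?H]]] cancel[OF \<phi>] eq by metis
  then show "\<exists>F. finite F \<and> F \<subseteq> I \<and> coproduct_part T I X S \<iota> F \<cdot> \<phi> = \<phi>"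
    using F(1,2) G(1,2) by (intro exI[of _ ?H]) auto
qed

text \<open>Suspension is left adjoint to its quasi-inverse \<open>G\<close>, so it preserves
  compact objects once \<open>G\<close> preserves coproducts; and \<open>G\<close> does, having the
  suspension as its right adjoint too.\<close>

lemma compact_object_sus:
  assumes A: "compact_object (U :: 'u set) T A"
  shows "compact_object U T (\<Sigma>\<^sub>o A)"
proof -
  obtain G \<eta> \<epsilon> where G: "is_functor T T G"
    and \<eta>: "natural_iso T T id_ftr (comp_ftr G (Sus T)) \<eta>"
    and \<epsilon>: "natural_iso T T (comp_ftr (Sus T) G) id_ftr \<epsilon>"
    using sus_equivalence by (auto simp: equivalence_def)
  have Ao: "A \<in> Obj T" using A by (simp add: compact_object_def)
  have Gobj [simp]: "OnObj G X \<in> Obj T" if "X \<in> Obj T" for X using G that by (auto simp: is_functor_def)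
  note G_simps [simp] = functor_arr_simps[OF category_axioms G]
  have \<eta>h: "\<eta> X \<in> Hom T X (OnObj G (\<Sigma>\<^sub>o X))" "iso_arr T (\<eta> X)" if "X \<in> Obj T" for X
    using \<eta> that by (auto simp: natural_iso_def id_ftr_def comp_ftr_def)
  have \<epsilon>h: "\<epsilon> X \<in> Hom T (\<Sigma>\<^sub>o (OnObj G X)) X" "iso_arr T (\<epsilon> X)" if "X \<in> Obj T" for X
    using \<epsilon> that by (auto simp: natural_iso_def id_ftr_def comp_ftr_def)
  have \<epsilon>_nat: "\<epsilon> Y \<cdot> \<Sigma>\<^sub>a (OnArr G f) = f \<cdot> \<epsilon> X" if "f \<in> Hom T X Y" for f X Y
    using \<epsilon> that by (auto simp: natural_iso_def id_ftr_def comp_ftr_def Hom_def)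
  define \<epsilon>' where "\<epsilon>' X = inv_arr T (\<epsilon> X)" for X
  have \<epsilon>': "\<epsilon>' X \<in> Hom T X (\<Sigma>\<^sub>o (OnObj G X))" "\<epsilon>' X \<cdot> \<epsilon> X = Ident T (\<Sigma>\<^sub>o (OnObj G X))"
    "\<epsilon> X \<cdot> \<epsilon>' X = Ident T X" if "X \<in> Obj T" for X
    using inv_arr[OF \<epsilon>h(2)[OF that]] in_HomD[OF \<epsilon>h(1)[OF that]] by (auto simp: inverse_arrs_def \<epsilon>'_def)
  define \<Psi> where "\<Psi> X Y t = \<Sigma>\<^sub>a t \<cdot> \<epsilon>' X" for X and Y :: 'o and t
  have bij: "bij_betw (\<Psi> X Y) (Hom T (OnObj G X) Y) (Hom T X (\<Sigma>\<^sub>o Y))" if X: "X \<in> Obj T" and Y: "Y \<in> Obj T" for X Y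
  proof (rule bij_betwI')
    fix s t assume s: "s \<in> Hom T (OnObj G X) Y" and t: "t \<in> Hom T (OnObj G X) Y"
    have S: "\<Sigma>\<^sub>a s \<in> Hom T (\<Sigma>\<^sub>o (OnObj G X)) (\<Sigma>\<^sub>o Y)" "\<Sigma>\<^sub>a t \<in> Hom T (\<Sigma>\<^sub>o (OnObj G X)) (\<Sigma>\<^sub>o Y)"
      using in_HomD[OF s] in_HomD[OF t] by (auto intro: in_HomI)
    have "iso_arr T (\<epsilon>' X)" using inverse_arrs_sym[OF inv_arr[OF \<epsilon>h(2)[OF X]]] by (auto simp: iso_arr_def \<epsilon>'_def)
    then show "\<Psi> X Y s = \<Psi> X Y t \<longleftrightarrow> s = t"
      using iso_cancel_right[OF _ \<epsilon>'(1)[OF X] S] sus_inj[OF _ s t] unfolding \<Psi>_def by blast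
  next
    fix t assume t: "t \<in> Hom T (OnObj G X) Y"
    then show "\<Psi> X Y t \<in> Hom T X (\<Sigma>\<^sub>o Y)"
      unfolding \<Psi>_def using in_HomD[OF t] in_HomD[OF \<epsilon>'(1)[OF X]] by (intro in_HomI) auto
  next
    fix k assume k: "k \<in> Hom T X (\<Sigma>\<^sub>o Y)"
    obtain t where t: "t \<in> Hom T (OnObj G X) Y" "\<Sigma>\<^sub>a t = k \<cdot> \<epsilon> X"
      using sus_surj[OF comp_closed[OF \<epsilon>h(1)[OF X] k] Gobj[OF X] Y] by blast
    have "\<Psi> X Y t = k"
      unfolding \<Psi>_def t(2) using comp_assoc[OF \<epsilon>'(1) \<epsilon>h(1) k] \<epsilon>'(3) X comp_ident[OF k] by simp
    then show "\<exists>t \<in> Hom T (OnObj G X) Y. k = \<Psi> X Y t" using t(1) by blast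
  qed
  have nat: "\<Psi> X' Y (t \<cdot> OnArr G u) = \<Psi> X Y t \<cdot> u" if u: "u \<in> Hom T X' X" and t: "t \<in> Hom T (OnObj G X) Y"
    for X X' Y u t
  proof -
    have X: "X \<in> Obj T" "X' \<in> Obj T" using hom_obj[OF u] by auto
    note H = in_HomD[OF u] in_HomD[OF t] in_HomD[OF \<epsilon>'(1)[OF X(1)]] in_HomD[OF \<epsilon>'(1)[OF X(2)]]
      in_HomD[OF \<epsilon>h(1)[OF X(1)]] in_HomD[OF \<epsilon>h(1)[OF X(2)]]
    have "\<Sigma>\<^sub>a (OnArr G u) \<cdot> \<epsilon>' X' = (\<epsilon>' X \<cdot> \<epsilon> X) \<cdot> (\<Sigma>\<^sub>a (OnArr G u) \<cdot> \<epsilon>' X')"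
      unfolding \<epsilon>'(2)[OF X(1)] using H by simp
    also have "\<dots> = \<epsilon>' X \<cdot> ((\<epsilon> X \<cdot> \<Sigma>\<^sub>a (OnArr G u)) \<cdot> \<epsilon>' X')" using H by simp
    also have "\<dots> = \<epsilon>' X \<cdot> (u \<cdot> (\<epsilon> X' \<cdot> \<epsilon>' X'))" unfolding \<epsilon>_nat[OF u] using H by simp
    also have "\<dots> = \<epsilon>' X \<cdot> u" unfolding \<epsilon>'(3)[OF X(2)] using H by simp
    finally have "\<Sigma>\<^sub>a (OnArr G u) \<cdot> \<epsilon>' X' = \<epsilon>' X \<cdot> u" .
    then show ?thesis unfolding \<Psi>_def using H by simp
  qed
  have So: "\<Sigma>\<^sub>o Y \<in> Obj T" if "Y \<in> Obj T" for Y using that by simp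
  obtain Z where Z: "zero_object T Z" using has_zero_object by blast
  show ?thesis
  proof (rule compact_object_left_adjoint[OF A So[OF Ao] G, where \<Phi> = "\<lambda>S \<phi>. OnArr G \<phi> \<cdot> \<eta> A"])
    show "OnArr G (Zero T X Y) = Zero T (OnObj G X) (OnObj G Y)" if "X \<in> Obj T" "Y \<in> Obj T" for X Y
      by (rule left_adjoint_zero[where \<Psi> = \<Psi>, OF G So bij Z that])
    show "is_coproduct T I (\<lambda>i. OnObj G (X i)) (OnObj G S) (\<lambda>i. OnArr G (\<iota> i))"
      if "is_coproduct T I X S \<iota>" for I :: "'u set" and X S \<iota>
      by (rule left_adjoint_coproduct[where \<Psi> = \<Psi>, OF G So bij nat that])
    show "OnArr G \<phi> \<cdot> \<eta> A \<in> Hom T A (OnObj G S)" if "\<phi> \<in> Hom T (\<Sigma>\<^sub>o A) S" for S \<phi>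
      using in_HomD[OF that] in_HomD[OF \<eta>h(1)[OF Ao]] by (intro in_HomI) auto
    show "OnArr G (e \<cdot> \<phi>) \<cdot> \<eta> A = OnArr G e \<cdot> (OnArr G \<phi> \<cdot> \<eta> A)"
      if "e \<in> Hom T S S" "\<phi> \<in> Hom T (\<Sigma>\<^sub>o A) S" for S e \<phi>
      using functor_comp[OF G that(2,1)] in_HomD[OF that(1)] in_HomD[OF that(2)] in_HomD[OF \<eta>h(1)[OF Ao]] by simp
    show "inj_on (\<lambda>\<phi>. OnArr G \<phi> \<cdot> \<eta> A) (Hom T (\<Sigma>\<^sub>o A) S)" if S: "S \<in> Obj T" for S
    proof (rule inj_onI)
      fix s t assume s: "s \<in> Hom T (\<Sigma>\<^sub>o A) S" and t: "t \<in> Hom T (\<Sigma>\<^sub>o A) S"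
        and eq: "OnArr G s \<cdot> \<eta> A = OnArr G t \<cdot> \<eta> A"
      have "OnArr G s = OnArr G t"
        by (rule iso_cancel_right[OF \<eta>h(2)[OF Ao] \<eta>h(1)[OF Ao] _ _ eq])
          (use functor_hom[OF G So[OF Ao] S] s t in auto)
      then have "s \<cdot> \<epsilon> (\<Sigma>\<^sub>o A) = t \<cdot> \<epsilon> (\<Sigma>\<^sub>o A)" using \<epsilon>_nat[OF s] \<epsilon>_nat[OF t] by simp
      then show "s = t" by (rule iso_cancel_right[OF \<epsilon>h(2,1)[OF So[OF Ao]] s t])
    qed
  qed
qed

end

section \<open>Rigid objects\<close>

lemma (in category) iso_cancel_left_arr:
  assumes "iso_arr C k" "k \<cdot> t = k \<cdot> t'" "k \<in> Arr C" "t \<in> Arr C" "t' \<in> Arr C"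
    "Cod C t = Dom C k" "Cod C t' = Dom C k" "Dom C t = Dom C t'"
  shows "t = t'"
proof -
  obtain i where i: "i \<in> Hom C (Cod C k) (Dom C k)" "i \<cdot> k = Ident C (Dom C k)"
    using iso_arrE[OF assms(1)] assms(3) by (metis in_HomI)
  have "t = (i \<cdot> k) \<cdot> t" using i(2) assms by simp
  also have "\<dots> = i \<cdot> (k \<cdot> t')" unfolding assms(2) [symmetric] using assms in_HomD[OF i(1)] by simp
  also have "\<dots> = (i \<cdot> k) \<cdot> t'" using assms in_HomD[OF i(1)] by simp
  also have "\<dots> = t'" using i(2) assms by simp
  finally show ?thesis .
qed

lemma (in category) iso_cancel_right_arr:
  assumes "iso_arr C k" "t \<cdot> k = t' \<cdot> k" "k \<in> Arr C" "t \<in> Arr C" "t' \<in> Arr C"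
    "Dom C t = Cod C k" "Dom C t' = Cod C k" "Cod C t = Cod C t'"
  shows "t = t'"
  by (rule iso_cancel_right[OF assms(1) _ _ _ assms(2)]) (use assms in \<open>auto simp: Hom_def\<close>)

section \<open>Coherence of the symmetric monoidal structure\<close>

context tensor_triangulated_category
begin

abbreviation "E \<equiv> TUnit T"
abbreviation "id\<^sub>T \<equiv> Ident T"
abbreviation "assoc \<equiv> Assoc T"
abbreviation "assoc' X Y Z \<equiv> inv_arr T (Assoc T X Y Z)"
abbreviation "lunit \<equiv> LUnit T"
abbreviation "lunit' X \<equiv> inv_arr T (LUnit T X)"
abbreviation "runit \<equiv> RUnit T"
abbreviation "runit' X \<equiv> inv_arr T (RUnit T X)"
abbreviation "braid \<equiv> Braid T"

lemma inv_arr_simps: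
  assumes "iso_arr T f" "f \<in> Hom T A B"
  shows "inv_arr T f \<in> Arr T" "Dom T (inv_arr T f) = B" "Cod T (inv_arr T f) = A"
    "inv_arr T f \<cdot> f = id\<^sub>T A" "f \<cdot> inv_arr T f = id\<^sub>T B"
  using inv_arr[OF assms(1)] assms(2) by (auto simp: inverse_arrs_def Hom_def)

lemma tensor_simps [simp]:
  "E \<in> Obj T"
  "X \<in> Obj T \<Longrightarrow> Y \<in> Obj T \<Longrightarrow> X \<boxtimes> Y \<in> Obj T"
  "f \<in> Arr T \<Longrightarrow> g \<in> Arr T \<Longrightarrow> f \<boxdot> g \<in> Arr T"
  "f \<in> Arr T \<Longrightarrow> g \<in> Arr T \<Longrightarrow> Dom T (f \<boxdot> g) = Dom T f \<boxtimes> Dom T g"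
  "f \<in> Arr T \<Longrightarrow> g \<in> Arr T \<Longrightarrow> Cod T (f \<boxdot> g) = Cod T f \<boxtimes> Cod T g"
  "X \<in> Obj T \<Longrightarrow> Y \<in> Obj T \<Longrightarrow> id\<^sub>T X \<boxdot> id\<^sub>T Y = id\<^sub>T (X \<boxtimes> Y)"
  using tens_arr[of f "Dom T f" "Cod T f" g "Dom T g" "Cod T g"]
  by (auto simp: tunit_obj tens_obj tens_ident Hom_def)

lemma assoc_simps [simp]:
  assumes "X \<in> Obj T" "Y \<in> Obj T" "Z \<in> Obj T"
  shows "assoc X Y Z \<in> Arr T" "Dom T (assoc X Y Z) = (X \<boxtimes> Y) \<boxtimes> Z" "Cod T (assoc X Y Z) = X \<boxtimes> (Y \<boxtimes> Z)"
    "assoc' X Y Z \<in> Arr T" "Dom T (assoc' X Y Z) = X \<boxtimes> (Y \<boxtimes> Z)" "Cod T (assoc' X Y Z) = (X \<boxtimes> Y) \<boxtimes> Z"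
    "assoc' X Y Z \<cdot> assoc X Y Z = id\<^sub>T ((X \<boxtimes> Y) \<boxtimes> Z)" "assoc X Y Z \<cdot> assoc' X Y Z = id\<^sub>T (X \<boxtimes> (Y \<boxtimes> Z))"
  using assoc_iso[OF assms] inv_arr_simps[of "assoc X Y Z"] by (auto simp: Hom_def)

lemma unit_simps [simp]:
  assumes "X \<in> Obj T"
  shows "lunit X \<in> Arr T" "Dom T (lunit X) = E \<boxtimes> X" "Cod T (lunit X) = X"
    "lunit' X \<in> Arr T" "Dom T (lunit' X) = X" "Cod T (lunit' X) = E \<boxtimes> X"
    "lunit' X \<cdot> lunit X = id\<^sub>T (E \<boxtimes> X)" "lunit X \<cdot> lunit' X = id\<^sub>T X"
    "runit X \<in> Arr T" "Dom T (runit X) = X \<boxtimes> E" "Cod T (runit X) = X"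
    "runit' X \<in> Arr T" "Dom T (runit' X) = X" "Cod T (runit' X) = X \<boxtimes> E"
    "runit' X \<cdot> runit X = id\<^sub>T (X \<boxtimes> E)" "runit X \<cdot> runit' X = id\<^sub>T X"
  using lunit_iso[OF assms] inv_arr_simps[of "lunit X"] runit_iso[OF assms] inv_arr_simps[of "runit X"]
  by (auto simp: Hom_def)

lemma braid_simps [simp]:
  assumes "X \<in> Obj T" "Y \<in> Obj T"
  shows "braid X Y \<in> Arr T" "Dom T (braid X Y) = X \<boxtimes> Y" "Cod T (braid X Y) = Y \<boxtimes> X"
    "braid Y X \<cdot> braid X Y = id\<^sub>T (X \<boxtimes> Y)"
  using braid_arr[OF assms] braid_symmetric[OF assms] by (auto simp: Hom_def)

lemma structure_isos [simp]:
  "X \<in> Obj T \<Longrightarrow> Y \<in> Obj T \<Longrightarrow> Z \<in> Obj T \<Longrightarrow> iso_arr T (assoc X Y Z)"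
  "X \<in> Obj T \<Longrightarrow> iso_arr T (lunit X)"
  "X \<in> Obj T \<Longrightarrow> iso_arr T (runit X)"
  "X \<in> Obj T \<Longrightarrow> Y \<in> Obj T \<Longrightarrow> iso_arr T (braid X Y)"
  using assoc_iso lunit_iso runit_iso iso_arrI[of "braid X Y" "X \<boxtimes> Y" "Y \<boxtimes> X" "braid Y X"]
  by (auto simp: Hom_def)

lemma interchange:
  assumes "f \<in> Arr T" "g \<in> Arr T" "f' \<in> Arr T" "g' \<in> Arr T" "Dom T f' = Cod T f" "Dom T g' = Cod T g"
  shows "(f' \<boxdot> g') \<cdot> (f \<boxdot> g) = (f' \<cdot> f) \<boxdot> (g' \<cdot> g)"
  using tens_comp[of f "Dom T f" "Cod T f" f' "Cod T f'" g "Dom T g" "Cod T g" g' "Cod T g'"] assms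
  by (simp add: Hom_def)

lemma interchange_tail:
  assumes "f \<in> Arr T" "g \<in> Arr T" "f' \<in> Arr T" "g' \<in> Arr T" "Dom T f' = Cod T f" "Dom T g' = Cod T g"
    "x \<in> Arr T" "Cod T x = Dom T f \<boxtimes> Dom T g"
  shows "(f' \<boxdot> g') \<cdot> ((f \<boxdot> g) \<cdot> x) = ((f' \<cdot> f) \<boxdot> (g' \<cdot> g)) \<cdot> x"
  by (rule comp_reduce[OF interchange[OF assms(1-6)]]) (use assms in simp_all)

lemma assoc_nat:
  assumes "f \<in> Arr T" "g \<in> Arr T" "h \<in> Arr T"
  shows "assoc (Cod T f) (Cod T g) (Cod T h) \<cdot> ((f \<boxdot> g) \<boxdot> h) =
    (f \<boxdot> (g \<boxdot> h)) \<cdot> assoc (Dom T f) (Dom T g) (Dom T h)"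
  using assoc_natural[of f _ _ g _ _ h] assms by (simp add: Hom_def)

lemma assoc'_nat:
  assumes "f \<in> Arr T" "g \<in> Arr T" "h \<in> Arr T"
  shows "assoc' (Cod T f) (Cod T g) (Cod T h) \<cdot> (f \<boxdot> (g \<boxdot> h)) =
    ((f \<boxdot> g) \<boxdot> h) \<cdot> assoc' (Dom T f) (Dom T g) (Dom T h)"
proof -
  let ?a = "assoc (Dom T f) (Dom T g) (Dom T h)" and ?a' = "assoc' (Dom T f) (Dom T g) (Dom T h)"
  let ?b = "assoc (Cod T f) (Cod T g) (Cod T h)" and ?b' = "assoc' (Cod T f) (Cod T g) (Cod T h)"
  have "?b' \<cdot> (f \<boxdot> (g \<boxdot> h)) = ?b' \<cdot> (((f \<boxdot> (g \<boxdot> h)) \<cdot> ?a) \<cdot> ?a')"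
    using assms by simp
  also have "\<dots> = ?b' \<cdot> ((?b \<cdot> ((f \<boxdot> g) \<boxdot> h)) \<cdot> ?a')"
    using assoc_nat[OF assms] by simp
  also have "\<dots> = (?b' \<cdot> ?b) \<cdot> (((f \<boxdot> g) \<boxdot> h) \<cdot> ?a')"
    using assms by (simp del: assoc_simps(7,8))
  also have "\<dots> = ((f \<boxdot> g) \<boxdot> h) \<cdot> ?a'" using assms by simp
  finally show ?thesis .
qed

lemma lunit_nat: "f \<in> Arr T \<Longrightarrow> lunit (Cod T f) \<cdot> (id\<^sub>T E \<boxdot> f) = f \<cdot> lunit (Dom T f)"
  using lunit_natural[of f] by (simp add: Hom_def)

lemma runit_nat: "f \<in> Arr T \<Longrightarrow> runit (Cod T f) \<cdot> (f \<boxdot> id\<^sub>T E) = f \<cdot> runit (Dom T f)"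
  using runit_natural[of f] by (simp add: Hom_def)

lemma braid_nat:
  "f \<in> Arr T \<Longrightarrow> g \<in> Arr T \<Longrightarrow>
     braid (Cod T f) (Cod T g) \<cdot> (f \<boxdot> g) = (g \<boxdot> f) \<cdot> braid (Dom T f) (Dom T g)"
  using braid_natural[of f _ _ g] by (simp add: Hom_def)

text \<open>Tensoring with the unit is faithful, being naturally isomorphic to the identity.
  Equations between unitors can therefore be proved after tensoring with \<open>E\<close>, where the
  pentagon applies.\<close>

lemma tens_unit_right_cancel:
  assumes "s \<in> Arr T" "t \<in> Arr T" "Dom T s = Dom T t" "Cod T s = Cod T t" "s \<boxdot> id\<^sub>T E = t \<boxdot> id\<^sub>T E"
  shows "s = t"
proof (rule iso_cancel_right_arr)
  show "s \<cdot> runit (Dom T t) = t \<cdot> runit (Dom T t)"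
    using runit_nat[OF assms(1)] runit_nat[OF assms(2)] assms by simp
qed (use assms in simp_all)

lemma tens_unit_left_cancel:
  assumes "s \<in> Arr T" "t \<in> Arr T" "Dom T s = Dom T t" "Cod T s = Cod T t" "id\<^sub>T E \<boxdot> s = id\<^sub>T E \<boxdot> t"
  shows "s = t"
proof (rule iso_cancel_right_arr)
  show "s \<cdot> lunit (Dom T t) = t \<cdot> lunit (Dom T t)"
    using lunit_nat[OF assms(1)] lunit_nat[OF assms(2)] assms by simp
qed (use assms in simp_all)

text \<open>One of Kelly's consequences of the pentagon and the triangle. After tensoring with
  \<open>E\<close> and composing with an associator, the pentagon for \<open>X\<close>,
  \<open>Y\<close>, \<open>E\<close>, \<open>E\<close> relates two instances of the
  triangle.\<close>

lemma runit_tensor: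
  assumes X: "X \<in> Obj T" and Y: "Y \<in> Obj T"
  shows "(id\<^sub>T X \<boxdot> runit Y) \<cdot> assoc X Y E = runit (X \<boxtimes> Y)"
proof -
  have "assoc X Y E \<cdot> (runit (X \<boxtimes> Y) \<boxdot> id\<^sub>T E) =
      assoc X Y E \<cdot> ((id\<^sub>T (X \<boxtimes> Y) \<boxdot> lunit E) \<cdot> assoc (X \<boxtimes> Y) E E)"
    using unit_triangle[of "X \<boxtimes> Y" E] X Y by simp
  also have "\<dots> = (id\<^sub>T X \<boxdot> (id\<^sub>T Y \<boxdot> lunit E)) \<cdot> (assoc X Y (E \<boxtimes> E) \<cdot> assoc (X \<boxtimes> Y) E E)"
    using comp_reduce[OF assoc_nat[of "id\<^sub>T X" "id\<^sub>T Y" "lunit E"], of "assoc (X \<boxtimes> Y) E E"] X Y by simp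
  also have "\<dots> = (id\<^sub>T X \<boxdot> (id\<^sub>T Y \<boxdot> lunit E)) \<cdot>
      ((id\<^sub>T X \<boxdot> assoc Y E E) \<cdot> (assoc X (Y \<boxtimes> E) E \<cdot> (assoc X Y E \<boxdot> id\<^sub>T E)))"
    using pentagon[of X Y E E] X Y by simp
  also have "\<dots> = (id\<^sub>T X \<boxdot> ((id\<^sub>T Y \<boxdot> lunit E) \<cdot> assoc Y E E)) \<cdot>
      (assoc X (Y \<boxtimes> E) E \<cdot> (assoc X Y E \<boxdot> id\<^sub>T E))"
    using X Y by (simp add: interchange_tail)
  also have "\<dots> = (id\<^sub>T X \<boxdot> (runit Y \<boxdot> id\<^sub>T E)) \<cdot> (assoc X (Y \<boxtimes> E) E \<cdot> (assoc X Y E \<boxdot> id\<^sub>T E))"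
    using unit_triangle[of Y E] Y by simp
  also have "\<dots> = assoc X Y E \<cdot> (((id\<^sub>T X \<boxdot> runit Y) \<boxdot> id\<^sub>T E) \<cdot> (assoc X Y E \<boxdot> id\<^sub>T E))"
    using comp_reduce[OF assoc_nat[of "id\<^sub>T X" "runit Y" "id\<^sub>T E"], of "assoc X Y E \<boxdot> id\<^sub>T E"] X Y by simp
  also have "\<dots> = assoc X Y E \<cdot> (((id\<^sub>T X \<boxdot> runit Y) \<cdot> assoc X Y E) \<boxdot> id\<^sub>T E)"
    using X Y by (simp add: interchange)
  finally have eq: "assoc X Y E \<cdot> (runit (X \<boxtimes> Y) \<boxdot> id\<^sub>T E) =
      assoc X Y E \<cdot> (((id\<^sub>T X \<boxdot> runit Y) \<cdot> assoc X Y E) \<boxdot> id\<^sub>T E)" .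
  have "runit (X \<boxtimes> Y) \<boxdot> id\<^sub>T E = ((id\<^sub>T X \<boxdot> runit Y) \<cdot> assoc X Y E) \<boxdot> id\<^sub>T E"
    by (rule iso_cancel_left_arr[OF _ eq]) (use X Y in simp_all)
  then have "runit (X \<boxtimes> Y) = (id\<^sub>T X \<boxdot> runit Y) \<cdot> assoc X Y E"
    by (rule tens_unit_right_cancel[rotated 4]) (use X Y in auto)
  then show ?thesis by simp
qed

text \<open>The mirror image, after tensoring with \<open>E\<close> on the left: here the pentagon
  for \<open>E\<close>, \<open>E\<close>, \<open>X\<close>, \<open>Y\<close> relates two instances
  of the triangle.\<close>

lemma lunit_tensor:
  assumes X: "X \<in> Obj T" and Y: "Y \<in> Obj T"
  shows "lunit (X \<boxtimes> Y) \<cdot> assoc E X Y = lunit X \<boxdot> id\<^sub>T Y"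
proof -
  let ?u = "assoc E (E \<boxtimes> X) Y \<cdot> (assoc E E X \<boxdot> id\<^sub>T Y)"
  have "(id\<^sub>T E \<boxdot> (lunit (X \<boxtimes> Y) \<cdot> assoc E X Y)) \<cdot> ?u =
      (id\<^sub>T E \<boxdot> lunit (X \<boxtimes> Y)) \<cdot> ((id\<^sub>T E \<boxdot> assoc E X Y) \<cdot> ?u)"
    using X Y by (simp add: interchange_tail)
  also have "\<dots> = (id\<^sub>T E \<boxdot> lunit (X \<boxtimes> Y)) \<cdot> (assoc E E (X \<boxtimes> Y) \<cdot> assoc (E \<boxtimes> E) X Y)"
    using pentagon[of E E X Y] X Y by simp
  also have "\<dots> = (runit E \<boxdot> id\<^sub>T (X \<boxtimes> Y)) \<cdot> assoc (E \<boxtimes> E) X Y"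
    using comp_reduce[OF unit_triangle[of E "X \<boxtimes> Y"], of "assoc (E \<boxtimes> E) X Y"] X Y by simp
  also have "\<dots> = assoc E X Y \<cdot> ((runit E \<boxdot> id\<^sub>T X) \<boxdot> id\<^sub>T Y)"
    using assoc_nat[of "runit E" "id\<^sub>T X" "id\<^sub>T Y"] X Y by simp
  also have "\<dots> = assoc E X Y \<cdot> (((id\<^sub>T E \<boxdot> lunit X) \<boxdot> id\<^sub>T Y) \<cdot> (assoc E E X \<boxdot> id\<^sub>T Y))"
    using unit_triangle[of E X] X Y by (simp add: interchange)
  also have "\<dots> = (id\<^sub>T E \<boxdot> (lunit X \<boxdot> id\<^sub>T Y)) \<cdot> ?u"
    using comp_reduce[OF assoc_nat[of "id\<^sub>T E" "lunit X" "id\<^sub>T Y"], of "assoc E E X \<boxdot> id\<^sub>T Y"] X Y by simp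
  finally have eq: "(id\<^sub>T E \<boxdot> (lunit (X \<boxtimes> Y) \<cdot> assoc E X Y)) \<cdot> ?u = (id\<^sub>T E \<boxdot> (lunit X \<boxdot> id\<^sub>T Y)) \<cdot> ?u" .
  let ?v = "(assoc' E E X \<boxdot> id\<^sub>T Y) \<cdot> assoc' E (E \<boxtimes> X) Y"
  have "iso_arr T ?u"
  proof (rule iso_arrI)
    show "?u \<in> Hom T (((E \<boxtimes> E) \<boxtimes> X) \<boxtimes> Y) (E \<boxtimes> ((E \<boxtimes> X) \<boxtimes> Y))"
      "?v \<in> Hom T (E \<boxtimes> ((E \<boxtimes> X) \<boxtimes> Y)) (((E \<boxtimes> E) \<boxtimes> X) \<boxtimes> Y)"
      using X Y by (auto simp: Hom_def)
    show "?v \<cdot> ?u = id\<^sub>T (((E \<boxtimes> E) \<boxtimes> X) \<boxtimes> Y)"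
      using X Y comp_reduce[OF assoc_simps(7)[of E "E \<boxtimes> X" Y], of "assoc E E X \<boxdot> id\<^sub>T Y"]
      by (simp add: interchange)
    show "?u \<cdot> ?v = id\<^sub>T (E \<boxtimes> ((E \<boxtimes> X) \<boxtimes> Y))"
      using X Y by (simp add: interchange_tail)
  qed
  then have "id\<^sub>T E \<boxdot> (lunit (X \<boxtimes> Y) \<cdot> assoc E X Y) = id\<^sub>T E \<boxdot> (lunit X \<boxdot> id\<^sub>T Y)"
    by (rule iso_cancel_right_arr[OF _ eq]) (use X Y in simp_all)
  then show ?thesis by (rule tens_unit_left_cancel[rotated 4]) (use X Y in auto)
qed

text \<open>\<open>runit E \<boxdot> id\<close> equals the right unitor of
  \<open>E \<boxtimes> E\<close> by naturality; the triangle expresses the former through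
  \<open>lunit E\<close>, and \<open>runit_tensor\<close> the latter through
  \<open>runit E\<close>.\<close>

lemma lunit_unit: "lunit E = runit E"
proof -
  have eq: "runit E \<cdot> (runit E \<boxdot> id\<^sub>T E) = runit E \<cdot> runit (E \<boxtimes> E)" using runit_nat[of "runit E"] by simp
  have "runit E \<boxdot> id\<^sub>T E = runit (E \<boxtimes> E)"
    by (rule iso_cancel_left_arr[OF _ eq]) simp_all
  then have eq: "(id\<^sub>T E \<boxdot> lunit E) \<cdot> assoc E E E = (id\<^sub>T E \<boxdot> runit E) \<cdot> assoc E E E"
    using unit_triangle[of E E] runit_tensor[of E E] by simp
  have "id\<^sub>T E \<boxdot> lunit E = id\<^sub>T E \<boxdot> runit E"
    by (rule iso_cancel_right_arr[OF _ eq]) simp_all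
  then show ?thesis by (rule tens_unit_left_cancel[rotated 4]) auto
qed

text \<open>The hexagon for \<open>X\<close>, \<open>E\<close>, \<open>E\<close>, simplified by the
  triangle, \<open>lunit_tensor\<close> and naturality, becomes the claim tensored with
  \<open>E\<close> and composed with a braiding.\<close>

lemma lunit_braid:
  assumes X: "X \<in> Obj T"
  shows "lunit X \<cdot> braid X E = runit X"
proof -
  have "braid X E \<cdot> (runit X \<boxdot> id\<^sub>T E) = braid X E \<cdot> ((id\<^sub>T X \<boxdot> lunit E) \<cdot> assoc X E E)"
    using unit_triangle[of X E] X by simp
  also have "\<dots> = (lunit E \<boxdot> id\<^sub>T X) \<cdot> (braid X (E \<boxtimes> E) \<cdot> assoc X E E)"
    using comp_reduce[OF braid_nat[of "id\<^sub>T X" "lunit E"], of "assoc X E E"] X by simp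
  also have "\<dots> = lunit (E \<boxtimes> X) \<cdot> (assoc E E X \<cdot> (braid X (E \<boxtimes> E) \<cdot> assoc X E E))"
    using comp_reduce[OF lunit_tensor[of E X], of "braid X (E \<boxtimes> E) \<cdot> assoc X E E"] X by simp
  also have "\<dots> = lunit (E \<boxtimes> X) \<cdot> ((id\<^sub>T E \<boxdot> braid X E) \<cdot> (assoc E X E \<cdot> (braid X E \<boxdot> id\<^sub>T E)))"
    using hexagon[of X E E] X by simp
  also have "\<dots> = braid X E \<cdot> (lunit (X \<boxtimes> E) \<cdot> (assoc E X E \<cdot> (braid X E \<boxdot> id\<^sub>T E)))"
    using comp_reduce[OF lunit_nat[of "braid X E"], of "assoc E X E \<cdot> (braid X E \<boxdot> id\<^sub>T E)"] X by simp
  also have "\<dots> = braid X E \<cdot> ((lunit X \<boxdot> id\<^sub>T E) \<cdot> (braid X E \<boxdot> id\<^sub>T E))"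
    using comp_reduce[OF lunit_tensor[of X E], of "braid X E \<boxdot> id\<^sub>T E"] X by simp
  also have "\<dots> = braid X E \<cdot> ((lunit X \<cdot> braid X E) \<boxdot> id\<^sub>T E)" using X by (simp add: interchange)
  finally have eq: "braid X E \<cdot> (runit X \<boxdot> id\<^sub>T E) = braid X E \<cdot> ((lunit X \<cdot> braid X E) \<boxdot> id\<^sub>T E)" .
  have "runit X \<boxdot> id\<^sub>T E = (lunit X \<cdot> braid X E) \<boxdot> id\<^sub>T E"
    by (rule iso_cancel_left_arr[OF _ eq]) (use X in simp_all)
  then have "runit X = lunit X \<cdot> braid X E" by (rule tens_unit_right_cancel[rotated 4]) (use X in auto)
  then show ?thesis by simp
qed

text \<open>The inverse form of the hexagon, solved for the braiding of
  \<open>Y \<boxtimes> Z\<close> past \<open>X\<close>; symmetry supplies the inverses of the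
  braidings.\<close>

lemma hexagon':
  assumes X: "X \<in> Obj T" and Y: "Y \<in> Obj T" and Z: "Z \<in> Obj T"
  shows "assoc' X Y Z \<cdot> braid (Y \<boxtimes> Z) X =
    (braid Y X \<boxdot> id\<^sub>T Z) \<cdot> (assoc' Y X Z \<cdot> ((id\<^sub>T Y \<boxdot> braid Z X) \<cdot> assoc Y Z X))"
    (is "?l = ?r")
proof -
  let ?m = "assoc Y Z X \<cdot> (braid X (Y \<boxtimes> Z) \<cdot> assoc X Y Z)"
  note O = X Y Z
  have r: "?r \<in> Hom T ((Y \<boxtimes> Z) \<boxtimes> X) ((X \<boxtimes> Y) \<boxtimes> Z)" using O by (auto simp: Hom_def)
  have "?r = ?r \<cdot> ((braid X (Y \<boxtimes> Z) \<cdot> (assoc X Y Z \<cdot> assoc' X Y Z)) \<cdot> braid (Y \<boxtimes> Z) X)"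
    using O by simp
  also have "\<dots> = ((braid Y X \<boxdot> id\<^sub>T Z) \<cdot> (assoc' Y X Z \<cdot> ((id\<^sub>T Y \<boxdot> braid Z X) \<cdot> ?m))) \<cdot> ?l"
    using O by (simp del: assoc_simps(7,8) braid_simps(4))
  also have "?m = (id\<^sub>T Y \<boxdot> braid X Z) \<cdot> (assoc Y X Z \<cdot> (braid X Y \<boxdot> id\<^sub>T Z))"
    using hexagon[OF O] .
  also have "(id\<^sub>T Y \<boxdot> braid Z X) \<cdot> \<dots> = assoc Y X Z \<cdot> (braid X Y \<boxdot> id\<^sub>T Z)"
    using O by (simp add: interchange_tail)
  also have "assoc' Y X Z \<cdot> \<dots> = braid X Y \<boxdot> id\<^sub>T Z"
    using comp_reduce[OF assoc_simps(7)[of Y X Z], of "braid X Y \<boxdot> id\<^sub>T Z"] O by simp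
  also have "(braid Y X \<boxdot> id\<^sub>T Z) \<cdot> \<dots> = id\<^sub>T ((X \<boxtimes> Y) \<boxtimes> Z)" using O by (simp add: interchange)
  also have "\<dots> \<cdot> ?l = ?l" using O by simp
  finally show ?thesis by simp
qed

end

section \<open>Evaluation maps and dual objects\<close>

context closed_tensor_triangulated_category
begin

lemma adj_hom:
  assumes "t \<in> Hom T (X \<boxtimes> Y) Z" "X \<in> Obj T" "Y \<in> Obj T"
  shows "Adj T X Y Z t \<in> Hom T X (IHom T Y Z)"
  using bij_betwE[OF adj_bij[OF assms(2,3) hom_obj(2)[OF assms(1)]]] assms(1) by blast

lemma adj_inj:
  assumes "s \<in> Hom T (X \<boxtimes> Y) Z" "t \<in> Hom T (X \<boxtimes> Y) Z" "X \<in> Obj T" "Y \<in> Obj T"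
    "Adj T X Y Z s = Adj T X Y Z t"
  shows "s = t"
  using bij_betw_imp_inj_on[OF adj_bij[OF assms(3,4) hom_obj(2)[OF assms(1)]]] assms
  by (auto simp: inj_on_def)

lemma adj_nat:
  assumes "f \<in> Hom T X' X" "t \<in> Hom T (X \<boxtimes> Y) Z" "Y \<in> Obj T"
  shows "Adj T X' Y Z (t \<cdot> (f \<boxdot> id\<^sub>T Y)) = Adj T X Y Z t \<cdot> f"
proof -
  have Z: "Z \<in> Obj T" "X \<in> Obj T" using hom_obj[OF assms(2)] hom_obj[OF assms(1)] by auto
  have "Adj T X' Y Z (id\<^sub>T Z \<cdot> (t \<cdot> (f \<boxdot> id\<^sub>T Y))) =
      IHomA T (id\<^sub>T Y) (id\<^sub>T Z) \<cdot> (Adj T X Y Z t \<cdot> f)"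
    by (rule adj_natural[OF assms(1) _ _ assms(2)]) (use assms(3) Z ident_closed in auto)
  moreover have "id\<^sub>T Z \<cdot> (t \<cdot> (f \<boxdot> id\<^sub>T Y)) = t \<cdot> (f \<boxdot> id\<^sub>T Y)"
    using in_HomD[OF assms(1)] in_HomD[OF assms(2)] assms(3) by simp
  moreover have "IHomA T (id\<^sub>T Y) (id\<^sub>T Z) \<cdot> (Adj T X Y Z t \<cdot> f) = Adj T X Y Z t \<cdot> f"
    using ihom_ident[OF assms(3) Z(1)] in_HomD[OF adj_hom[OF assms(2) Z(2) assms(3)]] in_HomD[OF assms(1)] by simp
  ultimately show ?thesis by simp
qed

abbreviation "ev A \<equiv> eval_arr T A E"
abbreviation "du A \<equiv> dual T A"

lemma dual_obj [simp]: "A \<in> Obj T \<Longrightarrow> du A \<in> Obj T"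
  by (simp add: dual_def ihom_obj)

lemma ev:
  assumes A: "A \<in> Obj T"
  shows "ev A \<in> Hom T (du A \<boxtimes> A) E" and "Adj T (du A) A E (ev A) = id\<^sub>T (du A)"
proof -
  have b: "bij_betw (Adj T (du A) A E) (Hom T (du A \<boxtimes> A) E) (Hom T (du A) (IHom T A E))"
    using adj_bij[of "du A" A E] A by simp
  have i: "id\<^sub>T (du A) \<in> Hom T (du A) (IHom T A E)" using ident_closed[OF dual_obj[OF A]] by (simp add: dual_def)
  show "ev A \<in> Hom T (du A \<boxtimes> A) E"
    unfolding eval_arr_def using bij_betwE[OF bij_betw_the_inv_into[OF b]] i by (simp add: dual_def)
  show "Adj T (du A) A E (ev A) = id\<^sub>T (du A)"
    unfolding eval_arr_def using f_the_inv_into_f_bij_betw[OF b] i by (simp add: dual_def)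
qed

lemma ev_simps [simp]:
  assumes "A \<in> Obj T"
  shows "ev A \<in> Arr T" "Dom T (ev A) = du A \<boxtimes> A" "Cod T (ev A) = E"
  using in_HomD[OF ev(1)[OF assms]] by auto

lemma adj_ev:
  assumes A: "A \<in> Obj T" and s: "s \<in> Hom T X (du A)"
  shows "Adj T X A E (ev A \<cdot> (s \<boxdot> id\<^sub>T A)) = s"
  using adj_nat[OF s ev(1)[OF A] A] ev(2)[OF A] in_HomD[OF s] by simp

text \<open>By \<open>adj_ev\<close> an arrow into a dual object is recovered from its evaluation,
  so equations between such arrows may be tested after evaluating.\<close>

lemma ev_cancel:
  assumes "A \<in> Obj T" "s \<in> Hom T X (du A)" "t \<in> Hom T X (du A)"
    "ev A \<cdot> (s \<boxdot> id\<^sub>T A) = ev A \<cdot> (t \<boxdot> id\<^sub>T A)"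
  shows "s = t"
  using adj_ev[OF assms(1,2)] adj_ev[OF assms(1,3)] unfolding assms(4) by (rule trans[OF sym])

text \<open>Evaluation with \<open>A\<close> on the left, the form in which it meets a coevaluation
  \<open>E \<rightarrow> du A \<boxtimes> A\<close> in the triangle identities.\<close>

definition ev' :: "'o \<Rightarrow> 'm" where
  "ev' A = ev A \<cdot> braid A (du A)"

lemma ev'_simps [simp]:
  assumes "A \<in> Obj T"
  shows "ev' A \<in> Arr T" "Dom T (ev' A) = A \<boxtimes> du A" "Cod T (ev' A) = E"
  using assms by (auto simp: ev'_def)

lemma ev'_cancel:
  assumes A: "A \<in> Obj T" and s: "s \<in> Hom T X (du A)" and t: "t \<in> Hom T X (du A)"
    and eq: "ev' A \<cdot> (id\<^sub>T A \<boxdot> s) = ev' A \<cdot> (id\<^sub>T A \<boxdot> t)"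
  shows "s = t"
proof (rule ev_cancel[OF A s t])
  have X: "X \<in> Obj T" using hom_obj[OF s] by blast
  have *: "ev A \<cdot> (r \<boxdot> id\<^sub>T A) = ev' A \<cdot> ((id\<^sub>T A \<boxdot> r) \<cdot> braid X A)" if r: "r \<in> Hom T X (du A)" for r
  proof -
    note r = in_HomD[OF r]
    have "(r \<boxdot> id\<^sub>T A) = (r \<boxdot> id\<^sub>T A) \<cdot> (braid A X \<cdot> braid X A)" using A X r by simp
    also have "\<dots> = ((r \<boxdot> id\<^sub>T A) \<cdot> braid A X) \<cdot> braid X A" using A X r by (simp del: braid_simps(4))
    also have "(r \<boxdot> id\<^sub>T A) \<cdot> braid A X = braid A (du A) \<cdot> (id\<^sub>T A \<boxdot> r)"
      using braid_nat[of "id\<^sub>T A" r] A r by simp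
    finally show ?thesis using A X r by (simp add: ev'_def)
  qed
  have "ev' A \<cdot> ((id\<^sub>T A \<boxdot> s) \<cdot> braid X A) = ev' A \<cdot> ((id\<^sub>T A \<boxdot> t) \<cdot> braid X A)"
    using arg_cong[OF eq, of "\<lambda>k. k \<cdot> braid X A"] A X in_HomD[OF s] in_HomD[OF t] by simp
  then show "ev A \<cdot> (s \<boxdot> id\<^sub>T A) = ev A \<cdot> (t \<boxdot> id\<^sub>T A)" unfolding *[OF s] *[OF t] .
qed

end

text \<open>The last assumption states that \<open>rigid_map T A A\<close> sends \<open>\<eta>\<close> to the adjunct of \<open>lunit A\<close>, i.e. to
  the name of the identity of \<open>A\<close>.\<close>

locale rigid_object = closed_tensor_triangulated_category T
  for T :: "('o, 'm, 'x) ttcat_scheme" (structure) +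
  fixes A :: 'o and \<eta> :: 'm
  assumes A [simp]: "A \<in> Obj T" and eta: "\<eta> \<in> Hom T E (du A \<boxtimes> A)"
    and rigid: "lunit A \<cdot> (ev A \<boxdot> id\<^sub>T A) \<cdot> assoc' (du A) A A \<cdot> (id\<^sub>T (du A) \<boxdot> braid A A) \<cdot>
                  assoc (du A) A A \<cdot> (\<eta> \<boxdot> id\<^sub>T A) = lunit A"
begin

abbreviation "D \<equiv> du A"

lemma eta_simps [simp]: "\<eta> \<in> Arr T" "Dom T \<eta> = E" "Cod T \<eta> = D \<boxtimes> A"
  using in_HomD[OF eta] by auto

text \<open>The first triangle identity. The assumption \<open>rigid\<close> has
  \<open>\<eta>\<close> to the left of \<open>A\<close>; the braiding moves it to the right, and the
  hexagon resolves the braiding past \<open>D \<boxtimes> A\<close> into braidings past each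
  factor.\<close>

lemma triangle_A: "lunit A \<cdot> (ev' A \<boxdot> id\<^sub>T A) \<cdot> assoc' A D A \<cdot> (id\<^sub>T A \<boxdot> \<eta>) = runit A"
proof -
  let ?z = "(\<eta> \<boxdot> id\<^sub>T A) \<cdot> braid A E"
  have "id\<^sub>T A \<boxdot> \<eta> = ((id\<^sub>T A \<boxdot> \<eta>) \<cdot> braid E A) \<cdot> braid A E" by simp
  also have "\<dots> = braid (D \<boxtimes> A) A \<cdot> ?z" using comp_reduce[OF braid_nat[of \<eta> "id\<^sub>T A"], of "braid A E"] by simp
  finally have "assoc' A D A \<cdot> (id\<^sub>T A \<boxdot> \<eta>) = (assoc' A D A \<cdot> braid (D \<boxtimes> A) A) \<cdot> ?z" by simp
  also have "\<dots> = (braid D A \<boxdot> id\<^sub>T A) \<cdot> assoc' D A A \<cdot> (id\<^sub>T D \<boxdot> braid A A) \<cdot> assoc D A A \<cdot> ?z"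
    unfolding hexagon'[OF A dual_obj[OF A] A] by simp
  finally have 1: "assoc' A D A \<cdot> (id\<^sub>T A \<boxdot> \<eta>) =
      (braid D A \<boxdot> id\<^sub>T A) \<cdot> assoc' D A A \<cdot> (id\<^sub>T D \<boxdot> braid A A) \<cdot> assoc D A A \<cdot> ?z" .
  have 2: "(ev' A \<boxdot> id\<^sub>T A) \<cdot> (braid D A \<boxdot> id\<^sub>T A) = ev A \<boxdot> id\<^sub>T A"
    by (simp add: interchange) (simp add: ev'_def)
  have "lunit A \<cdot> (ev' A \<boxdot> id\<^sub>T A) \<cdot> assoc' A D A \<cdot> (id\<^sub>T A \<boxdot> \<eta>) =
      (lunit A \<cdot> (ev A \<boxdot> id\<^sub>T A) \<cdot> assoc' D A A \<cdot> (id\<^sub>T D \<boxdot> braid A A) \<cdot> assoc D A A \<cdot> (\<eta> \<boxdot> id\<^sub>T A)) \<cdot> braid A E"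
    unfolding 1 by (simp add: comp_reduce[OF 2])
  also have "\<dots> = runit A" unfolding rigid by (simp add: lunit_braid)
  finally show ?thesis .
qed

text \<open>The composite in the second triangle identity, which will turn out to be
  \<open>lunit D\<close>.\<close>

definition zigzag :: 'm where
  "zigzag = runit D \<cdot> (id\<^sub>T D \<boxdot> ev' A) \<cdot> assoc D A D \<cdot> (\<eta> \<boxdot> id\<^sub>T D)"

lemma zigzag_simps [simp]: "zigzag \<in> Arr T" "Dom T zigzag = E \<boxtimes> D" "Cod T zigzag = D"
  by (simp_all add: zigzag_def)

text \<open>The pentagon for \<open>X\<close>, \<open>D\<close>, \<open>A\<close>, \<open>D\<close>
  moves the associators out of the zigzag tensored with \<open>X\<close>. The case
  \<open>X = A\<close> serves the second triangle identity, the general case the adjunction.\<close>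

lemma zigzag_tensor:
  assumes X: "X \<in> Obj T"
  shows "runit (X \<boxtimes> D) \<cdot> (id\<^sub>T (X \<boxtimes> D) \<boxdot> ev' A) \<cdot> assoc (X \<boxtimes> D) A D \<cdot> (assoc' X D A \<boxdot> id\<^sub>T D) \<cdot>
      ((id\<^sub>T X \<boxdot> \<eta>) \<boxdot> id\<^sub>T D) = (id\<^sub>T X \<boxdot> zigzag) \<cdot> assoc X E D"
proof -
  let ?z = "(id\<^sub>T X \<boxdot> \<eta>) \<boxdot> id\<^sub>T D"
  have "assoc (X \<boxtimes> D) A D \<cdot> (assoc' X D A \<boxdot> id\<^sub>T D) =
      (assoc' X D (A \<boxtimes> D) \<cdot> assoc X D (A \<boxtimes> D)) \<cdot> assoc (X \<boxtimes> D) A D \<cdot> (assoc' X D A \<boxdot> id\<^sub>T D)"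
    using X by simp
  also have "\<dots> = assoc' X D (A \<boxtimes> D) \<cdot> (assoc X D (A \<boxtimes> D) \<cdot> assoc (X \<boxtimes> D) A D) \<cdot> (assoc' X D A \<boxdot> id\<^sub>T D)"
    using X by (simp del: assoc_simps(7,8))
  also have "assoc X D (A \<boxtimes> D) \<cdot> assoc (X \<boxtimes> D) A D =
      (id\<^sub>T X \<boxdot> assoc D A D) \<cdot> assoc X (D \<boxtimes> A) D \<cdot> (assoc X D A \<boxdot> id\<^sub>T D)"
    using pentagon[of X D A D] X by simp
  also have "assoc' X D (A \<boxtimes> D) \<cdot> \<dots> \<cdot> (assoc' X D A \<boxdot> id\<^sub>T D) =
      assoc' X D (A \<boxtimes> D) \<cdot> (id\<^sub>T X \<boxdot> assoc D A D) \<cdot> assoc X (D \<boxtimes> A) D"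
    using X by (simp add: interchange)
  finally have 1: "assoc (X \<boxtimes> D) A D \<cdot> (assoc' X D A \<boxdot> id\<^sub>T D) =
      assoc' X D (A \<boxtimes> D) \<cdot> (id\<^sub>T X \<boxdot> assoc D A D) \<cdot> assoc X (D \<boxtimes> A) D" .
  have 2: "(id\<^sub>T (X \<boxtimes> D) \<boxdot> ev' A) \<cdot> assoc' X D (A \<boxtimes> D) = assoc' X D E \<cdot> (id\<^sub>T X \<boxdot> (id\<^sub>T D \<boxdot> ev' A))"
    using assoc'_nat[of "id\<^sub>T X" "id\<^sub>T D" "ev' A"] X by simp
  have "runit (X \<boxtimes> D) \<cdot> assoc' X D E = ((id\<^sub>T X \<boxdot> runit D) \<cdot> assoc X D E) \<cdot> assoc' X D E"
    using runit_tensor[of X D] X by simp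
  also have "\<dots> = id\<^sub>T X \<boxdot> runit D" using X by simp
  finally have 3: "runit (X \<boxtimes> D) \<cdot> assoc' X D E = id\<^sub>T X \<boxdot> runit D" .
  have 4: "assoc X (D \<boxtimes> A) D \<cdot> ?z = (id\<^sub>T X \<boxdot> (\<eta> \<boxdot> id\<^sub>T D)) \<cdot> assoc X E D"
    using assoc_nat[of "id\<^sub>T X" \<eta> "id\<^sub>T D"] X by simp
  have "runit (X \<boxtimes> D) \<cdot> (id\<^sub>T (X \<boxtimes> D) \<boxdot> ev' A) \<cdot> assoc (X \<boxtimes> D) A D \<cdot> (assoc' X D A \<boxdot> id\<^sub>T D) \<cdot> ?z =
     runit (X \<boxtimes> D) \<cdot> (id\<^sub>T (X \<boxtimes> D) \<boxdot> ev' A) \<cdot> (assoc (X \<boxtimes> D) A D \<cdot> (assoc' X D A \<boxdot> id\<^sub>T D)) \<cdot> ?z"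
    using X by simp
  also have "\<dots> = runit (X \<boxtimes> D) \<cdot> ((id\<^sub>T (X \<boxtimes> D) \<boxdot> ev' A) \<cdot> assoc' X D (A \<boxtimes> D)) \<cdot>
      (id\<^sub>T X \<boxdot> assoc D A D) \<cdot> (assoc X (D \<boxtimes> A) D \<cdot> ?z)"
    unfolding 1 using X by simp
  also have "\<dots> = (runit (X \<boxtimes> D) \<cdot> assoc' X D E) \<cdot> (id\<^sub>T X \<boxdot> (id\<^sub>T D \<boxdot> ev' A)) \<cdot>
      (id\<^sub>T X \<boxdot> assoc D A D) \<cdot> (id\<^sub>T X \<boxdot> (\<eta> \<boxdot> id\<^sub>T D)) \<cdot> assoc X E D"
    unfolding 2 4 using X by simp
  also have "\<dots> = (id\<^sub>T X \<boxdot> zigzag) \<cdot> assoc X E D"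
    unfolding 3 zigzag_def using X by (simp add: interchange_tail)
  finally show ?thesis .
qed

lemma ev'_lunit:
  "ev' A \<cdot> (lunit A \<boxdot> id\<^sub>T D) = runit E \<cdot> (id\<^sub>T E \<boxdot> ev' A) \<cdot> assoc E A D"
proof -
  have "ev' A \<cdot> (lunit A \<boxdot> id\<^sub>T D) = (ev' A \<cdot> lunit (A \<boxtimes> D)) \<cdot> assoc E A D"
    using lunit_tensor[of A D] by simp
  also have "ev' A \<cdot> lunit (A \<boxtimes> D) = lunit E \<cdot> (id\<^sub>T E \<boxdot> ev' A)" using lunit_nat[of "ev' A"] by simp
  finally show ?thesis by (simp add: lunit_unit)
qed

text \<open>The second triangle identity follows from the first. Arrows into \<open>D\<close> may be
  compared after \<open>ev'\<close>; there two evaluations act on disjoint factors, and once they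
  are exchanged, one of them is absorbed by \<open>triangle_A\<close>.\<close>

lemma zigzag: "zigzag = lunit D"
proof (rule ev'_cancel[OF A])
  let ?z = "(assoc' A D A \<boxdot> id\<^sub>T D) \<cdot> ((id\<^sub>T A \<boxdot> \<eta>) \<boxdot> id\<^sub>T D)"
  have 1: "ev' A \<cdot> runit (A \<boxtimes> D) = runit E \<cdot> (ev' A \<boxdot> id\<^sub>T E)" using runit_nat[of "ev' A"] by simp
  have 2: "(ev' A \<boxdot> id\<^sub>T (A \<boxtimes> D)) \<cdot> assoc (A \<boxtimes> D) A D = assoc E A D \<cdot> ((ev' A \<boxdot> id\<^sub>T A) \<boxdot> id\<^sub>T D)"
    using assoc_nat[of "ev' A" "id\<^sub>T A" "id\<^sub>T D"] by simp
  have "ev' A \<cdot> (id\<^sub>T A \<boxdot> zigzag) \<cdot> assoc A E D =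
      ev' A \<cdot> runit (A \<boxtimes> D) \<cdot> (id\<^sub>T (A \<boxtimes> D) \<boxdot> ev' A) \<cdot> assoc (A \<boxtimes> D) A D \<cdot> ?z"
    using zigzag_tensor[of A] by simp
  also have "\<dots> = (ev' A \<cdot> runit (A \<boxtimes> D)) \<cdot> (id\<^sub>T (A \<boxtimes> D) \<boxdot> ev' A) \<cdot> assoc (A \<boxtimes> D) A D \<cdot> ?z" by simp
  also have "\<dots> = runit E \<cdot> ((ev' A \<boxdot> id\<^sub>T E) \<cdot> (id\<^sub>T (A \<boxtimes> D) \<boxdot> ev' A)) \<cdot> assoc (A \<boxtimes> D) A D \<cdot> ?z"
    unfolding 1 by simp
  also have "(ev' A \<boxdot> id\<^sub>T E) \<cdot> (id\<^sub>T (A \<boxtimes> D) \<boxdot> ev' A) = (id\<^sub>T E \<boxdot> ev' A) \<cdot> (ev' A \<boxdot> id\<^sub>T (A \<boxtimes> D))"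
    by (simp add: interchange)
  also have "runit E \<cdot> \<dots> \<cdot> assoc (A \<boxtimes> D) A D \<cdot> ?z =
      runit E \<cdot> (id\<^sub>T E \<boxdot> ev' A) \<cdot> ((ev' A \<boxdot> id\<^sub>T (A \<boxtimes> D)) \<cdot> assoc (A \<boxtimes> D) A D) \<cdot> ?z" by simp
  also have "\<dots> = (runit E \<cdot> (id\<^sub>T E \<boxdot> ev' A) \<cdot> assoc E A D) \<cdot> ((ev' A \<boxdot> id\<^sub>T A) \<boxdot> id\<^sub>T D) \<cdot> ?z"
    unfolding 2 by simp
  also have "\<dots> = ev' A \<cdot> ((lunit A \<cdot> (ev' A \<boxdot> id\<^sub>T A) \<cdot> assoc' A D A \<cdot> (id\<^sub>T A \<boxdot> \<eta>)) \<boxdot> id\<^sub>T D)"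
    unfolding ev'_lunit [symmetric] by (simp add: interchange)
  also have "\<dots> = ev' A \<cdot> (id\<^sub>T A \<boxdot> lunit D) \<cdot> assoc A E D"
    unfolding triangle_A using unit_triangle[of A D] by simp
  finally have eq: "(ev' A \<cdot> (id\<^sub>T A \<boxdot> zigzag)) \<cdot> assoc A E D = (ev' A \<cdot> (id\<^sub>T A \<boxdot> lunit D)) \<cdot> assoc A E D" by simp
  show "ev' A \<cdot> (id\<^sub>T A \<boxdot> zigzag) = ev' A \<cdot> (id\<^sub>T A \<boxdot> lunit D)"
    by (rule iso_cancel_right_arr[OF _ eq]) simp_all
qed (auto simp: Hom_def)

section \<open>Tensoring with the dual as left adjoint of tensoring with the object\<close>

definition adj_unit :: "'o \<Rightarrow> 'm" where
  "adj_unit X = assoc' X D A \<cdot> (id\<^sub>T X \<boxdot> \<eta>) \<cdot> runit' X"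

lemma adj_unit_simps [simp]:
  assumes "X \<in> Obj T"
  shows "adj_unit X \<in> Arr T" "Dom T (adj_unit X) = X" "Cod T (adj_unit X) = (X \<boxtimes> D) \<boxtimes> A"
  using assms by (simp_all add: adj_unit_def)

text \<open>A triangle identity of the adjunction, obtained by tensoring the zigzag with
  \<open>X\<close>. It also exhibits \<open>X \<boxtimes> D\<close> as a retract of
  \<open>((X \<boxtimes> D) \<boxtimes> A) \<boxtimes> D\<close>.\<close>

lemma adj_unit_contract:
  assumes X: "X \<in> Obj T"
  shows "runit (X \<boxtimes> D) \<cdot> (id\<^sub>T (X \<boxtimes> D) \<boxdot> ev' A) \<cdot> assoc (X \<boxtimes> D) A D \<cdot> (adj_unit X \<boxdot> id\<^sub>T D) = id\<^sub>T (X \<boxtimes> D)"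
proof -
  have "adj_unit X \<boxdot> id\<^sub>T D = (assoc' X D A \<boxdot> id\<^sub>T D) \<cdot> ((id\<^sub>T X \<boxdot> \<eta>) \<boxdot> id\<^sub>T D) \<cdot> (runit' X \<boxdot> id\<^sub>T D)"
    using X by (simp add: adj_unit_def interchange)
  then have "runit (X \<boxtimes> D) \<cdot> (id\<^sub>T (X \<boxtimes> D) \<boxdot> ev' A) \<cdot> assoc (X \<boxtimes> D) A D \<cdot> (adj_unit X \<boxdot> id\<^sub>T D) =
      (runit (X \<boxtimes> D) \<cdot> (id\<^sub>T (X \<boxtimes> D) \<boxdot> ev' A) \<cdot> assoc (X \<boxtimes> D) A D \<cdot> (assoc' X D A \<boxdot> id\<^sub>T D) \<cdot>
      ((id\<^sub>T X \<boxdot> \<eta>) \<boxdot> id\<^sub>T D)) \<cdot> (runit' X \<boxdot> id\<^sub>T D)"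
    using X by simp
  also have "\<dots> = ((id\<^sub>T X \<boxdot> lunit D) \<cdot> assoc X E D) \<cdot> (runit' X \<boxdot> id\<^sub>T D)"
    unfolding zigzag_tensor[OF X] zigzag ..
  also have "\<dots> = id\<^sub>T (X \<boxtimes> D)"
    using X unit_triangle[of X D] by (simp add: interchange)
  finally show ?thesis .
qed

lemma adj_unit_nat:
  assumes f: "f \<in> Hom T X Y"
  shows "adj_unit Y \<cdot> f = ((f \<boxdot> id\<^sub>T D) \<boxdot> id\<^sub>T A) \<cdot> adj_unit X"
proof -
  note F [simp] = in_HomD[OF f]
  have O [simp]: "X \<in> Obj T" "Y \<in> Obj T" using hom_obj[OF f] by auto
  have "runit' Y \<cdot> f = runit' Y \<cdot> (f \<cdot> runit X) \<cdot> runit' X" by simp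
  also have "f \<cdot> runit X = runit Y \<cdot> (f \<boxdot> id\<^sub>T E)" using runit_nat[of f] by simp
  also have "runit' Y \<cdot> \<dots> \<cdot> runit' X = (runit' Y \<cdot> runit Y) \<cdot> (f \<boxdot> id\<^sub>T E) \<cdot> runit' X"
    by (simp del: unit_simps(15,16))
  also have "\<dots> = (f \<boxdot> id\<^sub>T E) \<cdot> runit' X" by simp
  finally have 1: "runit' Y \<cdot> f = (f \<boxdot> id\<^sub>T E) \<cdot> runit' X" .
  have "adj_unit Y \<cdot> f = assoc' Y D A \<cdot> (id\<^sub>T Y \<boxdot> \<eta>) \<cdot> (runit' Y \<cdot> f)" by (simp add: adj_unit_def)
  also have "\<dots> = (assoc' Y D A \<cdot> (f \<boxdot> (id\<^sub>T D \<boxdot> id\<^sub>T A))) \<cdot> (id\<^sub>T X \<boxdot> \<eta>) \<cdot> runit' X"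
    unfolding 1 by (simp add: interchange_tail)
  also have "assoc' Y D A \<cdot> (f \<boxdot> (id\<^sub>T D \<boxdot> id\<^sub>T A)) = ((f \<boxdot> id\<^sub>T D) \<boxdot> id\<^sub>T A) \<cdot> assoc' X D A"
    using assoc'_nat[of f "id\<^sub>T D" "id\<^sub>T A"] by simp
  finally show ?thesis by (simp add: adj_unit_def)
qed

text \<open>Naturality moves \<open>t\<close> to the front, and \<open>adj_unit_contract\<close>
  removes the rest. This left inverse of transposition gives the injectivity required by
  \<open>compact_object_left_adjoint\<close>.\<close>

lemma transpose_inverse:
  assumes X: "X \<in> Obj T" and t: "t \<in> Hom T (X \<boxtimes> D) S"
  shows "runit S \<cdot> (id\<^sub>T S \<boxdot> ev' A) \<cdot> assoc S A D \<cdot> (((t \<boxdot> id\<^sub>T A) \<cdot> adj_unit X) \<boxdot> id\<^sub>T D) = t"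
proof -
  note t' [simp] = in_HomD[OF t]
  have S [simp]: "S \<in> Obj T" using hom_obj[OF t] by auto
  have 1: "assoc S A D \<cdot> ((t \<boxdot> id\<^sub>T A) \<boxdot> id\<^sub>T D) = (t \<boxdot> id\<^sub>T (A \<boxtimes> D)) \<cdot> assoc (X \<boxtimes> D) A D"
    using assoc_nat[of t "id\<^sub>T A" "id\<^sub>T D"] X by simp
  have "runit S \<cdot> (id\<^sub>T S \<boxdot> ev' A) \<cdot> assoc S A D \<cdot> (((t \<boxdot> id\<^sub>T A) \<cdot> adj_unit X) \<boxdot> id\<^sub>T D) =
      runit S \<cdot> (id\<^sub>T S \<boxdot> ev' A) \<cdot> (assoc S A D \<cdot> ((t \<boxdot> id\<^sub>T A) \<boxdot> id\<^sub>T D)) \<cdot> (adj_unit X \<boxdot> id\<^sub>T D)"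
    using X by (simp add: interchange)
  also have "\<dots> = (runit S \<cdot> (t \<boxdot> id\<^sub>T E)) \<cdot> (id\<^sub>T (X \<boxtimes> D) \<boxdot> ev' A) \<cdot> assoc (X \<boxtimes> D) A D \<cdot> (adj_unit X \<boxdot> id\<^sub>T D)"
    unfolding 1 using X by (simp add: interchange_tail)
  also have "\<dots> = t \<cdot> (runit (X \<boxtimes> D) \<cdot> (id\<^sub>T (X \<boxtimes> D) \<boxdot> ev' A) \<cdot> assoc (X \<boxtimes> D) A D \<cdot> (adj_unit X \<boxdot> id\<^sub>T D))"
    using runit_nat[of t] X by simp
  also have "\<dots> = t" unfolding adj_unit_contract[OF X] using X by simp
  finally show ?thesis .
qed

text \<open>That \<open>- \<boxtimes> A\<close> preserves coproducts and zero arrows comes from its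
  right adjoint \<open>IHom T A\<close>.\<close>

lemma compact_tensor_dual:
  assumes C: "compact_object (U :: 'u set) T C"
  shows "compact_object U T (C \<boxtimes> D)"
proof -
  have Co [simp]: "C \<in> Obj T" using C by (simp add: compact_object_def)
  let ?R = "\<lparr>OnObj = (\<lambda>X. X \<boxtimes> A), OnArr = (\<lambda>f. f \<boxdot> id\<^sub>T A)\<rparr>"
  have R: "is_functor T T ?R"
    using tens_exact_left[OF A] by (simp add: exact_functor_def additive_functor_def)
  have Q: "IHom T A Y \<in> Obj T" if "Y \<in> Obj T" for Y using ihom_obj[OF A that] .
  have bij: "bij_betw (Adj T X A Y) (Hom T (OnObj ?R X) Y) (Hom T X (IHom T A Y))"
    if "X \<in> Obj T" "Y \<in> Obj T" for X Y
    using adj_bij[OF that(1) A that(2)] by simp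
  have nat: "Adj T X' A Y (t \<cdot> OnArr ?R k) = Adj T X A Y t \<cdot> k"
    if "k \<in> Hom T X' X" "t \<in> Hom T (OnObj ?R X) Y" for X X' Y k t
    using adj_nat[OF that(1) _ A] that(2) by simp
  obtain Z where Z: "zero_object T Z" using has_zero_object by blast
  show ?thesis
  proof (rule compact_object_left_adjoint[OF C _ R, where \<Phi> = "\<lambda>S t. (t \<boxdot> id\<^sub>T A) \<cdot> adj_unit C"])
    show "C \<boxtimes> D \<in> Obj T" by simp
    show "OnArr ?R (Zero T X Y) = Zero T (OnObj ?R X) (OnObj ?R Y)" if "X \<in> Obj T" "Y \<in> Obj T" for X Y
      by (rule left_adjoint_zero[where \<Psi> = "\<lambda>X. Adj T X A", OF R Q bij Z that])
    show "is_coproduct T I (\<lambda>i. OnObj ?R (X i)) (OnObj ?R S) (\<lambda>i. OnArr ?R (\<iota> i))"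
      if "is_coproduct T I X S \<iota>" for I :: "'u set" and X S \<iota>
      by (rule left_adjoint_coproduct[where \<Psi> = "\<lambda>X. Adj T X A", OF R Q bij nat that])
    show "(t \<boxdot> id\<^sub>T A) \<cdot> adj_unit C \<in> Hom T C (OnObj ?R S)" if "t \<in> Hom T (C \<boxtimes> D) S" for S t
      using in_HomD[OF that] by (intro in_HomI) auto
    show "inj_on (\<lambda>t. (t \<boxdot> id\<^sub>T A) \<cdot> adj_unit C) (Hom T (C \<boxtimes> D) S)" for S
      by (rule inj_on_inverseI[of _ "\<lambda>k. runit S \<cdot> (id\<^sub>T S \<boxdot> ev' A) \<cdot> assoc S A D \<cdot> (k \<boxdot> id\<^sub>T D)"])
        (rule transpose_inverse[OF Co])
    show "((e \<cdot> t) \<boxdot> id\<^sub>T A) \<cdot> adj_unit C = OnArr ?R e \<cdot> (t \<boxdot> id\<^sub>T A) \<cdot> adj_unit C"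
      if "e \<in> Hom T S S" "t \<in> Hom T (C \<boxtimes> D) S" for S e t
      using in_HomD[OF that(1)] in_HomD[OF that(2)] by (simp add: interchange_tail)
  qed
qed

text \<open>The chain starts from \<open>A\<close>, not from the unit:
  \<open>A \<boxtimes> D\<close> is compact, hence so is its copy
  \<open>(E \<boxtimes> D) \<boxtimes> A\<close>, and after tensoring with \<open>D\<close> once
  more, \<open>adj_unit_contract\<close> at \<open>X = E\<close> makes
  \<open>E \<boxtimes> D\<close> a retract.\<close>

lemma compact_dual:
  assumes "compact_object (U :: 'u set) T A"
  shows "compact_object U T D"
proof -
  have 1: "compact_object U T (A \<boxtimes> D)" by (rule compact_tensor_dual[OF assms])
  have "compact_object U T ((E \<boxtimes> D) \<boxtimes> A)"
  proof (rule compact_object_retract[OF 1])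
    show "braid D A \<cdot> (lunit D \<boxdot> id\<^sub>T A) \<in> Hom T ((E \<boxtimes> D) \<boxtimes> A) (A \<boxtimes> D)"
      and "(lunit' D \<boxdot> id\<^sub>T A) \<cdot> braid A D \<in> Hom T (A \<boxtimes> D) ((E \<boxtimes> D) \<boxtimes> A)" by (auto simp: Hom_def)
    have "((lunit' D \<boxdot> id\<^sub>T A) \<cdot> braid A D) \<cdot> (braid D A \<cdot> (lunit D \<boxdot> id\<^sub>T A)) =
        (lunit' D \<boxdot> id\<^sub>T A) \<cdot> ((braid A D \<cdot> braid D A) \<cdot> (lunit D \<boxdot> id\<^sub>T A))"
      by (simp del: braid_simps(4))
    also have "\<dots> = id\<^sub>T ((E \<boxtimes> D) \<boxtimes> A)" by (simp add: interchange)
    finally show "((lunit' D \<boxdot> id\<^sub>T A) \<cdot> braid A D) \<cdot> (braid D A \<cdot> (lunit D \<boxdot> id\<^sub>T A)) = id\<^sub>T ((E \<boxtimes> D) \<boxtimes> A)" .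
  qed
  then have 2: "compact_object U T (((E \<boxtimes> D) \<boxtimes> A) \<boxtimes> D)" by (rule compact_tensor_dual)
  have "compact_object U T (E \<boxtimes> D)"
    by (rule compact_object_retract[OF 2 _ _, where s = "adj_unit E \<boxdot> id\<^sub>T D" and
          r = "runit (E \<boxtimes> D) \<cdot> (id\<^sub>T (E \<boxtimes> D) \<boxdot> ev' A) \<cdot> assoc (E \<boxtimes> D) A D"])
      (use adj_unit_contract[of E] in \<open>auto simp: Hom_def\<close>)
  then show ?thesis
    by (rule compact_object_retract[where s = "lunit' D" and r = "lunit D"]) (auto simp: Hom_def)
qed

end

section \<open>The canonical map to the double dual\<close>

context closed_tensor_triangulated_category
begin

definition double_dual :: "'o \<Rightarrow> 'm" where
  "double_dual A = Adj T A (du A) E (ev' A)"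

lemma double_dual_hom: "A \<in> Obj T \<Longrightarrow> double_dual A \<in> Hom T A (du (du A))"
  unfolding double_dual_def dual_def [of T "du A"] by (rule adj_hom) (auto simp: Hom_def)

lemma ev_double_dual:
  assumes A: "A \<in> Obj T"
  shows "ev (du A) \<cdot> (double_dual A \<boxdot> id\<^sub>T (du A)) = ev' A"
proof (rule adj_inj)
  show "Adj T A (du A) E (ev (du A) \<cdot> (double_dual A \<boxdot> id\<^sub>T (du A))) = Adj T A (du A) E (ev' A)"
    using adj_ev[OF dual_obj[OF A] double_dual_hom[OF A]] by (simp add: double_dual_def)
qed (use A in_HomD[OF double_dual_hom[OF A]] in \<open>auto simp: Hom_def\<close>)

text \<open>By naturality of the adjunction, composing \<open>rigid_map T A A\<close> with
  \<open>\<eta>\<close> amounts to inserting \<open>\<eta>\<close> into the uncurried map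
  \<open>?\<rho>\<close>. The required equation is thus the uncurried form of
  \<open>rigid_map T A A \<cdot> \<eta> = Adj T E A A (lunit A)\<close>.\<close>

lemma rigid_object_ex:
  assumes A: "A \<in> Obj T" and iso: "iso_arr T (rigid_map T A A)"
  shows "\<exists>\<eta>. rigid_object T A \<eta>"
proof -
  let ?D = "du A"
  let ?\<rho> = "lunit A \<cdot> (ev A \<boxdot> id\<^sub>T A) \<cdot> assoc' ?D A A \<cdot> (id\<^sub>T ?D \<boxdot> braid A A) \<cdot> assoc ?D A A"
  have \<rho>: "?\<rho> \<in> Hom T ((?D \<boxtimes> A) \<boxtimes> A) A" using A by (auto simp: Hom_def)
  have r: "rigid_map T A A = Adj T (?D \<boxtimes> A) A A ?\<rho>" by (simp add: rigid_map_def)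
  have rh: "rigid_map T A A \<in> Hom T (?D \<boxtimes> A) (IHom T A A)" unfolding r by (rule adj_hom[OF \<rho>]) (use A in auto)
  obtain k where k: "k \<in> Hom T (IHom T A A) (?D \<boxtimes> A)" "rigid_map T A A \<cdot> k = id\<^sub>T (IHom T A A)"
    using iso_arrE[OF iso rh] by metis
  have l: "lunit A \<in> Hom T (E \<boxtimes> A) A" using A by (auto simp: Hom_def)
  have al: "Adj T E A A (lunit A) \<in> Hom T E (IHom T A A)" by (rule adj_hom[OF l]) (use A in auto)
  define \<eta> where "\<eta> = k \<cdot> Adj T E A A (lunit A)"
  have \<eta>: "\<eta> \<in> Hom T E (?D \<boxtimes> A)" unfolding \<eta>_def by (rule comp_closed[OF al k(1)])
  note \<eta>' = in_HomD[OF \<eta>]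
  have "Adj T E A A (?\<rho> \<cdot> (\<eta> \<boxdot> id\<^sub>T A)) = rigid_map T A A \<cdot> \<eta>"
    unfolding r by (rule adj_nat[OF \<eta> \<rho> A])
  also have "\<dots> = Adj T E A A (lunit A)"
    unfolding \<eta>_def using comp_assoc[OF al k(1) rh] k(2) ident_comp[OF al] by simp
  finally have "?\<rho> \<cdot> (\<eta> \<boxdot> id\<^sub>T A) = lunit A"
    by (rule adj_inj[rotated 4]) (use A \<eta>' in \<open>auto simp: Hom_def\<close>)
  then have "rigid_object T A \<eta>"
    by unfold_locales (use A \<eta> \<eta>' in \<open>simp_all\<close>)
  then show ?thesis ..
qed

end

text \<open>The inverse inserts a coevaluation next to \<open>du D\<close> and evaluates
  \<open>du D\<close> on \<open>D\<close>. One composite reduces to \<open>triangle_A\<close>; the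
  other ends in \<open>du D\<close> and is tested after evaluation, where
  \<open>transpose_inverse\<close> applies.\<close>

lemma (in rigid_object) double_dual_iso: "iso_arr T (double_dual A)"
proof (rule iso_arrI)
  let ?\<kappa> = "lunit A \<cdot> (ev D \<boxdot> id\<^sub>T A) \<cdot> adj_unit (du D)"
  show d: "double_dual A \<in> Hom T A (du D)" by (rule double_dual_hom[OF A])
  note d' [simp] = in_HomD[OF d]
  show \<kappa>: "?\<kappa> \<in> Hom T (du D) A" by (auto simp: Hom_def)
  have "?\<kappa> \<cdot> double_dual A = lunit A \<cdot> (ev D \<boxdot> id\<^sub>T A) \<cdot> (adj_unit (du D) \<cdot> double_dual A)" by simp
  also have "\<dots> = lunit A \<cdot> ((ev D \<cdot> (double_dual A \<boxdot> id\<^sub>T D)) \<boxdot> id\<^sub>T A) \<cdot> adj_unit A"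
    unfolding adj_unit_nat[OF d] by (simp add: interchange_tail)
  also have "\<dots> = (lunit A \<cdot> (ev' A \<boxdot> id\<^sub>T A) \<cdot> assoc' A D A \<cdot> (id\<^sub>T A \<boxdot> \<eta>)) \<cdot> runit' A"
    unfolding ev_double_dual[OF A] by (simp add: adj_unit_def)
  also have "\<dots> = id\<^sub>T A" unfolding triangle_A by simp
  finally show "?\<kappa> \<cdot> double_dual A = id\<^sub>T A" .
  have "ev D \<cdot> ((double_dual A \<cdot> ?\<kappa>) \<boxdot> id\<^sub>T D) = (ev D \<cdot> (double_dual A \<boxdot> id\<^sub>T D)) \<cdot> (?\<kappa> \<boxdot> id\<^sub>T D)"
    by (simp add: interchange)
  also have "\<dots> = (ev' A \<cdot> (lunit A \<boxdot> id\<^sub>T D)) \<cdot> (((ev D \<boxdot> id\<^sub>T A) \<cdot> adj_unit (du D)) \<boxdot> id\<^sub>T D)"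
    unfolding ev_double_dual[OF A] by (simp add: interchange)
  also have "\<dots> = runit E \<cdot> (id\<^sub>T E \<boxdot> ev' A) \<cdot> assoc E A D \<cdot> (((ev D \<boxdot> id\<^sub>T A) \<cdot> adj_unit (du D)) \<boxdot> id\<^sub>T D)"
    unfolding ev'_lunit by simp
  also have "\<dots> = ev D" by (rule transpose_inverse) (auto simp: Hom_def)
  also have "\<dots> = ev D \<cdot> (id\<^sub>T (du D) \<boxdot> id\<^sub>T D)" by simp
  finally show "double_dual A \<cdot> ?\<kappa> = id\<^sub>T (du D)"
    by (rule ev_cancel[rotated 3]) (use comp_closed[OF \<kappa> d] ident_closed[of "du D"] in auto)
qed

section \<open>The duality on compact objects\<close>

context closed_tensor_triangulated_category
begin

lemma tens_add_left:
  assumes "f \<in> Hom T X X'" "g \<in> Hom T X X'" "Y \<in> Obj T"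
  shows "(f \<boxplus> g) \<boxdot> id\<^sub>T Y = (f \<boxdot> id\<^sub>T Y) \<boxplus> (g \<boxdot> id\<^sub>T Y)"
  using tens_exact_left[OF assms(3)] assms(1,2) hom_obj[OF assms(1)]
  unfolding exact_functor_def additive_functor_def by auto

lemma tens_add_right:
  assumes "f \<in> Hom T Y Y'" "g \<in> Hom T Y Y'" "X \<in> Obj T"
  shows "id\<^sub>T X \<boxdot> (f \<boxplus> g) = (id\<^sub>T X \<boxdot> f) \<boxplus> (id\<^sub>T X \<boxdot> g)"
  using tens_exact_right[OF assms(3)] assms(1,2) hom_obj[OF assms(1)]
  unfolding exact_functor_def additive_functor_def by auto

lemma tens_zero_left:
  assumes "X \<in> Obj T" "X' \<in> Obj T" "Y \<in> Obj T"
  shows "Zero T X X' \<boxdot> id\<^sub>T Y = Zero T (X \<boxtimes> Y) (X' \<boxtimes> Y)"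
proof (rule add_self_zero)
  note z = zero_closed[OF assms(1,2)]
  show "Zero T X X' \<boxdot> id\<^sub>T Y \<in> Hom T (X \<boxtimes> Y) (X' \<boxtimes> Y)" using assms by (simp add: Hom_def)
  show "(Zero T X X' \<boxdot> id\<^sub>T Y) \<boxplus> (Zero T X X' \<boxdot> id\<^sub>T Y) = Zero T X X' \<boxdot> id\<^sub>T Y"
    using tens_add_left[OF z z assms(3)] add_zero[OF z] by simp
qed

text \<open>A bijection natural in \<open>X\<close> between additive functors of \<open>X\<close> is additive: the pair \<open>(s, t)\<close>
  comes from a single arrow out of \<open>(X \<oplus> X) \<otimes> Y\<close>, and \<open>s \<boxplus> t\<close> is its restriction along the diagonal.\<close>

lemma adj_add:
  assumes s: "s \<in> Hom T (X \<boxtimes> Y) Z" and t: "t \<in> Hom T (X \<boxtimes> Y) Z"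
    and X: "X \<in> Obj T" and Y: "Y \<in> Obj T"
  shows "Adj T X Y Z (s \<boxplus> t) = Adj T X Y Z s \<boxplus> Adj T X Y Z t"
proof -
  have Z: "Z \<in> Obj T" using hom_obj[OF s] by blast
  obtain S i j p q where S: "S \<in> Obj T" and i: "i \<in> Hom T X S" and j: "j \<in> Hom T X S"
    and p: "p \<in> Hom T S X" and q: "q \<in> Hom T S X"
    and pi: "p \<cdot> i = id\<^sub>T X" "q \<cdot> j = id\<^sub>T X" "p \<cdot> j = Zero T X X" "q \<cdot> i = Zero T X X"
    using has_biproducts[OF X X] by blast
  note H = in_HomD[OF s] in_HomD[OF t] in_HomD[OF i] in_HomD[OF j] in_HomD[OF p] in_HomD[OF q] X Y Z S
  have pY: "s \<cdot> (p \<boxdot> id\<^sub>T Y) \<in> Hom T (S \<boxtimes> Y) Z" "t \<cdot> (q \<boxdot> id\<^sub>T Y) \<in> Hom T (S \<boxtimes> Y) Z"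
    using H by (auto intro: in_HomI)
  \<comment> \<open>\<open>w\<close> restricts to \<open>s\<close> along \<open>i\<close> and to
    \<open>t\<close> along \<open>j\<close>, hence to \<open>s \<boxplus> t\<close> along the
    diagonal \<open>i \<boxplus> j\<close>.\<close>
  define w where "w = s \<cdot> (p \<boxdot> id\<^sub>T Y) \<boxplus> t \<cdot> (q \<boxdot> id\<^sub>T Y)"
  have w: "w \<in> Hom T (S \<boxtimes> Y) Z" unfolding w_def by (rule add_closed[OF pY])
  have iY: "i \<boxdot> id\<^sub>T Y \<in> Hom T (X \<boxtimes> Y) (S \<boxtimes> Y)" "j \<boxdot> id\<^sub>T Y \<in> Hom T (X \<boxtimes> Y) (S \<boxtimes> Y)"
    using H by (auto intro: in_HomI)
  have wi: "w \<cdot> (i \<boxdot> id\<^sub>T Y) = s"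
    unfolding w_def using comp_add[OF iY(1) pY] H pi tens_zero_left[OF X X Y] add_zero[OF s]
    by (simp add: interchange)
  have wj: "w \<cdot> (j \<boxdot> id\<^sub>T Y) = t"
    unfolding w_def using comp_add[OF iY(2) pY] H pi tens_zero_left[OF X X Y] zero_add[OF t]
    by (simp add: interchange)
  note aw = adj_hom[OF w S Y]
  have "w \<cdot> ((i \<boxplus> j) \<boxdot> id\<^sub>T Y) = s \<boxplus> t"
    using tens_add_left[OF i j Y] add_comp[OF iY w] wi wj by simp
  then have "Adj T X Y Z (s \<boxplus> t) = Adj T S Y Z w \<cdot> (i \<boxplus> j)"
    using adj_nat[OF add_closed[OF i j] w Y] by simp
  also have "\<dots> = Adj T S Y Z w \<cdot> i \<boxplus> Adj T S Y Z w \<cdot> j" by (rule add_comp[OF i j aw])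
  also have "\<dots> = Adj T X Y Z s \<boxplus> Adj T X Y Z t"
    using adj_nat[OF i w Y] adj_nat[OF j w Y] wi wj by simp
  finally show ?thesis .
qed

lemma dual_arr_hom: "f \<in> Hom T A B \<Longrightarrow> dual_arr T f \<in> Hom T (du B) (du A)"
  unfolding dual_arr_def dual_def by (rule ihom_arr) (auto simp: ident_closed)

lemma dual_arr_adj:
  assumes f: "f \<in> Hom T A B"
  shows "dual_arr T f = Adj T (du B) A E (ev B \<cdot> (id\<^sub>T (du B) \<boxdot> f))"
proof -
  have B: "B \<in> Obj T" using hom_obj[OF f] by blast
  note F = in_HomD[OF f] in_HomD[OF dual_arr_hom[OF f]]
  have "Adj T (du B) A E (id\<^sub>T E \<cdot> (ev B \<cdot> (id\<^sub>T (du B) \<boxdot> f))) =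
      dual_arr T f \<cdot> (Adj T (du B) B E (ev B) \<cdot> id\<^sub>T (du B))"
    unfolding dual_arr_def by (rule adj_natural[OF _ f _ ev(1)[OF B]]) (auto simp: ident_closed B)
  then show ?thesis using F B ev(2)[OF B] by simp
qed

lemma ev_dual_arr:
  assumes f: "f \<in> Hom T A B"
  shows "ev A \<cdot> (dual_arr T f \<boxdot> id\<^sub>T A) = ev B \<cdot> (id\<^sub>T (du B) \<boxdot> f)"
proof -
  have A: "A \<in> Obj T" and B: "B \<in> Obj T" using hom_obj[OF f] by auto
  note F = in_HomD[OF f] in_HomD[OF dual_arr_hom[OF f]]
  have "Adj T (du B) A E (ev A \<cdot> (dual_arr T f \<boxdot> id\<^sub>T A)) = Adj T (du B) A E (ev B \<cdot> (id\<^sub>T (du B) \<boxdot> f))"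
    using adj_ev[OF A dual_arr_hom[OF f]] dual_arr_adj[OF f] by simp
  then show ?thesis by (rule adj_inj[rotated 4]) (use A B F in \<open>auto simp: Hom_def\<close>)
qed

lemma dual_arr_comp:
  assumes f: "f \<in> Hom T A B" and g: "g \<in> Hom T B C"
  shows "dual_arr T (g \<cdot> f) = dual_arr T f \<cdot> dual_arr T g"
  using ihom_comp[OF g f ident_closed[OF tensor_simps(1)] ident_closed[OF tensor_simps(1)]]
  by (simp add: dual_arr_def)

lemma dual_arr_ident: "A \<in> Obj T \<Longrightarrow> dual_arr T (id\<^sub>T A) = id\<^sub>T (du A)"
  by (simp add: dual_arr_def dual_def ihom_ident)

text \<open>Additivity of the internal hom is not one of its axioms. The description of the dual
  arrow as an adjunct reduces it to additivity of the tensor product and of the adjunction.\<close>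

lemma dual_arr_add:
  assumes f: "f \<in> Hom T A B" and g: "g \<in> Hom T A B"
  shows "dual_arr T (f \<boxplus> g) = dual_arr T f \<boxplus> dual_arr T g"
proof -
  have A: "A \<in> Obj T" and B: "B \<in> Obj T" using hom_obj[OF f] by auto
  have Bf: "id\<^sub>T (du B) \<boxdot> f \<in> Hom T (du B \<boxtimes> A) (du B \<boxtimes> B)" "id\<^sub>T (du B) \<boxdot> g \<in> Hom T (du B \<boxtimes> A) (du B \<boxtimes> B)"
    using in_HomD[OF f] in_HomD[OF g] B by (auto intro: in_HomI)
  show ?thesis
    unfolding dual_arr_adj[OF f] dual_arr_adj[OF g] dual_arr_adj[OF add_closed[OF f g]]
    using tens_add_right[OF f g dual_obj[OF B]] add_comp[OF Bf ev(1)[OF B]]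
      adj_add[OF comp_closed[OF Bf(1) ev(1)[OF B]] comp_closed[OF Bf(2) ev(1)[OF B]] dual_obj[OF B] A] by simp
qed

text \<open>Adjunction and braiding identify \<open>Hom (A, du (du B))\<close> with
  \<open>Hom (A \<boxtimes> du B, E)\<close>, \<open>Hom (du B \<boxtimes> A, E)\<close> and
  \<open>Hom (du B, du A)\<close>. Under these bijections dualising \<open>f\<close> is composition
  with \<open>double_dual B\<close>, so it is bijective on hom sets once
  \<open>double_dual B\<close> is invertible.\<close>

lemma double_dual_comp_eq_iff:
  assumes f: "f \<in> Hom T A B" and m: "m \<in> Hom T (du B) (du A)"
  shows "double_dual B \<cdot> f = Adj T A (du B) E (ev A \<cdot> (m \<boxdot> id\<^sub>T A) \<cdot> braid A (du B)) \<longleftrightarrow> dual_arr T f = m"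
proof -
  have A: "A \<in> Obj T" and B: "B \<in> Obj T" using hom_obj[OF f] by auto
  note H = in_HomD[OF f] in_HomD[OF m] A B
  have e: "ev' B \<in> Hom T (B \<boxtimes> du B) E" using B by (auto simp: Hom_def)
  have l: "ev B \<cdot> (id\<^sub>T (du B) \<boxdot> f) \<in> Hom T (du B \<boxtimes> A) E" and r: "ev A \<cdot> (m \<boxdot> id\<^sub>T A) \<in> Hom T (du B \<boxtimes> A) E"
    using H by (auto simp: Hom_def)
  have b: "braid A (du B) \<in> Hom T (A \<boxtimes> du B) (du B \<boxtimes> A)" using H by (auto simp: Hom_def)
  have "ev' B \<cdot> (f \<boxdot> id\<^sub>T (du B)) = (ev B \<cdot> (id\<^sub>T (du B) \<boxdot> f)) \<cdot> braid A (du B)"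
    using braid_nat[of f "id\<^sub>T (du B)"] H by (simp add: ev'_def)
  then have "double_dual B \<cdot> f = Adj T A (du B) E ((ev B \<cdot> (id\<^sub>T (du B) \<boxdot> f)) \<cdot> braid A (du B))"
    using adj_nat[OF f e dual_obj[OF B]] by (simp add: double_dual_def)
  moreover have "ev A \<cdot> (m \<boxdot> id\<^sub>T A) \<cdot> braid A (du B) = (ev A \<cdot> (m \<boxdot> id\<^sub>T A)) \<cdot> braid A (du B)"
    using H by simp
  ultimately have "double_dual B \<cdot> f = Adj T A (du B) E (ev A \<cdot> (m \<boxdot> id\<^sub>T A) \<cdot> braid A (du B)) \<longleftrightarrow>
      (ev B \<cdot> (id\<^sub>T (du B) \<boxdot> f)) \<cdot> braid A (du B) = (ev A \<cdot> (m \<boxdot> id\<^sub>T A)) \<cdot> braid A (du B)"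
    using adj_inj[OF comp_closed[OF b l] comp_closed[OF b r] A dual_obj[OF B]] by auto
  also have "\<dots> \<longleftrightarrow> ev B \<cdot> (id\<^sub>T (du B) \<boxdot> f) = ev A \<cdot> (m \<boxdot> id\<^sub>T A)"
    using iso_cancel_right[OF structure_isos(4)[OF A dual_obj[OF B]] b l r] by auto
  also have "\<dots> \<longleftrightarrow> ev A \<cdot> (dual_arr T f \<boxdot> id\<^sub>T A) = ev A \<cdot> (m \<boxdot> id\<^sub>T A)"
    unfolding ev_dual_arr[OF f] ..
  also have "\<dots> \<longleftrightarrow> dual_arr T f = m"
    using ev_cancel[OF A dual_arr_hom[OF f] m] by auto
  finally show ?thesis .
qed

lemma dual_arr_inj:
  assumes "iso_arr T (double_dual B)" and f: "f \<in> Hom T A B" and g: "g \<in> Hom T A B"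
    and "dual_arr T f = dual_arr T g"
  shows "f = g"
proof -
  have B: "B \<in> Obj T" using hom_obj[OF f] by blast
  note H = in_HomD[OF f] in_HomD[OF g] in_HomD[OF double_dual_hom[OF B]]
  have "double_dual B \<cdot> f = double_dual B \<cdot> g"
    using double_dual_comp_eq_iff[OF f dual_arr_hom[OF f]] double_dual_comp_eq_iff[OF g dual_arr_hom[OF f]] assms(4)
    by simp
  then show ?thesis by (rule iso_cancel_left_arr[OF assms(1)]) (use H in simp_all)
qed

lemma dual_arr_surj:
  assumes "iso_arr T (double_dual B)" and A: "A \<in> Obj T" and B: "B \<in> Obj T" and m: "m \<in> Hom T (du B) (du A)"
  shows "\<exists>f \<in> Hom T A B. dual_arr T f = m"
proof -
  let ?k = "Adj T A (du B) E (ev A \<cdot> (m \<boxdot> id\<^sub>T A) \<cdot> braid A (du B))"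
  note H = in_HomD[OF m] A B
  have k: "?k \<in> Hom T A (du (du B))"
    unfolding dual_def [of T "du B"] by (rule adj_hom) (use H in \<open>auto simp: Hom_def\<close>)
  obtain i where i: "i \<in> Hom T (du (du B)) B" "double_dual B \<cdot> i = id\<^sub>T (du (du B))"
    using iso_arrE[OF assms(1) double_dual_hom[OF B]] by metis
  have f: "i \<cdot> ?k \<in> Hom T A B" by (rule comp_closed[OF k i(1)])
  have "double_dual B \<cdot> (i \<cdot> ?k) = ?k"
    using comp_assoc[OF k i(1) double_dual_hom[OF B]] i(2) ident_comp[OF k] by simp
  then show ?thesis using double_dual_comp_eq_iff[OF f m] f by blast
qed

end

section \<open>Passage to the full subcategory of compact objects\<close>

lemma full_subcat_simps:
  "Obj (full_subcat C S) = S" "Ident (full_subcat C S) = Ident C" "Comp (full_subcat C S) = Comp C"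
  "Dom (full_subcat C S) = Dom C" "Cod (full_subcat C S) = Cod C"
  by (simp_all add: full_subcat_def)

lemma full_subcat_abcat_simps:
  fixes C :: "('o, 'm, 'x) abcat_scheme"
  shows "Add (full_subcat C S) = Add C" "Zero (full_subcat C S) = Zero C"
  by (simp_all add: full_subcat_def)

lemma Hom_full_subcat:
  "Hom (full_subcat C S) A B = {f \<in> Hom C A B. A \<in> S \<and> B \<in> S}"
  by (auto simp: Hom_def full_subcat_def)

lemma (in preadditive_category) preadditive_full_subcat:
  assumes "S \<subseteq> Obj C"
  shows "preadditive_category (full_subcat C S)"
proof (intro preadditive_category.intro preadditive_category_axioms.intro category.intro)
  fix A B assume "A \<in> Obj (full_subcat C S)" "B \<in> Obj (full_subcat C S)"
  then have "HomGrp (full_subcat C S) A B = HomGrp C A B" "A \<in> Obj C" "B \<in> Obj C"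
    using assms by (auto simp: HomGrp_def Hom_full_subcat full_subcat_simps full_subcat_abcat_simps)
  then show "comm_group (HomGrp (full_subcat C S) A B)" using hom_comm_group by simp
qed (use assms in \<open>auto simp: Hom_full_subcat full_subcat_simps full_subcat_abcat_simps ident_closed comp_closed
      comp_assoc comp_ident ident_comp comp_add add_comp\<close>, auto simp: full_subcat_def)

text \<open>Factorisations exist in the ambient category, and fullness places them in the
  subcategory.\<close>

lemma weak_kernel_full_subcat:
  assumes "weak_kernel C f g" "f \<in> Arr (full_subcat C S)" "g \<in> Arr (full_subcat C S)"
  shows "weak_kernel (full_subcat C S) f g"
  using assms unfolding weak_kernel_def Hom_full_subcat
  by (auto simp: full_subcat_simps full_subcat_abcat_simps) (auto simp: full_subcat_def)

lemma weak_cokernel_full_subcat: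
  assumes "weak_cokernel C g f" "f \<in> Arr (full_subcat C S)" "g \<in> Arr (full_subcat C S)"
  shows "weak_cokernel (full_subcat C S) g f"
  using assms unfolding weak_cokernel_def Hom_full_subcat
  by (auto simp: full_subcat_simps full_subcat_abcat_simps) (auto simp: full_subcat_def)

context rigidly_compactly_generated_ttcat
begin

lemma compact_rigid_object:
  assumes "compact_object U T A"
  obtains \<eta> where "rigid_object T A \<eta>"
proof -
  have "A \<in> Obj T" using assms by (simp add: compact_object_def)
  moreover have "iso_arr T (rigid_map T A A)"
    using compacts_rigid[of A A] assms by (simp add: compacts_def full_subcat_simps)
  ultimately show ?thesis using rigid_object_ex that by blast
qed

lemma compact_dual_object:
  assumes "compact_object U T A"
  shows "compact_object U T (du A)"
proof -
  obtain \<eta> where "rigid_object T A \<eta>" using compact_rigid_object[OF assms] .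
  then show ?thesis by (rule rigid_object.compact_dual[OF _ assms])
qed

lemma compact_double_dual_iso:
  assumes "compact_object U T A"
  shows "iso_arr T (double_dual A)"
proof -
  obtain \<eta> where "rigid_object T A \<eta>" using compact_rigid_object[OF assms] .
  then show ?thesis by (rule rigid_object.double_dual_iso)
qed

lemma Hom_compacts:
  "Hom (compacts U T) A B = {f \<in> Hom T A B. compact_object U T A \<and> compact_object U T B}"
  by (simp add: compacts_def Hom_full_subcat)

lemma compacts_simps:
  "Obj (compacts U T) = {A. compact_object U T A}" "Ident (compacts U T) = Ident T" "Comp (compacts U T) = Comp T"
  "Dom (compacts U T) = Dom T" "Cod (compacts U T) = Cod T" "Add (compacts U T) = Add T" "Zero (compacts U T) = Zero T"
  by (simp_all add: compacts_def full_subcat_simps full_subcat_abcat_simps)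

lemma compacts_arr_iff:
  "f \<in> Arr (compacts U T) \<longleftrightarrow> f \<in> Arr T \<and> compact_object U T (Dom T f) \<and> compact_object U T (Cod T f)"
  by (auto simp: compacts_def full_subcat_def)

lemma compacts_duality: "preadditive_duality (compacts U T) (dual T) (dual_arr T)"
proof -
  have co: "compact_object U T A \<Longrightarrow> A \<in> Obj T" for A by (simp add: compact_object_def)
  interpret K: preadditive_category "compacts U T"
    unfolding compacts_def by (rule preadditive_full_subcat) (auto simp: co)
  show ?thesis
  proof unfold_locales
    fix f g A B C assume "f \<in> Hom (compacts U T) A B"
    then have f: "f \<in> Hom T A B" and AB: "compact_object U T A" "compact_object U T B" by (auto simp: Hom_compacts)
    show "dual_arr T f \<in> Hom (compacts U T) (du B) (du A)"
      using dual_arr_hom[OF f] AB by (simp add: Hom_compacts compact_dual_object)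
    show "dual_arr T (g \<cdot>\<^bsub>compacts U T\<^esub> f) = dual_arr T f \<cdot>\<^bsub>compacts U T\<^esub> dual_arr T g"
      if "g \<in> Hom (compacts U T) B C"
      using dual_arr_comp[OF f, of g C] that by (simp add: Hom_compacts compacts_simps)
    assume "g \<in> Hom (compacts U T) A B"
    then have g: "g \<in> Hom T A B" by (simp add: Hom_compacts)
    show "dual_arr T (f \<boxplus>\<^bsub>compacts U T\<^esub> g) = dual_arr T f \<boxplus>\<^bsub>compacts U T\<^esub> dual_arr T g"
      using dual_arr_add[OF f g] by (simp add: compacts_simps)
    show "dual_arr T f = dual_arr T g \<Longrightarrow> f = g"
      by (rule dual_arr_inj[OF compact_double_dual_iso[OF AB(2)] f g])
  next
    fix A assume "A \<in> Obj (compacts U T)"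
    then have A: "compact_object U T A" by (simp add: compacts_simps)
    show "du A \<in> Obj (compacts U T)" using compact_dual_object[OF A] by (simp add: compacts_simps)
    show "dual_arr T (Ident (compacts U T) A) = Ident (compacts U T) (du A)"
      using dual_arr_ident[OF co[OF A]] by (simp add: compacts_simps)
    have d: "double_dual A \<in> Hom T A (du (du A))" by (rule double_dual_hom[OF co[OF A]])
    have dc: "compact_object U T (du A)" "compact_object U T (du (du A))" using A compact_dual_object by auto
    obtain i where i: "i \<in> Hom T (du (du A)) A" "i \<cdot> double_dual A = id\<^sub>T A" "double_dual A \<cdot> i = id\<^sub>T (du (du A))"
      using iso_arrE[OF compact_double_dual_iso[OF A] d] by metis
    have "iso_arr (compacts U T) (double_dual A)"
      by (rule K.iso_arrI[of _ A "du (du A)" i]) (use d i A dc in \<open>auto simp: Hom_compacts compacts_simps\<close>)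
    then have "iso_objs (compacts U T) A (du (du A))"
      using d A dc by (auto simp: iso_objs_def Hom_compacts)
    then show "\<exists>B \<in> Obj (compacts U T). iso_objs (compacts U T) A (du B)"
      using dc by (auto simp: compacts_simps)
  next
    fix A B m
    assume "A \<in> Obj (compacts U T)" "B \<in> Obj (compacts U T)" "m \<in> Hom (compacts U T) (du B) (du A)"
    then have A: "compact_object U T A" and B: "compact_object U T B" and m: "m \<in> Hom T (du B) (du A)"
      by (auto simp: compacts_simps Hom_compacts)
    show "\<exists>f \<in> Hom (compacts U T) A B. dual_arr T f = m"
      using dual_arr_surj[OF compact_double_dual_iso[OF B] co[OF A] co[OF B] m] A B by (auto simp: Hom_compacts)
  next
    fix f assume f: "f \<in> Arr (compacts U T)"
    then have fT: "f \<in> Arr T" and A: "compact_object U T (Dom T f)" and B: "compact_object U T (Cod T f)"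
      by (auto simp: compacts_arr_iff)
    \<comment> \<open>The triangle on \<open>f\<close> stays among the compact objects: its third
      object is compact as a cone, and its last one as a suspension.\<close>
    obtain g h where t: "(f, g, h) \<in> Tri T" using tri_complete[OF fT] by blast
    note t' = triD[OF t]
    have S: "compact_object U T (\<Sigma>\<^sub>o (Dom T f))" by (rule compact_object_sus[OF A])
    have C: "compact_object U T (Cod T g)" by (rule compact_object_cone[OF t B S])
    have g: "g \<in> Arr (compacts U T)" and h: "h \<in> Arr (compacts U T)"
      using t' B C S by (auto simp: compacts_arr_iff)
    \<comment> \<open>The conditions on \<open>g\<close> and \<open>h\<close> come from the rotated
      triangle, whose first two arrows they are.\<close>
    have "weak_kernel (compacts U T) f g" "weak_kernel (compacts U T) g h"
      using tri_weak_kernel[OF t] tri_weak_kernel[OF tri_rotate_left[OF t]] f g h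
      unfolding compacts_def by (auto intro: weak_kernel_full_subcat)
    moreover have "weak_cokernel (compacts U T) g f" "weak_cokernel (compacts U T) h g"
      using tri_weak_cokernel[OF t] tri_weak_cokernel[OF tri_rotate_left[OF t]] f g h
      unfolding compacts_def by (auto intro: weak_cokernel_full_subcat)
    ultimately show "\<exists>g h. weak_kernel (compacts U T) f g \<and> weak_kernel (compacts U T) g h \<and>
        weak_cokernel (compacts U T) g f \<and> weak_cokernel (compacts U T) h g" by blast
  qed
qed

end

theorem proposition4p3:
  fixes T :: "('o, 'm) ttcat" and U :: "'u set"
  assumes "rigidly_compactly_generated_ttcat T U"
  shows "\<exists>D :: (('o, 'm, 'm set) presheaf,
                 ('o, 'm, 'm set) presheaf \<times> ('o \<Rightarrow> 'm set \<Rightarrow> 'm set) \<times> ('o, 'm, 'm set) presheaf,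
                 ('o, 'm, 'm set) presheaf,
                 ('o, 'm, 'm set) presheaf \<times> ('o \<Rightarrow> 'm set \<Rightarrow> 'm set) \<times> ('o, 'm, 'm set) presheaf) ftr.
           contravariant_equivalence (mod_cat (compacts U T)) (mod_cat (compacts U T)) D \<and>
           (\<forall>f \<in> Arr (compacts U T).
              presheaf_iso (compacts U T)
                (OnObj D (coker_functor (compacts U T) f))
                (ker_functor (compacts U T) (dual_arr T f)))"
proof -
  interpret rigidly_compactly_generated_ttcat T U by fact
  interpret K: preadditive_duality "compacts U T" "dual T" "dual_arr T" by (rule compacts_duality)
  show ?thesis
    using K.dual_ftr_contravariant_equivalence K.dual_ftr_coker by blast
qed

end
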